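(* Algorithm 1 (the triangulation algorithm described in the context), applied to a set of $n \ge 2$ cameras $P = \{P_1,\dots,P_n\}$ and an image observation vector $\widehat{x}\in\mathbb{R}^{2n}$, terminates in time polynomial in $n$.
   Context: Setting. Let $n\ge 2$ and let $P_1,\dots,P_n\in\mathbb{R}^{3\times 4}$ be projective cameras (rank $3$ matrices) with pairwise distinct centers, the center of $P_i$ being its one-dimensional kernel viewed as a point of projective $3$-space. For a vector $y$, $\tilde y=[y;1]$ (append a last entry $1$). $\Pi[u;v;w]=[u/w;v/w]$. $\mathcal{S}^k$ is the space of real symmetric $k\times k$ matrices with inner product $\langle A,B\rangle=\sum_{i,j}A_{ij}B_{ij}$, and $\mathcal{S}^k_+$ is the cone of positive semidefinite ones. Write $x=[x_1;\dots;x_n]\in\mathbb{R}^{2n}$ with $x_i\in\mathbb{R}^2$. For $i<j$ let $f_{ij}(x)=\tilde x_i^\top\Phi_{ij}\tilde x_j$, where $\Phi_{ij}\in\mathbb{R}^{3\times3}$ is the fundamental matrix of cameras $i,j$, i.e. up to a nonzero scalar the rank-2 matrix given by $\tilde x_i^\top \Phi_{ij}\tilde x_j=\det\begin{bmatrix}P_i&\tilde x_i&0\\P_j&0&\tilde x_j\end{bmatrix}$. Let $F_{ij}\in\mathcal{S}^{2n+1}$ be the symmetric matrix with $f_{ij}(x)=\tilde x^\top F_{ij}\tilde x$, and let $H_{ij}\in\mathcal{S}^{2n}$ be its top left $2n\times 2n$ block. Let $G=\begin{bmatrix}I&-\widehat x\\-\widehat x^\top&\|\widehat x\|^2\end{bmatrix}\in\mathcal{S}^{2n+1}$,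 and let $E\in\mathcal{S}^{2n+1}$ be zero except for its bottom right entry, which is $1$. Primal SDP: minimize $\langle G,Y\rangle$ subject to $\langle F_{ij},Y\rangle=0$ ($1\le i<j\le n$), $\langle E,Y\rangle=1$, $Y\in\mathcal{S}^{2n+1}_+$. Dual SDP: maximize $\rho$ subject to $G+\sum_{i<j}\lambda_{ij}F_{ij}-\rho E\succeq0$, $\lambda_{ij},\rho\in\mathbb{R}$. Algorithm 1. Input: $\widehat x\in\mathbb{R}^{2n}$ and the cameras $P$. 1. Solve the primal and dual SDPs to optimal $Y^*$, $\lambda_{ij}^*$, $\rho^*$. 2. Let $x$ be the last column of $Y^*$ without its last entry. 3. Determine a world point $X\in\mathbb{R}^3$ from $x$ by the linear SVD algorithm: stack, for each $i$, the two linear equations in $Z\in\mathbb{R}^4$ obtained by clearing denominators in $x_i=\Pi P_iZ$, take a right singular vector $Z$ for the smallest singular value of the resulting $2n\times4$ matrix, and dehomogenize. 4. If $I+\sum\lambda^*_{ij}H_{ij}\succ0$: (a) if $n=2$, or $n\ge4$ and the camera centers are not co-planar, return (OPTIMAL, $X$); (b) if $x_i=\Pi P_i\tilde X$ for all $i$, return (OPTIMAL, $X$). 5. Otherwise return (SUBOPTIMAL, $X$). Computational convention: "solving" an SDP means solving it to a prescribed arbitrary precision by a semidefinite programming solver whose running time is polynomial in the size of the description of the SDP; eigenvalue and singular value decompositions of a matrix are computed in time polynomial in its size. *)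

theory Defs
  imports
    Complex_Main
    "HOL-Computational_Algebra.Polynomial"
    "Jordan_Normal_Form.Determinant"
    "Jordan_Normal_Form.Matrix_Kernel"
    "Jordan_Normal_Form.DL_Rank"
begin

section \<open>Matrices\<close>

definition inner_mat :: "real mat \<Rightarrow> real mat \<Rightarrow> real" where
  "inner_mat A B = (\<Sum>i<dim_row A. \<Sum>j<dim_col A. A $$ (i,j) * B $$ (i,j))"

definition sym_mat :: "nat \<Rightarrow> real mat \<Rightarrow> bool" where
  "sym_mat k A \<longleftrightarrow> A \<in> carrier_mat k k \<and> transpose_mat A = A"

definition psd_mat :: "nat \<Rightarrow> real mat \<Rightarrow> bool" where
  "psd_mat k A \<longleftrightarrow> sym_mat k A \<and> (\<forall>v \<in> carrier_vec k. v \<bullet> (A *\<^sub>v v) \<ge> 0)"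

definition pd_mat :: "nat \<Rightarrow> real mat \<Rightarrow> bool" where
  "pd_mat k A \<longleftrightarrow>
     sym_mat k A \<and> (\<forall>v \<in> carrier_vec k. v \<noteq> 0\<^sub>v k \<longrightarrow> v \<bullet> (A *\<^sub>v v) > 0)"

text \<open>Unlike \<^const>\<open>orthogonal_mat\<close>, the columns have to be orthonormal.\<close>

definition orthonormal_mat :: "nat \<Rightarrow> real mat \<Rightarrow> bool" where
  "orthonormal_mat k U \<longleftrightarrow> U \<in> carrier_mat k k \<and> transpose_mat U * U = 1\<^sub>m k"

definition eigendecomposition :: "nat \<Rightarrow> real mat \<Rightarrow> real mat \<Rightarrow> real vec \<Rightarrow> bool" where
  "eigendecomposition k A Q d \<longleftrightarrow>
     orthonormal_mat k Q \<and> d \<in> carrier_vec k \<and>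
     A = Q * mat k k (\<lambda>(i,j). if i = j then d $ i else 0) * transpose_mat Q"

definition singular_value_decomposition ::
  "nat \<Rightarrow> nat \<Rightarrow> real mat \<Rightarrow> real mat \<Rightarrow> real vec \<Rightarrow> real mat \<Rightarrow> bool" where
  "singular_value_decomposition r c A U \<sigma> V \<longleftrightarrow>
     orthonormal_mat r U \<and> orthonormal_mat c V \<and>
     \<sigma> \<in> carrier_vec (min r c) \<and> (\<forall>i < min r c. \<sigma> $ i \<ge> 0) \<and>
     A = U * mat r c (\<lambda>(i,j). if i = j then \<sigma> $ i else 0) * transpose_mat V"


section \<open>Semidefinite programs\<close>

text \<open>
  \<open>SDP C [(A\<^sub>0,b\<^sub>0), \<dots>]\<close> is the pair of programs
  minimize \<open>\<langle>C,Y\<rangle>\<close> subject to \<open>\<langle>A\<^sub>k,Y\<rangle> = b\<^sub>k\<close> and \<open>Y\<close> positive semidefinite;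
  maximize \<open>\<Sum> b\<^sub>k y\<^sub>k\<close> subject to \<open>C - \<Sum> y\<^sub>k A\<^sub>k\<close> positive semidefinite.
\<close>

datatype sdp = SDP (objective: "real mat") (constraints: "(real mat \<times> real) list")

definition sdp_dim :: "sdp \<Rightarrow> nat" where
  "sdp_dim S = dim_row (objective S)"

definition sdp_wf :: "sdp \<Rightarrow> bool" where
  "sdp_wf S \<longleftrightarrow> sym_mat (sdp_dim S) (objective S) \<and>
     (\<forall>(A, b) \<in> set (constraints S). sym_mat (sdp_dim S) A)"

text \<open>The number of reals needed to write down the program.\<close>

definition sdp_size :: "sdp \<Rightarrow> nat" where
  "sdp_size S = (sdp_dim S)\<^sup>2 + length (constraints S) * ((sdp_dim S)\<^sup>2 + 1)"

definition primal_feasible :: "sdp \<Rightarrow> real mat \<Rightarrow> bool" where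
  "primal_feasible S Y \<longleftrightarrow> psd_mat (sdp_dim S) Y \<and>
     (\<forall>(A, b) \<in> set (constraints S). inner_mat A Y = b)"

definition dual_slack :: "sdp \<Rightarrow> real vec \<Rightarrow> real mat" where
  "dual_slack S y = mat (sdp_dim S) (sdp_dim S) (\<lambda>(r,c). objective S $$ (r,c) -
     (\<Sum>k<length (constraints S). y $ k * fst (constraints S ! k) $$ (r,c)))"

definition dual_feasible :: "sdp \<Rightarrow> real vec \<Rightarrow> bool" where
  "dual_feasible S y \<longleftrightarrow>
     y \<in> carrier_vec (length (constraints S)) \<and> psd_mat (sdp_dim S) (dual_slack S y)"

definition dual_objective :: "sdp \<Rightarrow> real vec \<Rightarrow> real" where
  "dual_objective S y = (\<Sum>k<length (constraints S). snd (constraints S ! k) * y $ k)"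

text \<open>
  Solutions to precision \<open>\<epsilon>\<close>: every constraint, and either optimal value, is met up to \<open>\<epsilon>\<close>.
  This is only used for programs whose primal and dual are both feasible, so that the
  infimum and the supremum are those of nonempty bounded sets.
\<close>

definition sdp_solution :: "real \<Rightarrow> sdp \<Rightarrow> real mat \<Rightarrow> real vec \<Rightarrow> bool" where
  "sdp_solution \<epsilon> S Y y \<longleftrightarrow>
     psd_mat (sdp_dim S) (Y + \<epsilon> \<cdot>\<^sub>m 1\<^sub>m (sdp_dim S)) \<and>
     sym_mat (sdp_dim S) Y \<and>
     (\<forall>(A, b) \<in> set (constraints S). \<bar>inner_mat A Y - b\<bar> \<le> \<epsilon>) \<and>
     \<bar>inner_mat (objective S) Y -
        (INF Y' \<in> {Y'. primal_feasible S Y'}. inner_mat (objective S) Y')\<bar> \<le> \<epsilon> \<and>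
     y \<in> carrier_vec (length (constraints S)) \<and>
     psd_mat (sdp_dim S) (dual_slack S y + \<epsilon> \<cdot>\<^sub>m 1\<^sub>m (sdp_dim S)) \<and>
     \<bar>dual_objective S y -
        (SUP y' \<in> {y'. dual_feasible S y'}. dual_objective S y')\<bar> \<le> \<epsilon>"


section \<open>Cameras and the triangulation programs\<close>

text \<open>Cameras are numbered from \<open>0\<close> to \<open>n - 1\<close>.\<close>

definition cameras :: "nat \<Rightarrow> (nat \<Rightarrow> real mat) \<Rightarrow> bool" where
  "cameras n P \<longleftrightarrow>
     (\<forall>i<n. P i \<in> carrier_mat 3 4 \<and> vec_space.rank 3 (P i) = 3) \<and>
     (\<forall>i<n. \<forall>j<n. i \<noteq> j \<longrightarrow> mat_kernel (P i) \<noteq> mat_kernel (P j))"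

definition coplanar_centers :: "nat \<Rightarrow> (nat \<Rightarrow> real mat) \<Rightarrow> bool" where
  "coplanar_centers n P \<longleftrightarrow>
     (\<exists>h \<in> carrier_vec 4. h \<noteq> 0\<^sub>v 4 \<and> (\<forall>i<n. \<forall>c \<in> mat_kernel (P i). h \<bullet> c = 0))"

definition homog :: "real vec \<Rightarrow> real vec" where
  "homog y = y @\<^sub>v vec_of_list [1]"

definition dehomog :: "real vec \<Rightarrow> real vec" where
  "dehomog z = vec (dim_vec z - 1) (\<lambda>k. z $ k / z $ (dim_vec z - 1))"

definition image_point :: "real vec \<Rightarrow> nat \<Rightarrow> real vec" where
  "image_point x i = vec 2 (\<lambda>k. x $ (2 * i + k))"

definition epipolar_mat :: "real mat \<Rightarrow> real mat \<Rightarrow> real vec \<Rightarrow> real vec \<Rightarrow> real mat" where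
  "epipolar_mat A B u v = mat 6 6 (\<lambda>(r,c).
     if r < 3 then (if c < 4 then A $$ (r,c) else if c = 4 then u $ r else 0)
     else (if c < 4 then B $$ (r - 3,c) else if c = 4 then 0 else v $ (r - 3)))"

definition fundamental_mat :: "real mat \<Rightarrow> real mat \<Rightarrow> real mat" where
  "fundamental_mat A B =
     mat 3 3 (\<lambda>(a,b). det (epipolar_mat A B (unit_vec 3 a) (unit_vec 3 b)))"

text \<open>The matrix sending \<open>homog x\<close> to \<open>homog (image_point x i)\<close>.\<close>

definition select_mat :: "nat \<Rightarrow> nat \<Rightarrow> real mat" where
  "select_mat n i = mat 3 (2 * n + 1)
     (\<lambda>(r,c). if (r < 2 \<and> c = 2 * i + r) \<or> (r = 2 \<and> c = 2 * n) then 1 else 0)"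

definition F_mat :: "nat \<Rightarrow> (nat \<Rightarrow> real mat) \<Rightarrow> nat \<Rightarrow> nat \<Rightarrow> real mat" where
  "F_mat n P i j =
     (let B = transpose_mat (select_mat n i) * fundamental_mat (P i) (P j) * select_mat n j
      in (1/2) \<cdot>\<^sub>m (B + transpose_mat B))"

definition G_mat :: "nat \<Rightarrow> real vec \<Rightarrow> real mat" where
  "G_mat n xh = four_block_mat
     (1\<^sub>m (2 * n)) (mat (2 * n) 1 (\<lambda>(r,_). - xh $ r))
     (mat 1 (2 * n) (\<lambda>(_,c). - xh $ c)) (mat 1 1 (\<lambda>_. xh \<bullet> xh))"

definition E_mat :: "nat \<Rightarrow> real mat" where
  "E_mat n = mat (2 * n + 1) (2 * n + 1) (\<lambda>(r,c). if r = 2 * n \<and> c = 2 * n then 1 else 0)"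

definition pairs :: "nat \<Rightarrow> (nat \<times> nat) list" where
  "pairs n = concat (map (\<lambda>j. map (\<lambda>i. (i, j)) [0..<j]) [0..<n])"

definition triangulation_sdp :: "nat \<Rightarrow> (nat \<Rightarrow> real mat) \<Rightarrow> real vec \<Rightarrow> sdp" where
  "triangulation_sdp n P xh =
     SDP (G_mat n xh) (map (\<lambda>(i, j). (F_mat n P i j, 0)) (pairs n) @ [(E_mat n, 1)])"

text \<open>
  The triangulation dual has slack \<open>G + \<Sum> \<lambda>\<^sub>i\<^sub>j F\<^sub>i\<^sub>j - \<rho> E\<close>, while the dual above subtracts all
  constraint matrices; hence the sign.
\<close>

definition multipliers :: "nat \<Rightarrow> (nat \<Rightarrow> nat \<Rightarrow> real) \<Rightarrow> real \<Rightarrow> real vec" where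
  "multipliers n l \<rho> = vec (length (pairs n) + 1)
     (\<lambda>k. if k < length (pairs n) then - (case pairs n ! k of (i, j) \<Rightarrow> l i j) else \<rho>)"

definition H_mat :: "nat \<Rightarrow> (nat \<Rightarrow> real mat) \<Rightarrow> nat \<Rightarrow> nat \<Rightarrow> real mat" where
  "H_mat n P i j = mat (2 * n) (2 * n) (\<lambda>(r,c). F_mat n P i j $$ (r,c))"

text \<open>\<open>I + \<Sum> \<lambda>\<^sub>i\<^sub>j H\<^sub>i\<^sub>j\<close>\<close>

definition hessian_mat :: "nat \<Rightarrow> (nat \<Rightarrow> real mat) \<Rightarrow> (nat \<Rightarrow> nat \<Rightarrow> real) \<Rightarrow> real mat" where
  "hessian_mat n P l = mat (2 * n) (2 * n) (\<lambda>(r,c).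
     (1\<^sub>m (2 * n)) $$ (r,c) + (\<Sum>j<n. \<Sum>i<j. l i j * H_mat n P i j $$ (r,c)))"

subsection \<open>The programs in the usual form\<close>

lemma set_pairs: "set (pairs n) = {(i, j). i < j \<and> j < n}"
  by (auto simp: pairs_def)

lemma sum_pairs:
  "(\<Sum>k<length (pairs n). g (pairs n ! k)) = (\<Sum>j<n. \<Sum>i<j. g (i, j :: nat) :: real)"
proof -
  have 1: "(\<Sum>k<length (pairs n). g (pairs n ! k)) = sum_list (map g (pairs n))"
    by (simp add: sum_list_sum_nth atLeast0LessThan)
  have "sum_list (map g (pairs n)) = (\<Sum>j<n. \<Sum>i<j. g (i, j))"
    by (induction n)
      (simp_all add: pairs_def interv_sum_list_conv_sum_set_nat atLeast0LessThan comp_def)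
  with 1 show ?thesis by simp
qed

lemma det_replace_column:
  assumes A: "A \<in> carrier_mat n n" and c: "c < n" and w: "w \<in> carrier_vec n"
  shows "det (mat n n (\<lambda>(r,k). if k = c then w $ r else A $$ (r,k))) =
    (\<Sum>a<n. w $ a * det (mat n n (\<lambda>(r,k). if k = c then unit_vec n a $ r else A $$ (r,k))))"
proof -
  let ?M = "\<lambda>w. mat n n (\<lambda>(r,k). if k = c then w $ r else A $$ (r,k))"
  have cof: "cofactor (?M u) i c = cofactor (?M v) i c" if "i < n" for u v i
    unfolding cofactor_def
    by (intro arg_cong2[where f = "(*)"] refl arg_cong[where f = det] eq_matI)
      (auto simp: mat_delete_def)
  have ex: "det (?M u) = (\<Sum>i<n. u $ i * cofactor (?M w) i c)" for u
  proof -
    have "det (?M u) = (\<Sum>i<n. ?M u $$ (i,c) * cofactor (?M u) i c)"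
      by (rule laplace_expansion_column) (use c in auto)
    also have "\<dots> = (\<Sum>i<n. u $ i * cofactor (?M w) i c)"
      by (intro sum.cong refl) (use c cof[of _ u w] in auto)
    finally show ?thesis .
  qed
  have "det (?M (unit_vec n a)) = cofactor (?M w) a c" if "a < n" for a
  proof -
    have "det (?M (unit_vec n a)) = (\<Sum>i<n. if i = a then cofactor (?M w) i c else 0)"
      unfolding ex using that by (intro sum.cong refl) auto
    then show ?thesis using that by simp
  qed
  then show ?thesis by (simp add: ex[of w])
qed

lemma fundamental_mat:
  assumes u: "u \<in> carrier_vec 3" and v: "v \<in> carrier_vec 3"
  shows "u \<bullet> (fundamental_mat A B *\<^sub>v v) = det (epipolar_mat A B u v)"
proof -
  have L: "det (epipolar_mat A B u v) =
      (\<Sum>a<3. u $ a * det (epipolar_mat A B (unit_vec 3 a) v))" for v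
  proof -
    let ?E = "epipolar_mat A B u v"
    let ?w = "vec 6 (\<lambda>r. if r < 3 then u $ r else 0)"
    have E: "epipolar_mat A B u v =
        mat 6 6 (\<lambda>(r,k). if k = 4 then ?w $ r else ?E $$ (r,k))"
      by (rule eq_matI) (auto simp: epipolar_mat_def)
    have "det ?E = (\<Sum>a<6. ?w $ a *
        det (mat 6 6 (\<lambda>(r,k). if k = 4 then unit_vec 6 a $ r else ?E $$ (r,k))))"
      by (subst E, rule det_replace_column) (auto simp: epipolar_mat_def)
    also have "\<dots> = (\<Sum>a<3. ?w $ a *
        det (mat 6 6 (\<lambda>(r,k). if k = 4 then unit_vec 6 a $ r else ?E $$ (r,k))))"
      by (rule sum.mono_neutral_right) auto
    also have "\<dots> = (\<Sum>a<3. u $ a * det (epipolar_mat A B (unit_vec 3 a) v))"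
      by (intro sum.cong refl arg_cong2[where f = "(*)"] arg_cong[where f = det] eq_matI)
        (auto simp: epipolar_mat_def unit_vec_def)
    finally show ?thesis .
  qed
  have R: "det (epipolar_mat A B u v) =
      (\<Sum>b<3. v $ b * det (epipolar_mat A B u (unit_vec 3 b)))" for u
  proof -
    let ?E = "epipolar_mat A B u v"
    let ?w = "vec 6 (\<lambda>r. if r < 3 then 0 else v $ (r - 3))"
    have E: "epipolar_mat A B u v =
        mat 6 6 (\<lambda>(r,k). if k = 5 then ?w $ r else ?E $$ (r,k))"
      by (rule eq_matI) (auto simp: epipolar_mat_def)
    have "det ?E = (\<Sum>a<6. ?w $ a *
        det (mat 6 6 (\<lambda>(r,k). if k = 5 then unit_vec 6 a $ r else ?E $$ (r,k))))"
      by (subst E, rule det_replace_column) (auto simp: epipolar_mat_def)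
    also have "\<dots> = (\<Sum>a\<in>{3..<6}. ?w $ a *
        det (mat 6 6 (\<lambda>(r,k). if k = 5 then unit_vec 6 a $ r else ?E $$ (r,k))))"
      by (rule sum.mono_neutral_right) auto
    also have "\<dots> = (\<Sum>b<3. ?w $ (b + 3) *
        det (mat 6 6 (\<lambda>(r,k). if k = 5 then unit_vec 6 (b + 3) $ r else ?E $$ (r,k))))"
      using sum.shift_bounds_nat_ivl[of "\<lambda>a. ?w $ a * det (mat 6 6
        (\<lambda>(r,k). if k = 5 then unit_vec 6 a $ r else ?E $$ (r,k)))" 0 3 3]
      by (simp only: atLeast0LessThan) simp
    also have "\<dots> = (\<Sum>b<3. v $ b * det (epipolar_mat A B u (unit_vec 3 b)))"
      by (intro sum.cong refl arg_cong2[where f = "(*)"] arg_cong[where f = det] eq_matI)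
        (auto simp: epipolar_mat_def unit_vec_def)
    finally show ?thesis .
  qed
  have "u \<bullet> (fundamental_mat A B *\<^sub>v v) =
      (\<Sum>a<3. u $ a * (\<Sum>b<3. v $ b * det (epipolar_mat A B (unit_vec 3 a) (unit_vec 3 b))))"
    using u v by (simp add: scalar_prod_def fundamental_mat_def atLeast0LessThan mult.commute)
  also have "\<dots> = (\<Sum>a<3. u $ a * det (epipolar_mat A B (unit_vec 3 a) v))"
    by (subst R) (rule refl)
  also have "\<dots> = det (epipolar_mat A B u v)"
    by (rule L[symmetric])
  finally show ?thesis .
qed

lemma select_mat:
  assumes x: "x \<in> carrier_vec (2 * n)" and i: "i < n"
  shows "select_mat n i *\<^sub>v homog x = homog (image_point x i)"
proof (rule eq_vecI)
  show "dim_vec (select_mat n i *\<^sub>v homog x) = dim_vec (homog (image_point x i))"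
    by (simp add: select_mat_def homog_def image_point_def)
next
  fix r assume "r < dim_vec (homog (image_point x i))"
  then have r: "r < 3" by (simp add: homog_def image_point_def)
  let ?c = "if r < 2 then 2 * i + r else 2 * n"
  have "(select_mat n i *\<^sub>v homog x) $ r =
      (\<Sum>c<2 * n + 1. select_mat n i $$ (r,c) * homog x $ c)"
    using r x by (auto simp: scalar_prod_def select_mat_def homog_def atLeast0LessThan
        intro!: sum.cong)
  also have "\<dots> = (\<Sum>c<2 * n + 1. if c = ?c then homog x $ c else 0)"
    using r i by (intro sum.cong refl) (auto simp: select_mat_def)
  also have "\<dots> = homog x $ ?c"
    using r i by simp
  also have "\<dots> = homog (image_point x i) $ r"
    using r i x by (auto simp: homog_def image_point_def)
  finally show "(select_mat n i *\<^sub>v homog x) $ r = homog (image_point x i) $ r" .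
qed

lemma F_mat_sym: "sym_mat (2 * n + 1) (F_mat n P i j)"
  unfolding sym_mat_def
proof
  show "F_mat n P i j \<in> carrier_mat (2 * n + 1) (2 * n + 1)"
    by (auto simp: F_mat_def Let_def select_mat_def)
  show "transpose_mat (F_mat n P i j) = F_mat n P i j"
    by (rule eq_matI) (auto simp: F_mat_def Let_def select_mat_def add.commute)
qed

lemma F_mat:
  assumes x: "x \<in> carrier_vec (2 * n)" and i: "i < n" and j: "j < n"
  shows "homog x \<bullet> (F_mat n P i j *\<^sub>v homog x) =
    homog (image_point x i) \<bullet>
      (fundamental_mat (P i) (P j) *\<^sub>v homog (image_point x j))"
proof -
  let ?N = "2 * n + 1" and ?z = "homog x"
  let ?S = "select_mat n i" and ?T = "select_mat n j" and ?M = "fundamental_mat (P i) (P j)"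
  let ?B = "transpose_mat ?S * ?M * ?T"
  have z: "?z \<in> carrier_vec ?N"
    using carrier_vecD[OF x] by (intro carrier_vecI) (simp add: homog_def)
  have S: "?S \<in> carrier_mat 3 ?N" and T: "?T \<in> carrier_mat 3 ?N" and M: "?M \<in> carrier_mat 3 3"
    by (simp_all add: select_mat_def fundamental_mat_def)
  have Tz: "?T *\<^sub>v ?z \<in> carrier_vec 3" and MTz: "?M *\<^sub>v (?T *\<^sub>v ?z) \<in> carrier_vec 3"
    by (rule mult_mat_vec_carrier[OF T z])
      (rule mult_mat_vec_carrier[OF M mult_mat_vec_carrier[OF T z]])
  have "?B *\<^sub>v ?z = transpose_mat ?S *\<^sub>v (?M *\<^sub>v (?T *\<^sub>v ?z))"
  proof -
    have "?B *\<^sub>v ?z = (transpose_mat ?S * ?M) *\<^sub>v (?T *\<^sub>v ?z)"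
      by (rule assoc_mult_mat_vec) (use S M T z in auto)
    also have "\<dots> = transpose_mat ?S *\<^sub>v (?M *\<^sub>v (?T *\<^sub>v ?z))"
      by (rule assoc_mult_mat_vec) (use S M Tz in auto)
    finally show ?thesis .
  qed
  moreover have "?z \<bullet> (transpose_mat ?S *\<^sub>v (?M *\<^sub>v (?T *\<^sub>v ?z))) =
      (transpose_mat ?S *\<^sub>v (?M *\<^sub>v (?T *\<^sub>v ?z))) \<bullet> ?z"
    by (rule comm_scalar_prod[OF z]) (use S MTz in auto)
  moreover have "\<dots> = (?M *\<^sub>v (?T *\<^sub>v ?z)) \<bullet> (?S *\<^sub>v ?z)"
    by (rule transpose_vec_mult_scalar[OF S z MTz])
  moreover have "\<dots> = (?S *\<^sub>v ?z) \<bullet> (?M *\<^sub>v (?T *\<^sub>v ?z))"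
    by (rule comm_scalar_prod[OF MTz]) (use S z in auto)
  ultimately have Bz: "?z \<bullet> (?B *\<^sub>v ?z) = (?S *\<^sub>v ?z) \<bullet> (?M *\<^sub>v (?T *\<^sub>v ?z))"
    by (simp only:)
  define B where B_eq: "B = ?B"
  have B: "B \<in> carrier_mat ?N ?N" using S T M by (auto simp: B_eq)
  have Bz': "B *\<^sub>v ?z \<in> carrier_vec ?N" and Btz: "transpose_mat B *\<^sub>v ?z \<in> carrier_vec ?N"
    using B z by auto
  have tr: "?z \<bullet> (transpose_mat B *\<^sub>v ?z) = ?z \<bullet> (B *\<^sub>v ?z)"
    by (rule trans[OF comm_scalar_prod[OF z Btz] transpose_vec_mult_scalar[OF B z z]])
  have smult: "(a \<cdot>\<^sub>m K) *\<^sub>v w = a \<cdot>\<^sub>v (K *\<^sub>v w)"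
    if "K \<in> carrier_mat ?N ?N" "w \<in> carrier_vec ?N" for a :: real and K w
    using that by (intro eq_vecI) auto
  have "F_mat n P i j = (1/2) \<cdot>\<^sub>m (B + transpose_mat B)"
    by (simp only: F_mat_def Let_def B_eq)
  then have "F_mat n P i j *\<^sub>v ?z = (1/2) \<cdot>\<^sub>v ((B + transpose_mat B) *\<^sub>v ?z)"
    by (simp only:) (rule smult, use B z in auto)
  also have "(B + transpose_mat B) *\<^sub>v ?z = B *\<^sub>v ?z + transpose_mat B *\<^sub>v ?z"
    by (rule add_mult_distrib_mat_vec) (use B z in auto)
  finally have "?z \<bullet> (F_mat n P i j *\<^sub>v ?z) =
      (1/2) * (?z \<bullet> (B *\<^sub>v ?z + transpose_mat B *\<^sub>v ?z))"
    by (simp only: scalar_prod_smult_distrib[OF z add_carrier_vec[OF Bz' Btz]])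
  also have "\<dots> = ?z \<bullet> (B *\<^sub>v ?z)"
    by (subst scalar_prod_add_distrib[OF z Bz' Btz]) (simp add: tr)
  finally show ?thesis
    by (simp only: B_eq Bz select_mat[OF x i] select_mat[OF x j])
qed

lemma triangulation_primal:
  "primal_feasible (triangulation_sdp n P xh) Y \<longleftrightarrow>
     psd_mat (2 * n + 1) Y \<and> (\<forall>i j. i < j \<and> j < n \<longrightarrow> inner_mat (F_mat n P i j) Y = 0) \<and>
     inner_mat (E_mat n) Y = 1"
  by (auto simp: primal_feasible_def triangulation_sdp_def sdp_dim_def G_mat_def set_pairs)

lemma triangulation_dual:
  "dual_slack (triangulation_sdp n P xh) (multipliers n l \<rho>) =
     mat (2 * n + 1) (2 * n + 1) (\<lambda>(r,c). G_mat n xh $$ (r,c) +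
       (\<Sum>j<n. \<Sum>i<j. l i j * F_mat n P i j $$ (r,c)) - \<rho> * E_mat n $$ (r,c))"
  "dual_objective (triangulation_sdp n P xh) (multipliers n l \<rho>) = \<rho>"
proof -
  have "(\<Sum>k<length (pairs n). (case pairs n ! k of (i, j) \<Rightarrow> l i j) *
      fst (case pairs n ! k of (i, j) \<Rightarrow> (F_mat n P i j, 0 :: real)) $$ (r,c)) =
      (\<Sum>j<n. \<Sum>i<j. l i j * F_mat n P i j $$ (r,c))" for r c
    using sum_pairs[of "\<lambda>p. (case p of (i, j) \<Rightarrow> l i j) *
      fst (case p of (i, j) \<Rightarrow> (F_mat n P i j, 0 :: real)) $$ (r,c)" n] by simp
  note S = this
  show "dual_slack (triangulation_sdp n P xh) (multipliers n l \<rho>) =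
     mat (2 * n + 1) (2 * n + 1) (\<lambda>(r,c). G_mat n xh $$ (r,c) +
       (\<Sum>j<n. \<Sum>i<j. l i j * F_mat n P i j $$ (r,c)) - \<rho> * E_mat n $$ (r,c))"
    (is "_ = ?R")
  proof (rule eq_matI)
    fix r c assume "r < dim_row ?R" and "c < dim_col ?R"
    then have rc: "r < 2 * n + 1" "c < 2 * n + 1" by simp_all
    have "(\<Sum>k<length (pairs n). multipliers n l \<rho> $ k *
        fst (case pairs n ! k of (i, j) \<Rightarrow> (F_mat n P i j, 0 :: real)) $$ (r,c)) =
        - (\<Sum>j<n. \<Sum>i<j. l i j * F_mat n P i j $$ (r,c))"
      unfolding S[symmetric] sum_negf[symmetric]
      by (intro sum.cong refl) (simp add: multipliers_def)
    with rc show "dual_slack (triangulation_sdp n P xh) (multipliers n l \<rho>) $$ (r,c) = ?R $$ (r,c)"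
      by (simp add: dual_slack_def triangulation_sdp_def sdp_dim_def G_mat_def nth_append)
        (simp add: multipliers_def)
  qed (simp_all add: dual_slack_def triangulation_sdp_def sdp_dim_def G_mat_def)
  show "dual_objective (triangulation_sdp n P xh) (multipliers n l \<rho>) = \<rho>"
    by (auto simp: dual_objective_def triangulation_sdp_def multipliers_def nth_append
        split: prod.splits intro!: sum.neutral)
qed


section \<open>The triangulation algorithm\<close>

datatype verdict = OPTIMAL | SUBOPTIMAL

text \<open>
  With \<open>(p, q, w) = P\<^sub>i Z\<close>, the rows for camera \<open>i\<close> are \<open>x\<^sub>i\<^sub>0 w - p\<close> and \<open>x\<^sub>i\<^sub>1 w - q\<close>.
\<close>

definition dlt_mat :: "nat \<Rightarrow> (nat \<Rightarrow> real mat) \<Rightarrow> real vec \<Rightarrow> real mat" where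
  "dlt_mat n P x = mat (2 * n) 4
     (\<lambda>(r,c). x $ r * P (r div 2) $$ (2,c) - P (r div 2) $$ (r mod 2,c))"

text \<open>Since \<open>a / 0 = 0\<close> in HOL, the projection has to be required to be finite.\<close>

definition reprojects :: "nat \<Rightarrow> (nat \<Rightarrow> real mat) \<Rightarrow> real vec \<Rightarrow> real vec \<Rightarrow> bool" where
  "reprojects n P x X \<longleftrightarrow> (\<forall>i<n. (P i *\<^sub>v homog X) $ 2 \<noteq> 0 \<and>
     image_point x i = dehomog (P i *\<^sub>v homog X))"

text \<open>
  \<open>triangulation \<epsilon> n P xh st X\<close>: a run of the algorithm in which the semidefinite programs are
  solved to precision \<open>\<epsilon>\<close> can return \<open>(st, X)\<close>. Neither the solution of the programs nor
  the right singular vector is unique, hence a relation.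
\<close>

definition triangulation ::
  "real \<Rightarrow> nat \<Rightarrow> (nat \<Rightarrow> real mat) \<Rightarrow> real vec \<Rightarrow> verdict \<Rightarrow> real vec \<Rightarrow> bool" where
  "triangulation \<epsilon> n P xh st X \<longleftrightarrow> (\<exists>Y l \<rho> x U \<sigma> V m.
     sdp_solution \<epsilon> (triangulation_sdp n P xh) Y (multipliers n l \<rho>) \<and>
     x = vec (2 * n) (\<lambda>r. Y $$ (r, 2 * n)) \<and>
     singular_value_decomposition (2 * n) 4 (dlt_mat n P x) U \<sigma> V \<and>
     m < 4 \<and> (\<forall>k<4. \<sigma> $ m \<le> \<sigma> $ k) \<and>
     X = dehomog (col V m) \<and>
     st = (if pd_mat (2 * n) (hessian_mat n P l) \<and>
              ((n = 2 \<or> n \<ge> 4 \<and> \<not> coplanar_centers n P) \<or> reprojects n P x X)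
           then OPTIMAL else SUBOPTIMAL))"


section \<open>A real random access machine with numerical routines\<close>

text \<open>
  Programs operate on registers holding natural numbers and on a memory of matrices
  \<open>mem 0, mem 1, \<dots>\<close> of reals. Natural numbers are only used as indices: there is no conversion
  between naturals and reals and no multiplication of naturals. Vectors are stored in column \<open>0\<close>
  of a matrix. Every node of every evaluated expression and every executed command takes one
  time unit.
\<close>

record state =
  reg :: "nat \<Rightarrow> nat"
  mem :: "nat \<Rightarrow> nat \<Rightarrow> nat \<Rightarrow> real"

datatype aexp = Num nat | Var nat | Plus aexp aexp | Minus aexp aexp

datatype rexp = Const int | Cell aexp aexp aexp
  | Add rexp rexp | Sub rexp rexp | Mul rexp rexp | Div rexp rexp

datatype bexp = ALess aexp aexp | RLess rexp rexp | Neg bexp | Conj bexp bexp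

fun aval :: "aexp \<Rightarrow> state \<Rightarrow> nat" where
  "aval (Num k) s = k"
| "aval (Var v) s = reg s v"
| "aval (Plus a b) s = aval a s + aval b s"
| "aval (Minus a b) s = aval a s - aval b s"

fun rval :: "rexp \<Rightarrow> state \<Rightarrow> real" where
  "rval (Const k) s = of_int k"
| "rval (Cell k i j) s = mem s (aval k s) (aval i s) (aval j s)"
| "rval (Add a b) s = rval a s + rval b s"
| "rval (Sub a b) s = rval a s - rval b s"
| "rval (Mul a b) s = rval a s * rval b s"
| "rval (Div a b) s = rval a s / rval b s"

fun bval :: "bexp \<Rightarrow> state \<Rightarrow> bool" where
  "bval (ALess a b) s \<longleftrightarrow> aval a s < aval b s"
| "bval (RLess a b) s \<longleftrightarrow> rval a s < rval b s"
| "bval (Neg b) s \<longleftrightarrow> \<not> bval b s"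
| "bval (Conj a b) s \<longleftrightarrow> bval a s \<and> bval b s"

fun acost :: "aexp \<Rightarrow> nat" where
  "acost (Plus a b) = 1 + acost a + acost b"
| "acost (Minus a b) = 1 + acost a + acost b"
| "acost _ = 1"

fun rcost :: "rexp \<Rightarrow> nat" where
  "rcost (Const k) = 1"
| "rcost (Cell k i j) = 1 + acost k + acost i + acost j"
| "rcost (Add a b) = 1 + rcost a + rcost b"
| "rcost (Sub a b) = 1 + rcost a + rcost b"
| "rcost (Mul a b) = 1 + rcost a + rcost b"
| "rcost (Div a b) = 1 + rcost a + rcost b"

fun bcost :: "bexp \<Rightarrow> nat" where
  "bcost (ALess a b) = 1 + acost a + acost b"
| "bcost (RLess a b) = 1 + rcost a + rcost b"
| "bcost (Neg b) = 1 + bcost b"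
| "bcost (Conj a b) = 1 + bcost a + bcost b"

text \<open>
  \<open>CallSDP d m p q\<close> solves the program of dimension \<open>d\<close> with objective \<open>mem p\<close>, the \<open>m\<close>
  constraint matrices \<open>mem (p + 1), \<dots>, mem (p + m)\<close> and right-hand sides \<open>mem (p + m + 1)\<close>;
  it stores the primal solution in \<open>mem q\<close> and the dual one in \<open>mem (q + 1)\<close>.
  \<open>CallEig d p q\<close> decomposes the \<open>d \<times> d\<close> matrix \<open>mem p\<close>; eigenvectors go to \<open>mem q\<close>, eigenvalues
  to \<open>mem (q + 1)\<close>.
  \<open>CallSVD r c p q\<close> decomposes the \<open>r \<times> c\<close> matrix \<open>mem p\<close> as \<open>U \<Sigma> V\<^sup>T\<close>; \<open>U\<close>, the
  singular values and \<open>V\<close> go to \<open>mem q\<close>, \<open>mem (q + 1)\<close> and \<open>mem (q + 2)\<close>.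
\<close>

datatype com =
    Skip
  | Assign nat aexp
  | Store aexp aexp aexp rexp
  | Seq com com
  | Cond bexp com com
  | While bexp com
  | CallSDP aexp aexp aexp aexp
  | CallEig aexp aexp aexp
  | CallSVD aexp aexp aexp aexp

record routines =
  sdp_solve :: "sdp \<Rightarrow> real mat \<times> real vec"
  sdp_time :: "sdp \<Rightarrow> nat"
  eig :: "real mat \<Rightarrow> real mat \<times> real vec"
  eig_time :: "real mat \<Rightarrow> nat"
  svd :: "real mat \<Rightarrow> real mat \<times> real vec \<times> real mat"
  svd_time :: "real mat \<Rightarrow> nat"

definition sdp_routine :: "real \<Rightarrow> routines \<Rightarrow> bool" where
  "sdp_routine \<epsilon> R \<longleftrightarrow>
     (\<forall>S. sdp_wf S \<and> (\<exists>Y. primal_feasible S Y) \<and> (\<exists>y. dual_feasible S y) \<longrightarrow>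
        (case sdp_solve R S of (Y, y) \<Rightarrow> sdp_solution \<epsilon> S Y y)) \<and>
     (\<exists>q :: nat poly. \<forall>S. sdp_wf S \<longrightarrow> sdp_time R S \<le> poly q (sdp_size S))"

definition eig_routine :: "routines \<Rightarrow> bool" where
  "eig_routine R \<longleftrightarrow>
     (\<forall>k A. sym_mat k A \<longrightarrow> (case eig R A of (Q, d) \<Rightarrow> eigendecomposition k A Q d)) \<and>
     (\<exists>q :: nat poly. \<forall>k A. sym_mat k A \<longrightarrow> eig_time R A \<le> poly q (k * k))"

definition svd_routine :: "routines \<Rightarrow> bool" where
  "svd_routine R \<longleftrightarrow>
     (\<forall>r c. \<forall>A \<in> carrier_mat r c.
        (case svd R A of (U, \<sigma>, W) \<Rightarrow> singular_value_decomposition r c A U \<sigma> W)) \<and>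
     (\<exists>q :: nat poly. \<forall>r c. \<forall>A \<in> carrier_mat r c. svd_time R A \<le> poly q (r * c))"

definition get_mat :: "state \<Rightarrow> nat \<Rightarrow> nat \<Rightarrow> nat \<Rightarrow> real mat" where
  "get_mat s k r c = mat r c (\<lambda>(i,j). mem s k i j)"

definition put_mat :: "nat \<Rightarrow> real mat \<Rightarrow> state \<Rightarrow> state" where
  "put_mat k A s = s\<lparr>mem := (mem s)(k := (\<lambda>i j.
     if i < dim_row A \<and> j < dim_col A then A $$ (i,j) else mem s k i j))\<rparr>"

definition put_vec :: "nat \<Rightarrow> real vec \<Rightarrow> state \<Rightarrow> state" where
  "put_vec k v = put_mat k (mat (dim_vec v) 1 (\<lambda>(i,_). v $ i))"

definition get_sdp :: "state \<Rightarrow> nat \<Rightarrow> nat \<Rightarrow> nat \<Rightarrow> sdp" where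
  "get_sdp s d m p = SDP (get_mat s p d d)
     (map (\<lambda>k. (get_mat s (p + 1 + k) d d, mem s (p + m + 1) k 0)) [0..<m])"

text \<open>\<open>exec R c s t s'\<close>: started in \<open>s\<close>, the program \<open>c\<close> terminates in \<open>s'\<close> after \<open>t\<close> time units.\<close>

inductive exec :: "routines \<Rightarrow> com \<Rightarrow> state \<Rightarrow> nat \<Rightarrow> state \<Rightarrow> bool" for R where
  Skip: "exec R Skip s 1 s"
| Assign: "exec R (Assign v a) s (1 + acost a) (s\<lparr>reg := (reg s)(v := aval a s)\<rparr>)"
| Store: "k' = aval k s \<Longrightarrow> i' = aval i s \<Longrightarrow> j' = aval j s \<Longrightarrow>
    exec R (Store k i j e) s (1 + acost k + acost i + acost j + rcost e)
      (s\<lparr>mem := (mem s)(k' := (mem s k')(i' := (mem s k' i')(j' := rval e s)))\<rparr>)"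
| Seq: "exec R c1 s t1 s' \<Longrightarrow> exec R c2 s' t2 s'' \<Longrightarrow> exec R (Seq c1 c2) s (1 + t1 + t2) s''"
| CondTrue: "bval b s \<Longrightarrow> exec R c1 s t s' \<Longrightarrow> exec R (Cond b c1 c2) s (1 + bcost b + t) s'"
| CondFalse: "\<not> bval b s \<Longrightarrow> exec R c2 s t s' \<Longrightarrow> exec R (Cond b c1 c2) s (1 + bcost b + t) s'"
| WhileFalse: "\<not> bval b s \<Longrightarrow> exec R (While b c) s (1 + bcost b) s"
| WhileTrue: "bval b s \<Longrightarrow> exec R c s t1 s' \<Longrightarrow> exec R (While b c) s' t2 s'' \<Longrightarrow>
    exec R (While b c) s (1 + bcost b + t1 + t2) s''"
| CallSDP: "S = get_sdp s (aval d s) (aval m s) (aval p s) \<Longrightarrow> sdp_solve R S = (Y, y) \<Longrightarrow>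
    exec R (CallSDP d m p q) s (1 + acost d + acost m + acost p + acost q + sdp_time R S)
      (put_vec (aval q s + 1) y (put_mat (aval q s) Y s))"
| CallEig: "A = get_mat s (aval p s) (aval d s) (aval d s) \<Longrightarrow> eig R A = (Q, e) \<Longrightarrow>
    exec R (CallEig d p q) s (1 + acost d + acost p + acost q + eig_time R A)
      (put_vec (aval q s + 1) e (put_mat (aval q s) Q s))"
| CallSVD: "A = get_mat s (aval p s) (aval r s) (aval c s) \<Longrightarrow> svd R A = (U, \<sigma>, W) \<Longrightarrow>
    exec R (CallSVD r c p q) s (1 + acost r + acost c + acost p + acost q + svd_time R A)
      (put_mat (aval q s + 2) W (put_vec (aval q s + 1) \<sigma> (put_mat (aval q s) U s)))"

inductive_cases SkipE: "exec R Skip s t s'"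
inductive_cases AssignE: "exec R (Assign v a) s t s'"
inductive_cases StoreE: "exec R (Store k i j e) s t s'"
inductive_cases SeqE: "exec R (Seq c1 c2) s t s'"
inductive_cases CondE: "exec R (Cond b c1 c2) s t s'"
inductive_cases WhileE: "exec R (While b c) s t s'"
inductive_cases CallSDPE: "exec R (CallSDP d m p q) s t s'"
inductive_cases CallEigE: "exec R (CallEig d p q) s t s'"
inductive_cases CallSVDE: "exec R (CallSVD r c p q) s t s'"

text \<open>Execution is deterministic, so that termination in one way is termination.\<close>

lemma exec_deterministic:
  assumes "exec R c s t s'" and "exec R c s u s''"
  shows "t = u \<and> s' = s''"
  using assms
proof (induction arbitrary: u s'' rule: exec.induct)
  case (Skip s)
  then show ?case by (rule SkipE) simp
next
  case (Assign v a s)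
  then show ?case by (rule AssignE) simp
next
  case (Store k' k s i' i j' j e)
  from Store.prems show ?case by (rule StoreE) (simp add: Store.hyps)
next
  case (Seq c1 s t1 s1 c2 t2 s2)
  from Seq.prems obtain u1 u2 r where u: "u = Suc (u1 + u2)"
    and 1: "exec R c1 s u1 r" and 2: "exec R c2 r u2 s''"
    by (rule SeqE)
  from Seq.IH(1)[OF 1] have r: "t1 = u1" "s1 = r" by simp_all
  from Seq.IH(2)[OF 2[folded r]] show ?case by (simp add: u r)
next
  case (CondTrue b s c1 t s1 c2)
  from CondTrue.prems show ?case
  proof (rule CondE)
    fix w assume u: "u = Suc (bcost b + w)" and w: "exec R c1 s w s''"
    from CondTrue.IH[OF w] show ?thesis by (simp add: u)
  qed (use CondTrue.hyps in simp)
next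
  case (CondFalse b s c2 t s1 c1)
  from CondFalse.prems show ?case
  proof (rule CondE)
    fix w assume u: "u = Suc (bcost b + w)" and w: "exec R c2 s w s''"
    from CondFalse.IH[OF w] show ?thesis by (simp add: u)
  qed (use CondFalse.hyps in simp)
next
  case (WhileFalse b s c)
  from WhileFalse.prems show ?case
    by (rule WhileE) (use WhileFalse.hyps in simp_all)
next
  case (WhileTrue b s c t1 s1 t2 s2)
  from WhileTrue.prems show ?case
  proof (rule WhileE)
    fix u1 r u2 assume u: "u = Suc (bcost b + u1 + u2)"
      and 1: "exec R c s u1 r" and 2: "exec R (While b c) r u2 s''"
    from WhileTrue.IH(1)[OF 1] have r: "t1 = u1" "s1 = r" by simp_all
    from WhileTrue.IH(2)[OF 2[folded r]] show ?thesis by (simp add: u r)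
  qed (use WhileTrue.hyps in simp)
next
  case (CallSDP S s d m p Y y q)
  from CallSDP.prems show ?case by (rule CallSDPE) (use CallSDP.hyps in simp)
next
  case (CallEig A s p d Q e q)
  from CallEig.prems show ?case by (rule CallEigE) (use CallEig.hyps in simp)
next
  case (CallSVD A s p r c U \<sigma> W q)
  from CallSVD.prems show ?case by (rule CallSVDE) (use CallSVD.hyps in simp)
qed

text \<open>
  The input is passed as \<open>n\<close> in register \<open>0\<close>, the cameras in \<open>mem 0, \<dots>, mem (n - 1)\<close> and the
  observation in \<open>mem n\<close>. The result is read off register \<open>0\<close> and \<open>mem 0\<close>.
\<close>

definition input :: "nat \<Rightarrow> (nat \<Rightarrow> real mat) \<Rightarrow> real vec \<Rightarrow> state" where
  "input n P xh = put_vec n xh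
     (fold (\<lambda>i. put_mat i (P i)) [0..<n]
       \<lparr>reg = (\<lambda>_. 0)(0 := n), mem = (\<lambda>_ _ _. 0)\<rparr>)"

definition output_verdict :: "state \<Rightarrow> verdict" where
  "output_verdict s = (if reg s 0 = 1 then OPTIMAL else SUBOPTIMAL)"

definition output_point :: "state \<Rightarrow> real vec" where
  "output_point s = vec 3 (\<lambda>r. mem s 0 r 0)"

end

theory Submission
  imports Defs
begin

text \<open>
  The witness is one machine program, the same for all inputs, which writes down the semidefinite
  programs, calls the solver, and evaluates the tests of the algorithm. Two things have to be
  shown: that every call meets the precondition under which the routine keeps its promise, and
  that each test of the algorithm is decided by the machine exactly.

  The solver promises a solution only for programs with feasible primal and dual. The dual is
  feasible because \<open>G\<close> is a Gram matrix, so that all multipliers may be \<open>0\<close>. The primal is feasible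
  because some world point lies off the principal planes of all cameras: only finitely many planes
  have to be avoided (\<open>finite_hyperplanes_avoidable\<close>). Its images \<open>x\<close> satisfy all epipolar
  constraints, since the matrix defining \<open>f\<^sub>i\<^sub>j\<close> annihilates a vector made of the world point and its
  two depths (\<open>det_epipolar_mat_common_point\<close>), and then \<open>homog x\<close> times its transpose is feasible.

  Two tests are not finite as they stand. Positive definiteness is read off the computed
  eigenvalues (\<open>pd_mat_iff_eigenvalues_pos\<close>). For coplanarity, the \<open>3 \<times> 3\<close> minors of a camera are
  the coordinates of its center, and the centers lie in a plane iff the determinant of their
  \<open>4 \<times> 4\<close> Gram matrix vanishes (\<open>coplanar_centers_iff_det_gram\<close>). All determinants that occur,
  including those in the fundamental matrices, have size at most \<open>6\<close>; they are expanded into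
  expressions of constant cost.

  The program consists of bounded loops filling matrices entrywise. Expressions have no
  conditionals, so an identity matrix is kept in memory and its cells serve as Kronecker deltas:
  every entry of \<open>F\<^sub>i\<^sub>j\<close>, of \<open>G\<close> and of the linear system for the world point becomes a sum of
  products. The loops are at most four deep with \<open>O(n\<^sup>2)\<close> iterations each, and the arguments
  handed to the three routines have size polynomial in \<open>n\<close>; hence so is the running time.
\<close>

section \<open>Kernels, Gram matrices and coplanar centers\<close>

text \<open>
  The columns of a matrix of full row rank contain a basis, so a vector orthogonal to all columns
  is orthogonal to itself.
\<close>

lemma full_rank_left_kernel:
  fixes A :: "real mat"
  assumes A: "A \<in> carrier_mat r c" and rank: "vec_space.rank r A = r"
    and w: "w \<in> carrier_vec r" and orth: "\<And>j. j < c \<Longrightarrow> w \<bullet> col A j = 0"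
  shows "w = 0\<^sub>v r"
proof -
  interpret vec_space "TYPE(real)" r .
  have "\<exists>S. maximal S (\<lambda>T. T \<subseteq> set (cols A) \<and> lin_indpt T)"
    using maximal_exists_superset[of "set (cols A)"
        "\<lambda>T. T \<subseteq> set (cols A) \<and> lin_indpt T" "{}"] by (auto simp: lin_dep_def)
  then obtain S where S: "maximal S (\<lambda>T. T \<subseteq> set (cols A) \<and> lin_indpt T)" by blast
  have sub: "S \<subseteq> set (cols A)" and ind: "lin_indpt S" using S by (auto simp: maximal_def)
  have carr: "S \<subseteq> carrier_vec r" using sub cols_dim[of A] A by auto
  have "card S = r" using rank_card_indpt[OF A S] rank by simp
  then have "basis S"
    using carr finite_subset[OF sub] by (intro dim_li_is_basis) (auto simp: ind dim_is_n)
  then have span: "span S = carrier_vec r" by (simp add: basis_def)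
  have "w \<bullet> v = 0" if "v \<in> S" for v
  proof -
    from that sub obtain j where "j < c" "v = col A j"
      using A by (auto simp: cols_def)
    then show ?thesis using orth by simp
  qed
  note S0 = this
  have "w \<bullet> v = 0" if v: "v \<in> span S" for v
  proof -
    obtain a T where T: "finite T" "T \<subseteq> S" and v_eq: "v = lincomb a T"
      using v by (auto simp: span_def)
    have TC: "T \<subseteq> carrier_vec r" using T carr by auto
    have "w \<bullet> v = (\<Sum>i<r. w $ i * (\<Sum>u\<in>T. a u * u $ i))"
      using lincomb_dim[OF T(1) TC, of a] by (simp add: v_eq scalar_prod_def atLeast0LessThan lincomb_index[OF _ TC])
    also have "\<dots> = (\<Sum>u\<in>T. \<Sum>i<r. w $ i * (a u * u $ i))"
      by (subst sum.swap) (simp add: sum_distrib_left)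
    also have "\<dots> = (\<Sum>u\<in>T. a u * (w \<bullet> u))"
      using TC by (intro sum.cong refl)
        (auto simp: scalar_prod_def atLeast0LessThan sum_distrib_left mult_ac intro!: sum.cong)
    also have "\<dots> = 0" using S0 T(2) by (intro sum.neutral) auto
    finally show ?thesis .
  qed
  then have "w \<bullet> w = 0" using span w by simp
  then show ?thesis using w conjugate_square_eq_0_vec[of w r] by simp
qed

text \<open>
  On the moment curve \<open>t \<mapsto> (1, t, \<dots>, t\<^sup>k\<^sup>-\<^sup>1)\<close>, membership in a hyperplane through the origin is
  a nontrivial polynomial equation for \<open>t\<close>; finitely many such equations leave some \<open>t\<close> over.
\<close>

lemma finite_hyperplanes_avoidable:
  fixes r :: "nat \<Rightarrow> real vec"
  assumes "\<And>i. i < n \<Longrightarrow> r i \<in> carrier_vec k" "\<And>i. i < n \<Longrightarrow> r i \<noteq> 0\<^sub>v k"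
  shows "\<exists>z \<in> carrier_vec k. \<forall>i<n. r i \<bullet> z \<noteq> 0"
proof -
  define p where "p i = (\<Sum>j<k. monom (r i $ j) j)" for i
  have coeff: "coeff (p i) j = (if j < k then r i $ j else 0)" for i j
    by (simp add: p_def coeff_sum)
  have p0: "p i \<noteq> 0" if "i < n" for i
  proof
    assume "p i = 0"
    then have "r i $ j = 0" if "j < k" for j using coeff[of i j] that by simp
    then show False using assms[OF \<open>i < n\<close>] by auto
  qed
  have ev: "poly (p i) t = r i \<bullet> vec k (\<lambda>j. t ^ j)" if "i < n" for i t
    using that assms(1) by (simp add: p_def poly_sum poly_monom scalar_prod_def atLeast0LessThan)
  have "finite (\<Union>i\<in>{..<n}. {t. poly (p i) t = 0})"
    using p0 by (auto intro: poly_roots_finite)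
  then obtain t where "t \<notin> (\<Union>i\<in>{..<n}. {t. poly (p i) t = 0})"
    using ex_new_if_finite[OF infinite_UNIV_char_0] by blast
  then show ?thesis using ev by (intro bexI[of _ "vec k (\<lambda>j. t ^ j)"]) auto
qed

text \<open>
  Both sides say that \<open>h\<close> lies in the row space of the camera. The advantage of the determinant
  is that it is linear in \<open>h\<close>, with coefficients that are computable from the camera.
\<close>

lemma coplanar_camera:
  fixes P :: "real mat"
  assumes P: "P \<in> carrier_mat 3 4" and rank: "vec_space.rank 3 P = 3" and h: "h \<in> carrier_vec 4"
  shows "(\<forall>c \<in> mat_kernel P. h \<bullet> c = 0) \<longleftrightarrow>
    det (mat 4 4 (\<lambda>(r,c). if r < 3 then P $$ (r,c) else h $ c)) = 0" (is "_ \<longleftrightarrow> det ?M = 0")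
proof -
  have M: "?M \<in> carrier_mat 4 4" by simp
  have rows: "row ?M r = row P r" if "r < 3" for r using that P by (intro eq_vecI) auto
  have row3: "row ?M 3 = h" using h by (intro eq_vecI) auto
  show ?thesis
  proof
    assume orth: "\<forall>c \<in> mat_kernel P. h \<bullet> c = 0"
    show "det ?M = 0"
    \<comment> \<open>Solving \<open>M z = e\<^sub>3\<close> gives a kernel vector of \<open>P\<close> with \<open>h \<bullet> z = 1\<close>.\<close>
    proof (rule ccontr)
      assume d: "det ?M \<noteq> 0"
      obtain B where B: "B \<in> carrier_mat 4 4" "?M * B = 1\<^sub>m 4"
        using det_non_zero_imp_unit[OF M d, of "()"] by (auto simp: Units_def ring_mat_simps)
      define z where "z = col B 3"
      have z: "z \<in> carrier_vec 4" using B(1) by (simp add: z_def carrier_vecI)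
      have zr: "row ?M r \<bullet> z = (if r = 3 then 1 else 0)" if "r < 4" for r
      proof -
        have "(?M * B) $$ (r,3) = row ?M r \<bullet> z" using that B(1) by (simp add: z_def)
        then show ?thesis using that B(2) by simp
      qed
      have "P *\<^sub>v z = 0\<^sub>v 3"
        using zr P by (intro eq_vecI) (simp_all add: rows[symmetric] del: row_mat)
      then have "z \<in> mat_kernel P" using z P by (simp add: mat_kernel_def)
      then show False using orth zr[of 3] row3 by simp
    qed
  next
    assume "det ?M = 0"
    then have "det ?M\<^sup>T = 0" using det_transpose[OF M] by simp
    \<comment> \<open>A row dependency must involve \<open>h\<close>, since the rows of \<open>P\<close> are independent.\<close>
    then obtain w where w: "w \<in> carrier_vec 4" "w \<noteq> 0\<^sub>v 4" "?M\<^sup>T *\<^sub>v w = 0\<^sub>v 4"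
      using det_0_iff_vec_prod_zero_field[of "?M\<^sup>T" 4] M by auto
    have lin: "(\<Sum>r<3. w $ r * P $$ (r,c)) + w $ 3 * h $ c = 0" if "c < 4" for c
    proof -
      have "(?M\<^sup>T *\<^sub>v w) $ c = (\<Sum>r<4. ?M $$ (r,c) * w $ r)"
        using that w(1) by (simp add: scalar_prod_def atLeast0LessThan)
      then have "(\<Sum>r<4. ?M $$ (r,c) * w $ r) = 0" using w(3) that by simp
      then show ?thesis using that by (simp add: eval_nat_numeral algebra_simps)
    qed
    have w3: "w $ 3 \<noteq> 0"
    proof
      assume w3: "w $ 3 = 0"
      have "vec 3 (($) w) = 0\<^sub>v 3"
      proof (rule full_rank_left_kernel[OF P rank])
        show "vec 3 (($) w) \<bullet> col P j = 0" if "j < 4" for j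
          using lin[OF that] w3 P that by (simp add: scalar_prod_def atLeast0LessThan)
      qed simp
      then have "w $ r = 0" if "r < 3" for r using that by (metis index_vec index_zero_vec(1))
      then show False using w(1,2) w3 by (auto simp: vec_eq_iff less_Suc_eq eval_nat_numeral)
    qed
    show "\<forall>c \<in> mat_kernel P. h \<bullet> c = 0"
    proof
      fix c assume "c \<in> mat_kernel P"
      then have c: "c \<in> carrier_vec 4" "P *\<^sub>v c = 0\<^sub>v 3" using P by (auto simp: mat_kernel_def)
      have Pc: "(\<Sum>k<4. P $$ (r,k) * c $ k) = 0" if "r < 3" for r
      proof -
        have "(P *\<^sub>v c) $ r = (\<Sum>k<4. P $$ (r,k) * c $ k)"
          using that P c(1) by (simp add: scalar_prod_def atLeast0LessThan)
        then show ?thesis using c(2) that by simp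
      qed
      have "0 = (\<Sum>k<4. ((\<Sum>r<3. w $ r * P $$ (r,k)) + w $ 3 * h $ k) * c $ k)"
        using lin by simp
      also have "\<dots> = (\<Sum>k<4. \<Sum>r<3. w $ r * P $$ (r,k) * c $ k) + w $ 3 * (\<Sum>k<4. h $ k * c $ k)"
        by (simp add: distrib_right sum.distrib sum_distrib_left sum_distrib_right mult.assoc)
      also have "(\<Sum>k<4. \<Sum>r<3. w $ r * P $$ (r,k) * c $ k) = (\<Sum>r<3. w $ r * (\<Sum>k<4. P $$ (r,k) * c $ k))"
        by (subst sum.swap) (simp add: sum_distrib_left mult.assoc)
      also have "\<dots> = 0" using Pc by simp
      finally show "h \<bullet> c = 0" using w3 c by (simp add: scalar_prod_def atLeast0LessThan)
    qed
  qed
qed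

text \<open>
  Up to sign the \<open>3 \<times> 3\<close> minors of the camera, which are the homogeneous coordinates of its center.
\<close>

definition center_coord :: "real mat \<Rightarrow> nat \<Rightarrow> real" where
  "center_coord P k = det (mat 4 4 (\<lambda>(r,c). if r < 3 then P $$ (r,c) else unit_vec 4 k $ c))"

lemma det_center:
  assumes h: "h \<in> carrier_vec 4"
  shows "det (mat 4 4 (\<lambda>(r,c). if r < 3 then P $$ (r,c) else h $ c)) =
    (\<Sum>k<4. h $ k * center_coord P k)"
proof -
  let ?A = "mat 4 4 (\<lambda>(r,c). P $$ (c,r))"
  have T: "mat 4 4 (\<lambda>(r,c). if r < 3 then P $$ (r,c) else v $ c) =
      (mat 4 4 (\<lambda>(r,c). if c = 3 then v $ r else ?A $$ (r,c)))\<^sup>T" for v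
    by (rule eq_matI) auto
  have D: "det (mat 4 4 (\<lambda>(r,c). if r < 3 then P $$ (r,c) else v $ c)) =
      det (mat 4 4 (\<lambda>(r,c). if c = 3 then v $ r else ?A $$ (r,c)))" for v
    by (subst T, rule det_transpose[of _ 4]) simp
  show ?thesis
    unfolding center_coord_def D by (rule det_replace_column) (use h in auto)
qed

definition gram_mat :: "nat \<Rightarrow> nat \<Rightarrow> (nat \<Rightarrow> nat \<Rightarrow> real) \<Rightarrow> real mat" where
  "gram_mat k n c = mat k k (\<lambda>(r,s). \<Sum>i<n. c i r * c i s)"

lemma gram_mat_carrier [simp]: "gram_mat k n c \<in> carrier_mat k k"
  and dim_gram_mat [simp]: "dim_row (gram_mat k n c) = k" "dim_col (gram_mat k n c) = k"
  by (simp_all add: gram_mat_def)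

lemma gram_mat_mult_vec:
  assumes "h \<in> carrier_vec k" "r < k"
  shows "(gram_mat k n c *\<^sub>v h) $ r = (\<Sum>i<n. c i r * (\<Sum>s<k. h $ s * c i s))"
proof -
  have "(gram_mat k n c *\<^sub>v h) $ r = (\<Sum>s<k. \<Sum>i<n. c i r * c i s * h $ s)"
    using assms by (simp add: gram_mat_def scalar_prod_def atLeast0LessThan sum_distrib_right)
  also have "\<dots> = (\<Sum>i<n. \<Sum>s<k. c i r * c i s * h $ s)" by (rule sum.swap)
  finally show ?thesis by (simp add: sum_distrib_left mult_ac)
qed

lemma gram_mat_quadratic_form:
  assumes h: "h \<in> carrier_vec k"
  shows "h \<bullet> (gram_mat k n c *\<^sub>v h) = (\<Sum>i<n. (\<Sum>r<k. h $ r * c i r)\<^sup>2)"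
proof -
  have "h \<bullet> (gram_mat k n c *\<^sub>v h) =
      (\<Sum>r<k. \<Sum>i<n. h $ r * c i r * (\<Sum>s<k. h $ s * c i s))"
    using gram_mat_carrier[of k n c] gram_mat_mult_vec[OF h]
    by (subst scalar_prod_def)
      (simp add: atLeast0LessThan sum_distrib_left mult.assoc del: index_mult_mat_vec)
  also have "\<dots> = (\<Sum>i<n. \<Sum>r<k. h $ r * c i r * (\<Sum>s<k. h $ s * c i s))"
    by (rule sum.swap)
  finally show ?thesis by (simp add: sum_distrib_right[symmetric] power2_eq_square)
qed

lemma gram_mat_psd: "psd_mat k (gram_mat k n c)"
proof -
  have "(gram_mat k n c)\<^sup>T = gram_mat k n c"
    by (rule eq_matI) (auto simp: gram_mat_def mult.commute)
  then show ?thesis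
    by (simp add: psd_mat_def sym_mat_def gram_mat_quadratic_form sum_nonneg)
qed

text \<open>
  The kernel of a Gram matrix is the set on which its quadratic form, a sum of squares, vanishes.
\<close>

lemma det_gram_mat_eq_0_iff:
  "det (gram_mat k n c) = 0 \<longleftrightarrow>
    (\<exists>h \<in> carrier_vec k. h \<noteq> 0\<^sub>v k \<and> (\<forall>i<n. (\<Sum>r<k. h $ r * c i r) = 0))"
proof -
  have "gram_mat k n c *\<^sub>v h = 0\<^sub>v k \<longleftrightarrow> (\<forall>i<n. (\<Sum>r<k. h $ r * c i r) = 0)"
    if h: "h \<in> carrier_vec k" for h
  proof
    assume "gram_mat k n c *\<^sub>v h = 0\<^sub>v k"
    then have "(\<Sum>i<n. (\<Sum>r<k. h $ r * c i r)\<^sup>2) = 0"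
      using gram_mat_quadratic_form[OF h, of n c] h by simp
    then show "\<forall>i<n. (\<Sum>r<k. h $ r * c i r) = 0"
      by (subst (asm) sum_nonneg_eq_0_iff) auto
  next
    assume "\<forall>i<n. (\<Sum>r<k. h $ r * c i r) = 0"
    then show "gram_mat k n c *\<^sub>v h = 0\<^sub>v k"
      using gram_mat_carrier[of k n c]
      by (intro eq_vecI) (simp_all add: gram_mat_mult_vec[OF h] del: index_mult_mat_vec)
  qed
  then show ?thesis by (subst det_0_iff_vec_prod_zero_field[of _ k]) auto
qed

lemma coplanar_centers_iff_det_gram:
  assumes "cameras n P"
  shows "coplanar_centers n P \<longleftrightarrow>
    det (gram_mat 4 n (\<lambda>i. center_coord (P i))) = 0"
proof -
  have "(\<forall>c \<in> mat_kernel (P i). h \<bullet> c = 0) \<longleftrightarrow> (\<Sum>k<4. h $ k * center_coord (P i) k) = 0"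
    if "i < n" "h \<in> carrier_vec 4" for i h
    using assms that coplanar_camera[of "P i" h] by (simp add: det_center cameras_def)
  then show ?thesis
    unfolding coplanar_centers_def det_gram_mat_eq_0_iff by (intro bex_cong refl) auto
qed

text \<open>
  In the coordinates \<open>Q\<^sup>T v\<close> the quadratic form of \<open>A\<close> is \<open>\<Sum> d\<^sub>i u\<^sub>i\<^sup>2\<close>, and the columns of \<open>Q\<close>
  single out the individual \<open>d\<^sub>i\<close>.
\<close>

lemma pd_mat_iff_eigenvalues_pos:
  assumes A: "sym_mat k A" and E: "eigendecomposition k A Q d"
  shows "pd_mat k A \<longleftrightarrow> (\<forall>i<k. d $ i > 0)"
proof -
  let ?D = "mat k k (\<lambda>(i,j). if i = j then d $ i else 0)"
  have Q: "Q \<in> carrier_mat k k" and QQ: "Q\<^sup>T * Q = 1\<^sub>m k" and AQ: "A = Q * ?D * Q\<^sup>T"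
    using E by (auto simp: eigendecomposition_def orthonormal_mat_def)
  have QQ': "Q * Q\<^sup>T = 1\<^sub>m k" by (rule mat_mult_left_right_inverse[OF _ Q QQ]) (use Q in simp)
  have form: "v \<bullet> (A *\<^sub>v v) = (\<Sum>i<k. d $ i * ((Q\<^sup>T *\<^sub>v v) $ i)\<^sup>2)" if v: "v \<in> carrier_vec k" for v
  proof -
    define u where "u = Q\<^sup>T *\<^sub>v v"
    have u: "u \<in> carrier_vec k" using Q v by (simp add: u_def)
    have DU: "?D *\<^sub>v u \<in> carrier_vec k" by (rule mult_mat_vec_carrier[OF mat_carrier u])
    have Du: "?D *\<^sub>v u = vec k (\<lambda>i. d $ i * u $ i)"
    proof (rule eq_vecI)
      fix i assume "i < dim_vec (vec k (\<lambda>i. d $ i * u $ i))"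
      then have i: "i < k" by simp
      have "(?D *\<^sub>v u) $ i = (\<Sum>j<k. if j = i then d $ i * u $ i else 0)"
        using i u by (simp add: scalar_prod_def atLeast0LessThan if_distrib[of "\<lambda>a. a * _"] cong: if_cong)
      then show "(?D *\<^sub>v u) $ i = vec k (\<lambda>i. d $ i * u $ i) $ i" using i by simp
    qed simp
    have "A *\<^sub>v v = Q *\<^sub>v (?D *\<^sub>v u)"
    proof -
      have "A *\<^sub>v v = (Q * ?D) *\<^sub>v u"
        unfolding AQ u_def by (rule assoc_mult_mat_vec) (use Q v in auto)
      then show ?thesis using assoc_mult_mat_vec[OF Q _ u, of ?D] by simp
    qed
    then have "v \<bullet> (A *\<^sub>v v) = (Q *\<^sub>v (?D *\<^sub>v u)) \<bullet> v"
      using comm_scalar_prod[OF v mult_mat_vec_carrier[OF Q mult_mat_vec_carrier[OF _ u, of ?D]]]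
      by simp
    also have "\<dots> = (?D *\<^sub>v u) \<bullet> u"
      using transpose_vec_mult_scalar[OF _ v DU, of "Q\<^sup>T"] Q by (simp add: u_def)
    also have "\<dots> = (\<Sum>i<k. d $ i * (u $ i)\<^sup>2)"
      unfolding Du using u by (simp add: scalar_prod_def atLeast0LessThan power2_eq_square mult.assoc)
    finally show ?thesis by (simp add: u_def)
  qed
  show ?thesis
  proof
    assume pd: "pd_mat k A"
    show "\<forall>i<k. d $ i > 0"
    proof (intro allI impI)
      fix i assume i: "i < k"
      have v: "col Q i \<in> carrier_vec k" using Q by auto
      have Qv: "Q\<^sup>T *\<^sub>v col Q i = unit_vec k i"
      proof -
        have "Q\<^sup>T *\<^sub>v col Q i = col (Q\<^sup>T * Q) i" using Q i by (intro col_mult2[symmetric, of _ k k]) auto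
        then show ?thesis using QQ i by simp
      qed
      have "col Q i \<noteq> 0\<^sub>v k"
      proof
        assume "col Q i = 0\<^sub>v k"
        then have "unit_vec k i $ i = (0 :: real)" using Q i by (simp add: Qv[symmetric])
        then show False using i by simp
      qed
      then have "0 < col Q i \<bullet> (A *\<^sub>v col Q i)"
        using pd v unfolding pd_mat_def by blast
      also have "\<dots> = (\<Sum>j<k. d $ j * (unit_vec k i $ j)\<^sup>2)"
        by (simp only: form[OF v] Qv)
      also have "\<dots> = (\<Sum>j<k. if j = i then d $ i else 0)" using i by (intro sum.cong) auto
      finally show "d $ i > 0" using i by simp
    qed
  next
    assume d: "\<forall>i<k. d $ i > 0"
    show "pd_mat k A"
      unfolding pd_mat_def
    proof (intro conjI ballI impI A)
      fix v :: "real vec" assume v: "v \<in> carrier_vec k" "v \<noteq> 0\<^sub>v k"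
      define u where "u = Q\<^sup>T *\<^sub>v v"
      have u: "u \<in> carrier_vec k" using Q v by (simp add: u_def)
      have "Q *\<^sub>v u = v"
        using assoc_mult_mat_vec[OF Q _ v(1), of "Q\<^sup>T"] Q v(1) QQ' by (simp add: u_def)
      then have "u \<noteq> 0\<^sub>v k" using v(2) Q by auto
      then obtain i where i: "i < k" "u $ i \<noteq> 0" using u by (auto simp: vec_eq_iff)
      have "0 < (\<Sum>i<k. d $ i * (u $ i)\<^sup>2)"
        by (rule sum_pos2[of _ i]) (use i d in \<open>auto simp: less_imp_le\<close>)
      then show "v \<bullet> (A *\<^sub>v v) > 0" using form[OF v(1)] by (simp add: u_def)
    qed
  qed
qed

section \<open>Feasibility of the triangulation programs\<close>

text \<open>
  The entries of the \<open>2n \<times> (2n + 1)\<close> matrix \<open>W = [I, - xh]\<close>, for which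
  \<open>G = W\<^sup>T W\<close>. The two case distinctions are written as factors because the machine reads them
  off its identity matrix.
\<close>

definition obs_factor :: "nat \<Rightarrow> real vec \<Rightarrow> nat \<Rightarrow> nat \<Rightarrow> real" where
  "obs_factor n xh k r = (if r = k then 1 else 0) - (if r = 2 * n then 1 else 0) * xh $ k"

lemma G_mat_gram:
  assumes xh: "xh \<in> carrier_vec (2 * n)"
  shows "G_mat n xh = gram_mat (2 * n + 1) (2 * n) (obs_factor n xh)"
proof (rule eq_matI)
  fix r c
  assume "r < dim_row (gram_mat (2 * n + 1) (2 * n) (obs_factor n xh))"
    "c < dim_col (gram_mat (2 * n + 1) (2 * n) (obs_factor n xh))"
  then have rc: "r < 2 * n + 1" "c < 2 * n + 1" by (simp_all add: gram_mat_def)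
  have "obs_factor n xh k r * obs_factor n xh k c =
      (if k = r then (if c = r then 1 else 0) - (if c = 2 * n then xh $ r else 0) else 0) +
      (if k = c then - (if r = 2 * n then xh $ c else 0) else 0) +
      (if r = 2 * n \<and> c = 2 * n then xh $ k * xh $ k else 0)" if "k < 2 * n" for k
    using that by (auto simp: obs_factor_def)
  then show "G_mat n xh $$ (r,c) = gram_mat (2 * n + 1) (2 * n) (obs_factor n xh) $$ (r,c)"
    using rc xh by (auto simp: gram_mat_def G_mat_def sum.distrib scalar_prod_def atLeast0LessThan)
qed (simp_all add: G_mat_def gram_mat_def)

lemma triangulation_sdp_wf:
  assumes "xh \<in> carrier_vec (2 * n)"
  shows "sdp_wf (triangulation_sdp n P xh)"
proof -
  have "sym_mat (2 * n + 1) (G_mat n xh)"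
    using gram_mat_psd by (simp add: G_mat_gram[OF assms] psd_mat_def)
  moreover have "sym_mat (2 * n + 1) (E_mat n)"
    unfolding sym_mat_def E_mat_def by (auto intro!: eq_matI)
  ultimately show ?thesis
    by (auto simp: sdp_wf_def triangulation_sdp_def sdp_dim_def F_mat_sym G_mat_def
        simp del: One_nat_def)
qed

lemma triangulation_dual_feasible:
  assumes xh: "xh \<in> carrier_vec (2 * n)"
  shows "\<exists>y. dual_feasible (triangulation_sdp n P xh) y"
proof -
  have "dual_slack (triangulation_sdp n P xh) (multipliers n (\<lambda>_ _. 0) 0) = G_mat n xh"
    by (simp add: triangulation_dual) (rule eq_matI, auto simp: G_mat_def)
  then have "dual_feasible (triangulation_sdp n P xh) (multipliers n (\<lambda>_ _. 0) 0)"
    using gram_mat_psd[of "2 * n + 1" "2 * n" "obs_factor n xh"] G_mat_gram[OF xh]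
    by (simp add: dual_feasible_def multipliers_def triangulation_sdp_def sdp_dim_def)
  then show ?thesis ..
qed

lemma inner_mat_gram_1:
  assumes A: "A \<in> carrier_mat k k" and v: "v \<in> carrier_vec k"
  shows "inner_mat A (gram_mat k 1 (\<lambda>_. ($) v)) = v \<bullet> (A *\<^sub>v v)"
proof -
  have "(\<Sum>j<k. A $$ (i, j) * (v $ i * v $ j)) = v $ i * (\<Sum>j<k. A $$ (i, j) * v $ j)" for i
    by (simp add: sum_distrib_left mult_ac)
  then show ?thesis
    using A v by (simp add: inner_mat_def gram_mat_def scalar_prod_def atLeast0LessThan)
qed

text \<open>
  The vector composed of \<open>z\<close>, \<open>-a\<close> and \<open>-b\<close> is in the kernel.
\<close>

lemma det_epipolar_mat_common_point:
  assumes A: "A \<in> carrier_mat 3 4" and B: "B \<in> carrier_mat 3 4"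
    and u: "u \<in> carrier_vec 3" and v: "v \<in> carrier_vec 3"
    and z: "z \<in> carrier_vec 4" "z \<noteq> 0\<^sub>v 4"
    and Az: "A *\<^sub>v z = a \<cdot>\<^sub>v u" and Bz: "B *\<^sub>v z = b \<cdot>\<^sub>v v"
  shows "det (epipolar_mat A B u v) = 0"
proof -
  let ?E = "epipolar_mat A B u v"
  define k where "k = vec 6 (\<lambda>i. if i < 4 then z $ i else if i = 4 then - a else - b)"
  have E: "?E \<in> carrier_mat 6 6" by (simp add: epipolar_mat_def)
  have "k \<noteq> 0\<^sub>v 6"
  proof
    assume k: "k = 0\<^sub>v 6"
    have "z $ i = 0" if "i < 4" for i
      using arg_cong[OF k, of "\<lambda>w. w $ i"] that by (simp add: k_def)
    then show False using z by auto
  qed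
  moreover have "?E *\<^sub>v k = 0\<^sub>v 6"
  proof (rule eq_vecI)
    fix r assume "r < dim_vec (0\<^sub>v 6 :: real vec)"
    then have r: "r < 6" by simp
    have A_r: "(\<Sum>c<4. A $$ (r,c) * z $ c) = a * u $ r" if "r < 3"
      using arg_cong[OF Az, of "\<lambda>w. w $ r"] that A u z
      by (simp add: scalar_prod_def atLeast0LessThan)
    have B_r: "(\<Sum>c<4. B $$ (r - 3,c) * z $ c) = b * v $ (r - 3)" if "\<not> r < 3"
      using arg_cong[OF Bz, of "\<lambda>w. w $ (r - 3)"] that r B v z
      by (simp add: scalar_prod_def atLeast0LessThan)
    have "(?E *\<^sub>v k) $ r = (\<Sum>c<6. ?E $$ (r,c) * k $ c)"
      using r E by (simp add: scalar_prod_def k_def atLeast0LessThan)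
    also have "\<dots> = 0"
      using r A_r B_r by (simp add: eval_nat_numeral epipolar_mat_def k_def)
    finally show "(?E *\<^sub>v k) $ r = 0\<^sub>v 6 $ r" using r by simp
  qed (simp add: epipolar_mat_def)
  ultimately show ?thesis
    using E by (subst det_0_iff_vec_prod_zero_field[of _ 6]) (auto simp: k_def intro!: exI[of _ k])
qed

lemma triangulation_primal_feasible:
  assumes cam: "cameras n P"
  shows "\<exists>Y. primal_feasible (triangulation_sdp n P xh) Y"
proof -
  have P: "P i \<in> carrier_mat 3 4" and rank: "vec_space.rank 3 (P i) = 3" if "i < n" for i
    using cam that by (auto simp: cameras_def)
  have "row (P i) 2 \<noteq> 0\<^sub>v 4" if i: "i < n" for i
  proof
    assume 0: "row (P i) 2 = 0\<^sub>v 4"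
    have "unit_vec 3 2 = (0\<^sub>v 3 :: real vec)"
    proof (rule full_rank_left_kernel[OF P[OF i] rank[OF i]])
      show "unit_vec 3 2 \<bullet> col (P i) j = 0" if "j < 4" for j
        using arg_cong[OF 0, of "\<lambda>w. w $ j"] that P[OF i] by (simp add: scalar_prod_left_unit)
    qed simp
    then show False using arg_cong[of _ _ "\<lambda>w. w $ 2"] by fastforce
  qed
  \<comment> \<open>A world point off all principal planes has a finite image in every camera.\<close>
  then obtain z where z: "z \<in> carrier_vec 4" and off: "\<And>i. i < n \<Longrightarrow> row (P i) 2 \<bullet> z \<noteq> 0"
    using finite_hyperplanes_avoidable[of n "\<lambda>i. row (P i) 2" 4] row_carrier_vec[OF _ P] by auto
  \<comment> \<open>The images of this point, with the depth \<open>row (P i) 2 \<bullet> z\<close> divided out.\<close>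
  define x where "x = vec (2 * n) (\<lambda>r. (P (r div 2) *\<^sub>v z) $ (r mod 2) / (row (P (r div 2)) 2 \<bullet> z))"
  have x: "x \<in> carrier_vec (2 * n)" by (simp add: x_def)
  have Pz: "P i *\<^sub>v z = (row (P i) 2 \<bullet> z) \<cdot>\<^sub>v homog (image_point x i)" if i: "i < n" for i
  proof (rule eq_vecI)
    fix r assume "r < dim_vec ((row (P i) 2 \<bullet> z) \<cdot>\<^sub>v homog (image_point x i))"
    then have "r < 3" by (simp add: homog_def image_point_def)
    then consider "r = 0" | "r = 1" | "r = 2" by linarith
    then show "(P i *\<^sub>v z) $ r = ((row (P i) 2 \<bullet> z) \<cdot>\<^sub>v homog (image_point x i)) $ r"
      using P[OF i] off[OF i] i by cases (auto simp: homog_def image_point_def x_def)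
  qed (use P[OF i] in \<open>simp add: homog_def image_point_def\<close>)
  have hom: "homog (image_point x i) \<in> carrier_vec 3" for i
    by (rule carrier_vecI) (simp add: homog_def image_point_def)
  have hx: "homog x \<in> carrier_vec (2 * n + 1)"
    by (rule carrier_vecI) (simp add: homog_def x_def)
  let ?Y = "gram_mat (2 * n + 1) 1 (\<lambda>_. ($) (homog x))"
  have "inner_mat (F_mat n P i j) ?Y = 0" if ij: "i < j" "j < n" for i j
  proof -
    have i: "i < n" using ij by simp
    have "z \<noteq> 0\<^sub>v 4" using off[OF i] row_carrier_vec[OF _ P[OF i], of 2] by auto
    have "inner_mat (F_mat n P i j) ?Y = homog x \<bullet> (F_mat n P i j *\<^sub>v homog x)"
      using F_mat_sym[of n P i j] by (intro inner_mat_gram_1 hx) (simp add: sym_mat_def)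
    also have "\<dots> = det (epipolar_mat (P i) (P j) (homog (image_point x i)) (homog (image_point x j)))"
      by (simp only: F_mat[OF x i ij(2)] fundamental_mat[OF hom hom])
    also have "\<dots> = 0"
      by (rule det_epipolar_mat_common_point[OF P[OF i] P[OF ij(2)] hom hom z \<open>z \<noteq> 0\<^sub>v 4\<close>
            Pz[OF i] Pz[OF ij(2)]])
    finally show ?thesis .
  qed
  moreover have "inner_mat (E_mat n) ?Y = 1"
  proof -
    have "inner_mat (E_mat n) ?Y = (\<Sum>i<2 * n + 1. \<Sum>j<2 * n + 1.
        if j = 2 * n then (if i = 2 * n then homog x $ i * homog x $ i else 0) else 0)"
      unfolding inner_mat_def by (intro sum.cong) (auto simp: E_mat_def gram_mat_def)
    also have "\<dots> = (homog x $ (2 * n))\<^sup>2" by (simp add: power2_eq_square del: sum.lessThan_Suc)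
    finally show ?thesis by (simp add: homog_def x_def)
  qed
  ultimately show ?thesis
    using gram_mat_psd unfolding triangulation_primal by blast
qed

section \<open>Bounded loops and matrix operations\<close>

text \<open>
  Total correctness with a time bound. A bound is used instead of the exact time because branches
  and inner loops of varying length then need no bookkeeping.
\<close>

definition runs :: "routines \<Rightarrow> com \<Rightarrow> state \<Rightarrow> nat \<Rightarrow> (state \<Rightarrow> bool) \<Rightarrow> bool" where
  "runs R c s T Q \<longleftrightarrow> (\<exists>t s'. exec R c s t s' \<and> t \<le> T \<and> Q s')"

lemma runsI: "exec R c s t s' \<Longrightarrow> t \<le> T \<Longrightarrow> Q s' \<Longrightarrow> runs R c s T Q"
  by (auto simp: runs_def)

lemma runs_mono: "runs R c s T Q \<Longrightarrow> T \<le> T' \<Longrightarrow> (\<And>s'. Q s' \<Longrightarrow> Q' s') \<Longrightarrow> runs R c s T' Q'"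
  by (auto simp: runs_def intro: order_trans)

lemma runs_Skip: "Q s \<Longrightarrow> runs R Skip s 1 Q"
  by (rule runsI[OF exec.Skip]) auto

lemma runs_Assign:
  "Q (s\<lparr>reg := (reg s)(v := aval a s)\<rparr>) \<Longrightarrow> runs R (Assign v a) s (1 + acost a) Q"
  by (rule runsI[OF exec.Assign]) auto

lemma runs_Store:
  "Q (s\<lparr>mem := (mem s)(aval k s := (mem s (aval k s))(aval i s :=
        (mem s (aval k s) (aval i s))(aval j s := rval e s)))\<rparr>) \<Longrightarrow>
    runs R (Store k i j e) s (1 + acost k + acost i + acost j + rcost e) Q"
  by (rule runsI[OF exec.Store[OF refl refl refl]]) auto

lemma runs_Seq:
  assumes "runs R c1 s T1 Q1" and "\<And>s'. Q1 s' \<Longrightarrow> runs R c2 s' T2 Q"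
  shows "runs R (Seq c1 c2) s (1 + T1 + T2) Q"
proof -
  obtain t1 s1 where 1: "exec R c1 s t1 s1" "t1 \<le> T1" "Q1 s1" using assms(1) by (auto simp: runs_def)
  obtain t2 s2 where 2: "exec R c2 s1 t2 s2" "t2 \<le> T2" "Q s2"
    using assms(2)[OF 1(3)] by (auto simp: runs_def)
  show ?thesis by (rule runsI[OF exec.Seq[OF 1(1) 2(1)]]) (use 1 2 in auto)
qed

lemma runs_Cond:
  assumes "bval b s \<Longrightarrow> runs R c1 s T Q" and "\<not> bval b s \<Longrightarrow> runs R c2 s T Q"
  shows "runs R (Cond b c1 c2) s (1 + bcost b + T) Q"
proof (cases "bval b s")
  case True
  then obtain t s' where "exec R c1 s t s'" "t \<le> T" "Q s'" using assms(1) by (auto simp: runs_def)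
  then show ?thesis using True by (intro runsI[OF exec.CondTrue]) auto
next
  case False
  then obtain t s' where "exec R c2 s t s'" "t \<le> T" "Q s'" using assms(2) by (auto simp: runs_def)
  then show ?thesis using False by (intro runsI[OF exec.CondFalse]) auto
qed

definition For :: "nat \<Rightarrow> aexp \<Rightarrow> com \<Rightarrow> com" where
  "For v a c = Seq (Assign v (Num 0))
     (While (ALess (Var v) a) (Seq c (Assign v (Plus (Var v) (Num 1)))))"

text \<open>
  Besides the body, an iteration pays for the test, the increment and the sequencing; the
  additional iteration covers the initialization and the final test.
\<close>

definition for_time :: "nat \<Rightarrow> aexp \<Rightarrow> nat \<Rightarrow> nat" where
  "for_time N a T = (N + 1) * (T + acost a + 8)"

text \<open>
  The invariant is stated for the state after the increment of the counter, and the body has to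
  leave the counter alone. The bound of the loop is reevaluated in every iteration, hence the second
  assumption.
\<close>

lemma runs_For:
  assumes init: "I 0 (s\<lparr>reg := (reg s)(v := 0)\<rparr>)"
    and bound: "\<And>k s. k \<le> N \<Longrightarrow> I k s \<Longrightarrow> reg s v = k \<Longrightarrow> aval a s = N"
    and step: "\<And>k s. k < N \<Longrightarrow> I k s \<Longrightarrow> reg s v = k \<Longrightarrow>
      runs R c s T (\<lambda>s'. reg s' v = k \<and> I (Suc k) (s'\<lparr>reg := (reg s')(v := Suc k)\<rparr>))"
  shows "runs R (For v a c) s (for_time N a T) (I N)"
proof -
  let ?W = "While (ALess (Var v) a) (Seq c (Assign v (Plus (Var v) (Num 1))))"
  have loop: "runs R ?W s ((N - k) * (T + acost a + 8) + 3 + acost a) (I N)"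
    if "k \<le> N" "I k s" "reg s v = k" for k s
    using that
  proof (induction "N - k" arbitrary: k s)
    case 0
    then have "k = N" by simp
    then show ?case using 0 bound[OF 0(2-4)]
      by (intro runsI[OF exec.WhileFalse]) auto
  next
    case (Suc d)
    then have k: "k < N" by simp
    obtain t1 s1 where 1: "exec R c s t1 s1" "t1 \<le> T" "reg s1 v = k"
      "I (Suc k) (s1\<lparr>reg := (reg s1)(v := Suc k)\<rparr>)"
      using step[OF k Suc(4,5)] by (auto simp: runs_def)
    let ?s2 = "s1\<lparr>reg := (reg s1)(v := Suc k)\<rparr>"
    obtain t2 s3 where 2: "exec R ?W ?s2 t2 s3"
      "t2 \<le> (N - Suc k) * (T + acost a + 8) + 3 + acost a" "I N s3"
      using Suc(1)[of "Suc k" ?s2] Suc(2) k 1(4) unfolding runs_def by fastforce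
    have inc: "exec R (Assign v (Plus (Var v) (Num 1))) s1 4 ?s2"
      using exec.Assign[of R v "Plus (Var v) (Num 1)" s1] 1(3) by (simp add: numeral_eq_Suc)
    have "(N - k) * (T + acost a + 8) = (T + acost a + 8) + (N - Suc k) * (T + acost a + 8)"
      using k by (metis Suc_diff_Suc mult_Suc)
    then show ?case
      using k bound[OF Suc(3-5)] 1(2,3) 2(2,3) Suc(5)
      by (intro runsI[OF exec.WhileTrue[OF _ exec.Seq[OF 1(1) inc] 2(1)]]) auto
  qed
  have "runs R (For v a c) s (1 + (1 + acost (Num 0)) + (N * (T + acost a + 8) + 3 + acost a)) (I N)"
    unfolding For_def
    by (rule runs_Seq[OF runs_Assign[where Q = "\<lambda>s'. s' = s\<lparr>reg := (reg s)(v := 0)\<rparr>"]])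
      (use loop[of 0] init in auto)
  then show ?thesis by (rule runs_mono) (auto simp: for_time_def)
qed

definition same_regs :: "nat set \<Rightarrow> state \<Rightarrow> state \<Rightarrow> bool" where
  "same_regs V s s' \<longleftrightarrow> (\<forall>v. v \<notin> V \<longrightarrow> reg s' v = reg s v)"

lemma same_regs_trans: "same_regs V s s' \<Longrightarrow> same_regs W s' s'' \<Longrightarrow> V \<union> W \<subseteq> X \<Longrightarrow> same_regs X s s''"
  unfolding same_regs_def by (metis Un_iff subsetD)

text \<open>
  Registers \<open>10\<close> and \<open>11\<close> hold the row and the column of the entry being computed, and the
  expression for the entry refers to them.
\<close>

definition fill :: "aexp \<Rightarrow> aexp \<Rightarrow> aexp \<Rightarrow> rexp \<Rightarrow> com" where
  "fill k nr nc e = For 10 nr (For 11 nc (Store k (Var 10) (Var 11) e))"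

definition fill_time :: "nat \<Rightarrow> nat \<Rightarrow> aexp \<Rightarrow> aexp \<Rightarrow> aexp \<Rightarrow> rexp \<Rightarrow> nat" where
  "fill_time M N k nr nc e =
     for_time M nr (for_time N nc (1 + acost k + acost (Var 10) + acost (Var 11) + rcost e))"

definition set_block ::
  "nat \<Rightarrow> nat \<Rightarrow> nat \<Rightarrow> (nat \<Rightarrow> nat \<Rightarrow> real) \<Rightarrow> state \<Rightarrow> nat \<Rightarrow> nat \<Rightarrow> nat \<Rightarrow> real" where
  "set_block K M N f s = (mem s)(K := \<lambda>i j. if i < M \<and> j < N then f i j else mem s K i j)"

text \<open>
  The expression may read the cell that it is about to overwrite, which still has its old value;
  this makes \<open>fill\<close> usable for updates as well.
\<close>

lemma runs_fill:
  assumes adr: "\<And>s'. same_regs {10,11} s s' \<Longrightarrow> aval k s' = K \<and> aval nr s' = M \<and> aval nc s' = N"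
    and val: "\<And>s' i j. i < M \<Longrightarrow> j < N \<Longrightarrow> same_regs {10,11} s s' \<Longrightarrow> reg s' 10 = i \<Longrightarrow>
      reg s' 11 = j \<Longrightarrow> (\<And>a. a \<noteq> K \<Longrightarrow> mem s' a = mem s a) \<Longrightarrow> mem s' K i j = mem s K i j \<Longrightarrow>
      rval e s' = f i j"
  shows "runs R (fill k nr nc e) s (fill_time M N k nr nc e)
    (\<lambda>s'. same_regs {10,11} s s' \<and> mem s' = set_block K M N f s)"
proof -
  define B where "B i j = (mem s)(K := \<lambda>i' j'. if i' < i \<and> j' < N \<or> i' = i \<and> j' < j then f i' j'
    else mem s K i' j')" for i j
  define I where "I i s' \<longleftrightarrow> same_regs {10,11} s s' \<and> mem s' = B i 0" for i s'
  define J where "J i j s' \<longleftrightarrow> same_regs {10,11} s s' \<and> reg s' 10 = i \<and> mem s' = B i j" for i j s'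
  have BN: "B i N = B (Suc i) 0" for i by (auto simp: B_def less_Suc_eq fun_eq_iff)
  have "runs R (fill k nr nc e) s (fill_time M N k nr nc e) (I M)"
    unfolding fill_def fill_time_def
  proof (rule runs_For[where I = I])
    show "I 0 (s\<lparr>reg := (reg s)(10 := 0)\<rparr>)" by (simp add: I_def B_def same_regs_def)
    show "aval nr s' = M" if "I i s'" for i s' using that adr by (simp add: I_def)
  next
    fix i s1 assume i: "i < M" and I: "I i s1" and r10: "reg s1 10 = i"
    have "runs R (For 11 nc (Store k (Var 10) (Var 11) e)) s1
      (for_time N nc (1 + acost k + acost (Var 10) + acost (Var 11) + rcost e)) (J i N)"
    proof (rule runs_For[where I = "J i"])
      show "J i 0 (s1\<lparr>reg := (reg s1)(11 := 0)\<rparr>)"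
        using I r10 by (simp add: I_def J_def same_regs_def)
      show "aval nc s' = N" if "J i j s'" for j s' using that adr by (simp add: J_def)
    next
      fix j s2 assume j: "j < N" and J: "J i j s2" and r11: "reg s2 11 = j"
      have K: "aval k s2 = K" using J adr by (simp add: J_def)
      have e: "rval e s2 = f i j"
        by (rule val) (use i j J r11 in \<open>auto simp: J_def B_def\<close>)
      show "runs R (Store k (Var 10) (Var 11) e) s2
          (1 + acost k + acost (Var 10) + acost (Var 11) + rcost e)
          (\<lambda>s'. reg s' 11 = j \<and> J i (Suc j) (s'\<lparr>reg := (reg s')(11 := Suc j)\<rparr>))"
        by (rule runs_Store)
          (use J r11 in \<open>auto simp: J_def K e same_regs_def B_def less_Suc_eq fun_eq_iff\<close>)
    qed
    then show "runs R (For 11 nc (Store k (Var 10) (Var 11) e)) s1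
        (for_time N nc (1 + acost k + acost (Var 10) + acost (Var 11) + rcost e))
        (\<lambda>s'. reg s' 10 = i \<and> I (Suc i) (s'\<lparr>reg := (reg s')(10 := Suc i)\<rparr>))"
      by (rule runs_mono) (auto simp: I_def J_def BN same_regs_def)
  qed
  then show ?thesis
    by (rule runs_mono) (auto simp: I_def B_def set_block_def)
qed

text \<open>
  Register \<open>12\<close> holds the summation index.
\<close>

definition accumulate :: "aexp \<Rightarrow> aexp \<Rightarrow> aexp \<Rightarrow> aexp \<Rightarrow> rexp \<Rightarrow> com" where
  "accumulate k nr nc na e = For 12 na (fill k nr nc (Add (Cell k (Var 10) (Var 11)) e))"

definition accumulate_time :: "nat \<Rightarrow> nat \<Rightarrow> nat \<Rightarrow> aexp \<Rightarrow> aexp \<Rightarrow> aexp \<Rightarrow> aexp \<Rightarrow> rexp \<Rightarrow> nat" where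
  "accumulate_time M N L k nr nc na e =
     for_time L na (fill_time M N k nr nc (Add (Cell k (Var 10) (Var 11)) e))"

lemma runs_accumulate:
  assumes adr: "\<And>s'. same_regs {10,11,12} s s' \<Longrightarrow>
      aval k s' = K \<and> aval nr s' = M \<and> aval nc s' = N \<and> aval na s' = L"
    and val: "\<And>s' t i j. t < L \<Longrightarrow> i < M \<Longrightarrow> j < N \<Longrightarrow> same_regs {10,11,12} s s' \<Longrightarrow>
      reg s' 10 = i \<Longrightarrow> reg s' 11 = j \<Longrightarrow> reg s' 12 = t \<Longrightarrow>
      (\<And>a. a \<noteq> K \<Longrightarrow> mem s' a = mem s a) \<Longrightarrow> rval e s' = f t i j"
  shows "runs R (accumulate k nr nc na e) s (accumulate_time M N L k nr nc na e)
    (\<lambda>s'. same_regs {10,11,12} s s' \<and>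
      mem s' = set_block K M N (\<lambda>i j. mem s K i j + (\<Sum>t<L. f t i j)) s)"
  unfolding accumulate_def accumulate_time_def
proof (rule runs_For[where I = "\<lambda>t s'. same_regs {10,11,12} s s' \<and>
      mem s' = set_block K M N (\<lambda>i j. mem s K i j + (\<Sum>u<t. f u i j)) s"])
  fix t s1
  assume t: "t < L" and I: "same_regs {10,11,12} s s1 \<and>
      mem s1 = set_block K M N (\<lambda>i j. mem s K i j + (\<Sum>u<t. f u i j)) s" and r: "reg s1 12 = t"
  have "runs R (fill k nr nc (Add (Cell k (Var 10) (Var 11)) e)) s1
      (fill_time M N k nr nc (Add (Cell k (Var 10) (Var 11)) e))
      (\<lambda>s'. same_regs {10,11} s1 s' \<and>
        mem s' = set_block K M N (\<lambda>i j. mem s K i j + (\<Sum>u<Suc t. f u i j)) s1)"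
  proof (rule runs_fill)
    fix s2 assume s2: "same_regs {10,11} s1 s2"
    have s2': "same_regs {10,11,12} s s2"
      by (rule same_regs_trans[OF conjunct1[OF I] s2]) auto
    show K: "aval k s2 = K \<and> aval nr s2 = M \<and> aval nc s2 = N" using adr[OF s2'] by simp
    fix i j
    assume ij: "i < M" "j < N" "reg s2 10 = i" "reg s2 11 = j"
      and m: "\<And>a. a \<noteq> K \<Longrightarrow> mem s2 a = mem s1 a" "mem s2 K i j = mem s1 K i j"
    have "rval e s2 = f t i j"
      by (rule val[OF t ij(1,2) s2' ij(3,4)])
        (use s2 r m(1) I in \<open>auto simp: same_regs_def set_block_def\<close>)
    then show "rval (Add (Cell k (Var 10) (Var 11)) e) s2 = mem s K i j + (\<Sum>u<Suc t. f u i j)"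
      using K ij m I by (simp add: set_block_def)
  qed
  then show "runs R (fill k nr nc (Add (Cell k (Var 10) (Var 11)) e)) s1
      (fill_time M N k nr nc (Add (Cell k (Var 10) (Var 11)) e))
      (\<lambda>s'. reg s' 12 = t \<and> same_regs {10,11,12} s (s'\<lparr>reg := (reg s')(12 := Suc t)\<rparr>) \<and>
        mem (s'\<lparr>reg := (reg s')(12 := Suc t)\<rparr>) =
        set_block K M N (\<lambda>i j. mem s K i j + (\<Sum>u<Suc t. f u i j)) s)"
    by (rule runs_mono) (use I r in \<open>auto simp: same_regs_def set_block_def fun_eq_iff\<close>)
qed (use adr in \<open>auto simp: same_regs_def set_block_def\<close>)

definition check_all :: "nat \<Rightarrow> aexp \<Rightarrow> bexp \<Rightarrow> com" where
  "check_all v na b = Seq (Assign v (Num 1)) (For 12 na (Cond b Skip (Assign v (Num 0))))"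

definition check_all_time :: "nat \<Rightarrow> aexp \<Rightarrow> bexp \<Rightarrow> nat" where
  "check_all_time L na b = 3 + for_time L na (3 + bcost b)"

lemma runs_check_all:
  assumes v: "v \<noteq> 12" and adr: "\<And>s'. same_regs {v,12} s s' \<Longrightarrow> aval na s' = L"
    and val: "\<And>s' i. i < L \<Longrightarrow> same_regs {v,12} s s' \<Longrightarrow> reg s' 12 = i \<Longrightarrow> mem s' = mem s \<Longrightarrow>
      bval b s' \<longleftrightarrow> \<phi> i"
  shows "runs R (check_all v na b) s (check_all_time L na b)
    (\<lambda>s'. same_regs {v,12} s s' \<and> mem s' = mem s \<and> reg s' v = (if \<forall>i<L. \<phi> i then 1 else 0))"
proof -
  define I where "I k s' \<longleftrightarrow> same_regs {v,12} s s' \<and> mem s' = mem s \<and>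
    reg s' v = (if \<forall>i<k. \<phi> i then 1 else 0)" for k s'
  have "runs R (check_all v na b) s (1 + (1 + acost (Num 1)) + for_time L na (1 + bcost b + 2)) (I L)"
    unfolding check_all_def
  proof (rule runs_Seq[OF runs_Assign[where Q = "I 0"] runs_For[where I = I]])
    show "I 0 (s\<lparr>reg := (reg s)(v := aval (Num 1) s)\<rparr>)" by (simp add: I_def same_regs_def)
  next
    fix s1 assume "I 0 s1"
    then show "I 0 (s1\<lparr>reg := (reg s1)(12 := 0)\<rparr>)" using v by (simp add: I_def same_regs_def)
  next
    fix k s1 assume "I k s1"
    then show "aval na s1 = L" using adr by (simp add: I_def)
  next
    fix k s1 assume k: "k < L" "I k s1" "reg s1 12 = k"
    have b: "bval b s1 \<longleftrightarrow> \<phi> k" by (rule val) (use k in \<open>auto simp: I_def\<close>)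
    show "runs R (Cond b Skip (Assign v (Num 0))) s1 (1 + bcost b + 2)
      (\<lambda>s'. reg s' 12 = k \<and> I (Suc k) (s'\<lparr>reg := (reg s')(12 := Suc k)\<rparr>))"
    proof (rule runs_Cond)
      assume "bval b s1"
      then show "runs R Skip s1 2 (\<lambda>s'. reg s' 12 = k \<and> I (Suc k) (s'\<lparr>reg := (reg s')(12 := Suc k)\<rparr>))"
        using k b v by (intro runs_mono[OF runs_Skip[where Q = "(=) s1"]])
          (auto simp: I_def same_regs_def less_Suc_eq)
    next
      assume "\<not> bval b s1"
      then have "runs R (Assign v (Num 0)) s1 (1 + acost (Num 0))
          (\<lambda>s'. reg s' 12 = k \<and> I (Suc k) (s'\<lparr>reg := (reg s')(12 := Suc k)\<rparr>))"
        using k b v by (intro runs_Assign) (auto simp: I_def same_regs_def less_Suc_eq)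
      then show "runs R (Assign v (Num 0)) s1 2
          (\<lambda>s'. reg s' 12 = k \<and> I (Suc k) (s'\<lparr>reg := (reg s')(12 := Suc k)\<rparr>))"
        by (rule runs_mono) simp_all
    qed
  qed
  then show ?thesis by (rule runs_mono) (auto simp: I_def check_all_time_def for_time_def)
qed

definition find_min :: "nat \<Rightarrow> aexp \<Rightarrow> aexp \<Rightarrow> com" where
  "find_min v k na = Seq (Assign v (Num 0)) (For 12 na
     (Cond (RLess (Cell k (Var 12) (Num 0)) (Cell k (Var v) (Num 0))) (Assign v (Var 12)) Skip))"

definition find_min_time :: "nat \<Rightarrow> aexp \<Rightarrow> aexp \<Rightarrow> nat" where
  "find_min_time L k na = 3 + for_time L na (10 + 2 * acost k)"

lemma runs_find_min:
  assumes v: "v \<noteq> 12" and L: "L > 0"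
    and adr: "\<And>s'. same_regs {v,12} s s' \<Longrightarrow> aval na s' = L \<and> aval k s' = K"
  shows "runs R (find_min v k na) s (find_min_time L k na)
    (\<lambda>s'. same_regs {v,12} s s' \<and> mem s' = mem s \<and> reg s' v < L \<and>
      (\<forall>i<L. mem s K (reg s' v) 0 \<le> mem s K i 0))"
proof -
  define I where "I t s' \<longleftrightarrow> same_regs {v,12} s s' \<and> mem s' = mem s \<and> reg s' v < L \<and>
    (\<forall>i<t. mem s K (reg s' v) 0 \<le> mem s K i 0)" for t s'
  let ?b = "RLess (Cell k (Var 12) (Num 0)) (Cell k (Var v) (Num 0))"
  have "runs R (find_min v k na) s
      (1 + (1 + acost (Num 0)) + for_time L na (1 + bcost ?b + 2)) (I L)"
    unfolding find_min_def
  proof (rule runs_Seq[OF runs_Assign[where Q = "I 0"] runs_For[where I = I]])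
    show "I 0 (s\<lparr>reg := (reg s)(v := aval (Num 0) s)\<rparr>)" using L by (simp add: I_def same_regs_def)
  next
    fix s1 assume "I 0 s1"
    then show "I 0 (s1\<lparr>reg := (reg s1)(12 := 0)\<rparr>)" using v by (simp add: I_def same_regs_def)
  next
    fix t s1 assume "I t s1"
    then show "aval na s1 = L" using adr by (simp add: I_def)
  next
    fix t s1 assume t: "t < L" "I t s1" "reg s1 12 = t"
    have K: "aval k s1 = K" using adr t by (simp add: I_def)
    show "runs R (Cond ?b (Assign v (Var 12)) Skip) s1 (1 + bcost ?b + 2)
      (\<lambda>s'. reg s' 12 = t \<and> I (Suc t) (s'\<lparr>reg := (reg s')(12 := Suc t)\<rparr>))"
    proof (rule runs_Cond)
      assume "\<not> bval ?b s1"
      then show "runs R Skip s1 2 (\<lambda>s'. reg s' 12 = t \<and> I (Suc t) (s'\<lparr>reg := (reg s')(12 := Suc t)\<rparr>))"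
        using t K v by (intro runs_mono[OF runs_Skip[where Q = "(=) s1"]])
          (auto simp: I_def same_regs_def less_Suc_eq)
    next
      assume "bval ?b s1"
      then have "runs R (Assign v (Var 12)) s1 (1 + acost (Var 12))
          (\<lambda>s'. reg s' 12 = t \<and> I (Suc t) (s'\<lparr>reg := (reg s')(12 := Suc t)\<rparr>))"
        using t K v by (intro runs_Assign) (auto simp: I_def same_regs_def less_Suc_eq)
      then show "runs R (Assign v (Var 12)) s1 2
          (\<lambda>s'. reg s' 12 = t \<and> I (Suc t) (s'\<lparr>reg := (reg s')(12 := Suc t)\<rparr>))"
        by (rule runs_mono) simp_all
    qed
  qed
  then show ?thesis
    by (rule runs_mono) (auto simp: I_def find_min_time_def for_time_def algebra_simps)
qed

section \<open>Determinants as expressions\<close>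

fun sum_rexp :: "rexp list \<Rightarrow> rexp" where
  "sum_rexp [] = Const 0"
| "sum_rexp (e # es) = Add e (sum_rexp es)"

lemma rval_sum_rexp: "rval (sum_rexp es) s = (\<Sum>e\<leftarrow>es. rval e s)"
  by (induction es) simp_all

text \<open>
  Laplace expansion along the first row. It is only applied for \<open>k = 4\<close> and \<open>k = 6\<close>, so that its
  factorial size is a constant.
\<close>

fun det_rexp :: "nat \<Rightarrow> (nat \<Rightarrow> nat \<Rightarrow> rexp) \<Rightarrow> rexp" where
  "det_rexp 0 M = Const 1"
| "det_rexp (Suc k) M = sum_rexp (map (\<lambda>j. Mul (Mul (M 0 j) (Const ((- 1) ^ j)))
     (det_rexp k (\<lambda>r c. M (Suc r) (if c < j then c else Suc c)))) [0..<Suc k])"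

lemma rval_det_rexp: "rval (det_rexp k M) s = det (mat k k (\<lambda>(r,c). rval (M r c) s))"
proof (induction k arbitrary: M)
  case 0
  then show ?case by (simp add: det_def)
next
  case (Suc k)
  let ?A = "mat (Suc k) (Suc k) (\<lambda>(r,c). rval (M r c) s)"
  have minor: "mat_delete ?A 0 j =
      mat k k (\<lambda>(r,c). rval (M (Suc r) (if c < j then c else Suc c)) s)" if "j < Suc k" for j
    using that by (intro eq_matI) (auto simp: mat_delete_def)
  have "det ?A = (\<Sum>j<Suc k. ?A $$ (0,j) * cofactor ?A 0 j)"
    by (rule laplace_expansion_row) simp_all
  also have "\<dots> = (\<Sum>j<Suc k. rval (M 0 j) s * (- 1) ^ j *
      rval (det_rexp k (\<lambda>r c. M (Suc r) (if c < j then c else Suc c))) s)"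
    by (intro sum.cong refl) (simp add: cofactor_def minor Suc.IH)
  also have "\<dots> = rval (det_rexp (Suc k) M) s"
    by (simp add: rval_sum_rexp interv_sum_list_conv_sum_set_nat atLeast0LessThan comp_def
        del: upt_Suc sum.lessThan_Suc)
  finally show ?case ..
qed

text \<open>
  From here on only the value of the expression matters; unfolding it would produce hundreds of
  products.
\<close>

declare det_rexp.simps [simp del]

section \<open>Polynomially bounded functions\<close>

definition poly_bounded :: "(nat \<Rightarrow> nat) \<Rightarrow> bool" where
  "poly_bounded f \<longleftrightarrow> (\<exists>p :: nat poly. \<forall>n. f n \<le> poly p n)"

lemma poly_bounded_le: "poly_bounded f \<Longrightarrow> (\<And>n. g n \<le> f n) \<Longrightarrow> poly_bounded g"
  by (meson order_trans poly_bounded_def)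

lemma poly_bounded_const: "poly_bounded (\<lambda>_. c)"
  unfolding poly_bounded_def by (rule exI[of _ "[:c:]"]) simp

lemma poly_bounded_id: "poly_bounded (\<lambda>n. n)"
  unfolding poly_bounded_def by (rule exI[of _ "[:0, 1:]"]) simp

lemma poly_bounded_add: "poly_bounded f \<Longrightarrow> poly_bounded g \<Longrightarrow> poly_bounded (\<lambda>n. f n + g n)"
  unfolding poly_bounded_def by (metis add_mono poly_add)

lemma poly_bounded_mult: "poly_bounded f \<Longrightarrow> poly_bounded g \<Longrightarrow> poly_bounded (\<lambda>n. f n * g n)"
  unfolding poly_bounded_def by (metis mult_le_mono poly_mult)

lemma poly_nat_mono: "m \<le> n \<Longrightarrow> poly (p :: nat poly) m \<le> poly p n"
  by (induction p) (auto intro!: add_mono mult_mono)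

text \<open>
  Polynomials over the natural numbers are monotone, so bounds may be substituted into them.
\<close>

lemma poly_bounded_poly: "poly_bounded f \<Longrightarrow> poly_bounded (\<lambda>n. poly q (f n))"
  unfolding poly_bounded_def by (metis poly_nat_mono poly_pcompose)

section \<open>Memory layout\<close>

text \<open>
  After the cameras at \<open>0, \<dots>, n - 1\<close> and the observation at \<open>n\<close>, the memory contains an identity
  matrix at \<open>n + 1\<close> and the semidefinite program from \<open>n + 2\<close> on: the objective, the constraint
  matrices and the right-hand sides, as the solver expects them. All later results are stored
  relative to the next free address \<open>q\<close>, kept in register \<open>2\<close>:
  \<open>q\<close> and \<open>q + 1\<close> for the primal and dual solutions, \<open>q + 2\<close> for the Hessian, \<open>q + 3\<close> and
  \<open>q + 4\<close> for its eigenvectors and eigenvalues, \<open>q + 5\<close> for the linear system, \<open>q + 6\<close> to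
  \<open>q + 8\<close> for its singular value decomposition, \<open>q + 9\<close> for the world point, \<open>q + 10\<close> for the
  centers and \<open>q + 11\<close> for their Gram matrix.

  Register \<open>0\<close> holds \<open>n\<close>, register \<open>1\<close> holds \<open>2n\<close>, and register \<open>3\<close> the number of constraints
  written so far. Register \<open>4\<close> is the index of the smallest singular value, and \<open>5\<close> and \<open>6\<close> are the
  outcomes of the tests for definiteness and reprojection. Loop counters are \<open>10\<close> to \<open>13\<close>.
\<close>

abbreviation "unit_adr \<equiv> Plus (Var 0) (Num 1)"
abbreviation "objective_adr \<equiv> Plus (Var 0) (Num 2)"
abbreviation "constraint_adr \<equiv> Plus (Plus (Var 0) (Num 3)) (Var 3)"
abbreviation "output_adr k \<equiv> Plus (Var 2) (Num k)"
abbreviation "sdp_dim_exp \<equiv> Plus (Var 1) (Num 1)"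

definition frame :: "nat set \<Rightarrow> nat set \<Rightarrow> state \<Rightarrow> state \<Rightarrow> bool" where
  "frame V A s s' \<longleftrightarrow> same_regs V s s' \<and> (\<forall>a. a \<notin> A \<longrightarrow> mem s' a = mem s a)"

lemma frame_trans:
  "frame V A s s' \<Longrightarrow> frame W B s' s'' \<Longrightarrow> V \<union> W \<subseteq> X \<Longrightarrow> A \<union> B \<subseteq> C \<Longrightarrow> frame X C s s''"
  unfolding frame_def same_regs_def by (metis Un_iff subsetD)

lemma frame_reg: "frame V A s s' \<Longrightarrow> v \<notin> V \<Longrightarrow> reg s' v = reg s v"
  by (simp add: frame_def same_regs_def)

lemma frame_mem: "frame V A s s' \<Longrightarrow> a \<notin> A \<Longrightarrow> mem s' a = mem s a"
  by (simp add: frame_def)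

definition problem_state :: "nat \<Rightarrow> (nat \<Rightarrow> real mat) \<Rightarrow> real vec \<Rightarrow> state \<Rightarrow> bool" where
  "problem_state n P xh s \<longleftrightarrow> reg s 0 = n \<and> reg s 1 = 2 * n \<and>
     (\<forall>i<n. \<forall>r<3. \<forall>c<4. mem s i r c = P i $$ (r,c)) \<and>
     (\<forall>r<2 * n. mem s n r 0 = xh $ r) \<and>
     (\<forall>i\<le>2 * n. \<forall>j\<le>2 * n. mem s (n + 1) i j = (if i = j then 1 else 0))"

lemma problem_state_frame:
  assumes "problem_state n P xh s" and "frame V A s s'" and "0 \<notin> V" "1 \<notin> V" and "\<forall>a\<in>A. n + 1 < a"
  shows "problem_state n P xh s'"
proof -
  have "mem s' a = mem s a" if "a \<le> n + 1" for a
    using assms(2,5) that unfolding frame_def by (meson leD)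
  then show ?thesis
    using assms(1) frame_reg[OF assms(2) assms(3)] frame_reg[OF assms(2) assms(4)]
    by (simp add: problem_state_def)
qed

text \<open>
  Accumulation presupposes that the target is \<open>0\<close>, and so do the right-hand sides of the program,
  of which only the last one is written.
\<close>

definition blank_above :: "nat \<Rightarrow> state \<Rightarrow> bool" where
  "blank_above b s \<longleftrightarrow> (\<forall>a>b. mem s a = (\<lambda>_ _. 0))"

lemma blank_above_frame:
  "blank_above b s \<Longrightarrow> frame V A s s' \<Longrightarrow> b \<le> b' \<Longrightarrow> \<forall>a\<in>A. a \<le> b' \<Longrightarrow> blank_above b' s'"
  unfolding blank_above_def frame_def by (metis leD order_le_less_trans)

section \<open>Writing down the semidefinite program\<close>

definition setup_prog :: com where
  "setup_prog = Seq (Assign 1 (Plus (Var 0) (Var 0)))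
     (For 12 sdp_dim_exp (Store unit_adr (Var 12) (Var 12) (Const 1)))"

definition setup_time :: "nat \<Rightarrow> nat" where
  "setup_time n = 5 + for_time (2 * n + 1) sdp_dim_exp 7"

lemma mem_fold_put_mat:
  "mem (fold (\<lambda>i. put_mat i (P i)) [0..<k] s) a i j =
    (if a < k \<and> i < dim_row (P a) \<and> j < dim_col (P a) then P a $$ (i,j) else mem s a i j)"
  by (induction k) (auto simp: put_mat_def less_Suc_eq)

lemma reg_fold_put_mat: "reg (fold (\<lambda>i. put_mat i (P i)) is s) = reg s"
  by (induction "is" arbitrary: s) (simp_all add: put_mat_def)

lemma input_state:
  assumes P: "\<And>i. i < n \<Longrightarrow> P i \<in> carrier_mat 3 4" and xh: "xh \<in> carrier_vec (2 * n)"
  shows "reg (input n P xh) = (\<lambda>_. 0)(0 := n)"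
    and "i < n \<Longrightarrow> r < 3 \<Longrightarrow> c < 4 \<Longrightarrow> mem (input n P xh) i r c = P i $$ (r,c)"
    and "k < 2 * n \<Longrightarrow> mem (input n P xh) n k 0 = xh $ k"
    and "blank_above n (input n P xh)"
proof -
  show "reg (input n P xh) = (\<lambda>_. 0)(0 := n)"
    by (simp add: input_def put_vec_def put_mat_def reg_fold_put_mat)
  show "mem (input n P xh) i r c = P i $$ (r,c)" if "i < n" "r < 3" "c < 4"
    using that P[OF that(1)] by (simp add: input_def put_vec_def put_mat_def mem_fold_put_mat)
  show "mem (input n P xh) n k 0 = xh $ k" if "k < 2 * n"
    using that xh by (simp add: input_def put_vec_def put_mat_def)
  show "blank_above n (input n P xh)"
    by (auto simp: blank_above_def input_def put_vec_def put_mat_def mem_fold_put_mat fun_eq_iff)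
qed

lemma runs_setup:
  assumes P: "\<And>i. i < n \<Longrightarrow> P i \<in> carrier_mat 3 4" and xh: "xh \<in> carrier_vec (2 * n)"
  shows "runs R setup_prog (input n P xh) (setup_time n)
    (\<lambda>s. problem_state n P xh s \<and> blank_above (n + 1) s \<and> reg s 3 = 0)"
proof -
  let ?s = "input n P xh"
  define I where "I k s \<longleftrightarrow> frame {1,12} {n + 1} ?s s \<and> reg s 1 = 2 * n \<and>
    (\<forall>i j. mem s (n + 1) i j = (if i = j \<and> i < k then 1 else 0))" for k s
  note inp = input_state[OF P xh]
  have r: "reg s 0 = n" "reg s 1 = 2 * n" if "I k s" for k s
    using that frame_reg[of "{1,12}" "{n+1}" ?s s 0] inp(1) by (auto simp: I_def)
  have "runs R setup_prog ?s (1 + (1 + acost (Plus (Var 0) (Var 0))) +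
      for_time (2 * n + 1) sdp_dim_exp 7) (I (2 * n + 1))"
    unfolding setup_prog_def
  proof (rule runs_Seq[OF runs_Assign[where Q = "I 0"] runs_For[where I = I]])
    show "I 0 (?s\<lparr>reg := (reg ?s)(1 := aval (Plus (Var 0) (Var 0)) ?s)\<rparr>)"
      using inp(4) by (auto simp: I_def frame_def same_regs_def inp(1) blank_above_def)
  next
    fix k s assume k: "k < 2 * n + 1" "I k s" "reg s 12 = k"
    have "runs R (Store unit_adr (Var 12) (Var 12) (Const 1)) s
        (1 + acost unit_adr + acost (Var 12) + acost (Var 12) + rcost (Const 1))
        (\<lambda>s'. reg s' 12 = k \<and> I (Suc k) (s'\<lparr>reg := (reg s')(12 := Suc k)\<rparr>))"
      using k r[OF k(2)] by (intro runs_Store) (auto simp: I_def frame_def same_regs_def)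
    then show "runs R (Store unit_adr (Var 12) (Var 12) (Const 1)) s 7
        (\<lambda>s'. reg s' 12 = k \<and> I (Suc k) (s'\<lparr>reg := (reg s')(12 := Suc k)\<rparr>))"
      by (rule runs_mono) simp_all
  next
    fix k s assume "I k s"
    then show "aval sdp_dim_exp s = 2 * n + 1" using r by simp
  qed (auto simp: I_def frame_def same_regs_def)
  then show ?thesis
  proof (rule runs_mono)
    fix s assume I: "I (2 * n + 1) s"
    then have m: "mem s a = mem ?s a" if "a \<noteq> n + 1" for a using that by (simp add: I_def frame_def)
    have "blank_above (n + 1) s" using m inp(4) by (simp add: blank_above_def)
    moreover have "problem_state n P xh s"
      using r[OF I] m inp(2,3) I by (auto simp: problem_state_def I_def)
    moreover have "reg s 3 = 0" using I inp(1) by (simp add: I_def frame_def same_regs_def)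
    ultimately show "problem_state n P xh s \<and> blank_above (n + 1) s \<and> reg s 3 = 0" by simp
  qed (simp add: setup_time_def)
qed

abbreviation "factor_rexp v \<equiv> Sub (Cell unit_adr (Var 12) (Var v))
  (Mul (Cell unit_adr (Var 1) (Var v)) (Cell (Var 0) (Var 12) (Num 0)))"

definition objective_prog :: com where
  "objective_prog = accumulate objective_adr sdp_dim_exp sdp_dim_exp (Var 1)
     (Mul (factor_rexp 10) (factor_rexp 11))"

definition objective_time :: "nat \<Rightarrow> nat" where
  "objective_time n = accumulate_time (2 * n + 1) (2 * n + 1) (2 * n) objective_adr sdp_dim_exp
     sdp_dim_exp (Var 1) (Mul (factor_rexp 10) (factor_rexp 11))"

lemma runs_objective:
  assumes s: "problem_state n P xh s" "blank_above (n + 1) s" and xh: "xh \<in> carrier_vec (2 * n)"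
  shows "runs R objective_prog s (objective_time n)
    (\<lambda>s'. frame {10,11,12} {n + 2} s s' \<and>
      get_mat s' (n + 2) (2 * n + 1) (2 * n + 1) = G_mat n xh)"
proof -
  have r: "reg s 0 = n" "reg s 1 = 2 * n" using s by (simp_all add: problem_state_def)
  have "runs R objective_prog s (objective_time n)
    (\<lambda>s'. same_regs {10,11,12} s s' \<and> mem s' = set_block (n + 2) (2 * n + 1) (2 * n + 1)
      (\<lambda>i j. mem s (n + 2) i j + (\<Sum>t<2 * n. obs_factor n xh t i * obs_factor n xh t j)) s)"
    unfolding objective_prog_def objective_time_def
  proof (rule runs_accumulate)
    fix s' assume "same_regs {10,11,12} s s'"
    then show "aval objective_adr s' = n + 2 \<and> aval sdp_dim_exp s' = 2 * n + 1 \<and>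
        aval sdp_dim_exp s' = 2 * n + 1 \<and> aval (Var 1) s' = 2 * n"
      using r by (simp add: same_regs_def)
  next
    fix s' t i j
    assume "t < 2 * n" "i < 2 * n + 1" "j < 2 * n + 1" "same_regs {10,11,12} s s'"
      and "reg s' 10 = i" "reg s' 11 = j" "reg s' 12 = t" "\<And>a. a \<noteq> n + 2 \<Longrightarrow> mem s' a = mem s a"
    then show "rval (Mul (factor_rexp 10) (factor_rexp 11)) s' =
        obs_factor n xh t i * obs_factor n xh t j"
      using s(1) r by (simp add: same_regs_def problem_state_def obs_factor_def)
  qed
  then show ?thesis
    by (rule runs_mono) (use s(2) in \<open>auto simp: frame_def set_block_def get_mat_def G_mat_gram[OF xh]
      gram_mat_def blank_above_def\<close>)
qed

text \<open>
  The register \<open>w\<close> holds the number of the camera. For camera \<open>i\<close>, the only nonzero entry of row \<open>a\<close>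
  is in column \<open>2i + a\<close>, or in column \<open>2n\<close> for \<open>a = 2\<close>, so the row is a row of the identity matrix.
\<close>

definition select_rexp :: "nat \<Rightarrow> nat \<Rightarrow> nat \<Rightarrow> rexp" where
  "select_rexp w a v = Cell unit_adr
     (if a < 2 then Plus (Plus (Var w) (Var w)) (Num a) else Var 1) (Var v)"

lemma rval_select_rexp:
  assumes "problem_state n P xh s" "reg s w = i" "i < n" "a < 3" "reg s v = c" "c < 2 * n + 1"
  shows "rval (select_rexp w a v) s = select_mat n i $$ (a,c)"
  using assms by (auto simp: select_rexp_def problem_state_def select_mat_def)

text \<open>
  The cameras \<open>i\<close> and \<open>j\<close> of the pair are in registers \<open>12\<close> and \<open>13\<close>; the loop over \<open>i < j\<close>
  inside the one over \<open>j\<close> visits the pairs in the order of \<^const>\<open>pairs\<close>.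
\<close>

definition fundamental_rexp :: "nat \<Rightarrow> nat \<Rightarrow> rexp" where
  "fundamental_rexp a b = det_rexp 6 (\<lambda>r c.
     if r < 3 then (if c < 4 then Cell (Var 12) (Num r) (Num c)
       else Const (if c = 4 \<and> r = a then 1 else 0))
     else (if c < 4 then Cell (Var 13) (Num (r - 3)) (Num c)
       else Const (if c = 5 \<and> r - 3 = b then 1 else 0)))"

lemma rval_fundamental_rexp:
  assumes "problem_state n P xh s" "reg s 12 = i" "i < n" "reg s 13 = j" "j < n" "a < 3" "b < 3"
  shows "rval (fundamental_rexp a b) s = fundamental_mat (P i) (P j) $$ (a,b)"
proof -
  have "rval (fundamental_rexp a b) s = det (epipolar_mat (P i) (P j) (unit_vec 3 a) (unit_vec 3 b))"
    unfolding fundamental_rexp_def rval_det_rexp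
    by (rule arg_cong[where f = det], rule eq_matI)
      (use assms in \<open>auto simp: epipolar_mat_def problem_state_def unit_vec_def\<close>)
  then show ?thesis using assms by (simp add: fundamental_mat_def)
qed

text \<open>
  The entry of \<open>S\<^sub>i\<^sup>T \<Phi>\<^sub>i\<^sub>j S\<^sub>j\<close> with row in register \<open>v\<close> and column in register \<open>w\<close>, where \<open>S\<^sub>i\<close> and
  \<open>S\<^sub>j\<close> are the selection matrices; exchanging \<open>v\<close> and \<open>w\<close> transposes it.
\<close>

definition bilinear_rexp :: "nat \<Rightarrow> nat \<Rightarrow> rexp" where
  "bilinear_rexp v w = sum_rexp (map (\<lambda>a. sum_rexp (map (\<lambda>b.
     Mul (Mul (select_rexp 12 a v) (fundamental_rexp a b)) (select_rexp 13 b w)) [0..<3])) [0..<3])"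

lemma F_mat_index:
  assumes "r < 2 * n + 1" "c < 2 * n + 1"
  shows "F_mat n P i j $$ (r,c) = 1 / 2 *
    ((\<Sum>a<3. \<Sum>b<3. select_mat n i $$ (a,r) * fundamental_mat (P i) (P j) $$ (a,b) *
        select_mat n j $$ (b,c)) +
     (\<Sum>a<3. \<Sum>b<3. select_mat n i $$ (a,c) * fundamental_mat (P i) (P j) $$ (a,b) *
        select_mat n j $$ (b,r)))"
proof -
  have S: "select_mat n i \<in> carrier_mat 3 (2 * n + 1)" for i by (simp add: select_mat_def)
  have M: "fundamental_mat (P i) (P j) \<in> carrier_mat 3 3" by (simp add: fundamental_mat_def)
  let ?B = "transpose_mat (select_mat n i) * fundamental_mat (P i) (P j) * select_mat n j"
  have B: "?B $$ (r,c) = (\<Sum>a<3. \<Sum>b<3. select_mat n i $$ (a,r) *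
      fundamental_mat (P i) (P j) $$ (a,b) * select_mat n j $$ (b,c))"
    if "r < 2 * n + 1" "c < 2 * n + 1" for r c
    using S[of i] S[of j] M that
    by (simp add: scalar_prod_def atLeast0LessThan sum_distrib_left mult.assoc
        del: sum.lessThan_Suc)
  have "F_mat n P i j $$ (r,c) = 1 / 2 * (?B $$ (r,c) + ?B $$ (c,r))"
    using S[of i] S[of j] M assms unfolding F_mat_def Let_def
    by (subst index_smult_mat) (simp_all del: index_mult_mat(1))
  then show ?thesis using B assms by simp
qed

definition epipolar_rexp :: rexp where
  "epipolar_rexp = Mul (Div (Const 1) (Const 2)) (Add (bilinear_rexp 10 11) (bilinear_rexp 11 10))"

lemma rval_epipolar_rexp:
  assumes s: "problem_state n P xh s" and ij: "reg s 12 = i" "i < n" "reg s 13 = j" "j < n"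
    and rc: "reg s 10 = r" "r < 2 * n + 1" "reg s 11 = c" "c < 2 * n + 1"
  shows "rval epipolar_rexp s = F_mat n P i j $$ (r,c)"
proof -
  have "rval (bilinear_rexp v w) s = (\<Sum>a<3. \<Sum>b<3. select_mat n i $$ (a,r) *
      fundamental_mat (P i) (P j) $$ (a,b) * select_mat n j $$ (b,c))"
    if "reg s v = r" "r < 2 * n + 1" "reg s w = c" "c < 2 * n + 1" for v w r c
    unfolding bilinear_rexp_def rval_sum_rexp
    using rval_select_rexp[OF s ij(1,2) _ that(1,2)] rval_select_rexp[OF s ij(3,4) _ that(3,4)]
      rval_fundamental_rexp[OF s ij]
    by (simp add: rval_sum_rexp interv_sum_list_conv_sum_set_nat atLeast0LessThan comp_def
        del: upt_rec_numeral sum.lessThan_Suc)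
  then show ?thesis using rc by (simp add: epipolar_rexp_def F_mat_index)
qed

definition constraints_prog :: com where
  "constraints_prog = For 13 (Var 0) (For 12 (Var 13)
     (Seq (fill constraint_adr sdp_dim_exp sdp_dim_exp epipolar_rexp)
       (Assign 3 (Plus (Var 3) (Num 1)))))"

definition constraints_time :: "nat \<Rightarrow> nat" where
  "constraints_time n = for_time n (Var 0) (for_time n (Var 13)
     (5 + fill_time (2 * n + 1) (2 * n + 1) constraint_adr sdp_dim_exp sdp_dim_exp epipolar_rexp))"

lemma pairs_Suc: "pairs (Suc j) = pairs j @ map (\<lambda>i. (i, j)) [0..<j]"
  by (simp add: pairs_def)

lemma pairs_prefix: "j \<le> n \<Longrightarrow> \<exists>ys. pairs n = pairs j @ ys"
  by (induction n) (auto simp: pairs_Suc le_Suc_eq)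

text \<open>
  The index that the two nested loops have reached at \<open>(i, j)\<close>.
\<close>

lemma nth_pairs:
  assumes "i < j" "j < n"
  shows "pairs n ! (length (pairs j) + i) = (i, j)"
proof -
  obtain ys where "pairs n = pairs (Suc j) @ ys" using pairs_prefix[of "Suc j" n] assms by auto
  then show ?thesis using assms by (simp add: pairs_Suc nth_append)
qed

text \<open>
  Register \<open>3\<close> counts the pairs over both loops, so that one invariant in terms of that count
  serves the inner and the outer loop.
\<close>

lemma runs_constraints:
  assumes s: "problem_state n P xh s" "blank_above (n + 2) s" "reg s 3 = 0"
  shows "runs R constraints_prog s (constraints_time n)
    (\<lambda>s'. frame {3,10,11,12,13} {n + 3..<n + 3 + length (pairs n)} s s' \<and>
      reg s' 3 = length (pairs n) \<and>
      (\<forall>k<length (pairs n). get_mat s' (n + 3 + k) (2 * n + 1) (2 * n + 1) =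
        (case pairs n ! k of (i, j) \<Rightarrow> F_mat n P i j)))"
proof -
  let ?V = "{3,10,11,12,13} :: nat set" and ?N = "2 * n + 1"
  define I where "I k s' \<longleftrightarrow> frame ?V {n + 3..<n + 3 + k} s s' \<and> reg s' 3 = k \<and>
    (\<forall>l<k. get_mat s' (n + 3 + l) ?N ?N = (case pairs n ! l of (i, j) \<Rightarrow> F_mat n P i j))" for k s'
  have r: "reg s' 0 = n" "reg s' 1 = 2 * n" "problem_state n P xh s'" if "I k s'" for k s'
    using that problem_state_frame[OF s(1), of ?V "{n + 3..<n + 3 + k}" s']
    by (auto simp: I_def problem_state_def)
  let ?b = "fill_time ?N ?N constraint_adr sdp_dim_exp sdp_dim_exp epipolar_rexp"
  have "runs R constraints_prog s (constraints_time n) (I (length (pairs n)))"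
    unfolding constraints_prog_def constraints_time_def
  proof (rule runs_For[where I = "\<lambda>j. I (length (pairs j))"])
    show "I (length (pairs 0)) (s\<lparr>reg := (reg s)(13 := 0)\<rparr>)"
      using s(3) by (simp add: I_def pairs_def frame_def same_regs_def)
    show "aval (Var 0) s' = n" if "I (length (pairs j)) s'" for j s' using r[OF that] by simp
  next
    fix j s1 assume j: "j < n" "I (length (pairs j)) s1" "reg s1 13 = j"
    have "runs R (For 12 (Var 13) (Seq (fill constraint_adr sdp_dim_exp sdp_dim_exp epipolar_rexp)
        (Assign 3 (Plus (Var 3) (Num 1))))) s1 (for_time j (Var 13) (5 + ?b))
      (\<lambda>s'. I (length (pairs j) + j) s' \<and> reg s' 13 = j)"
    proof (rule runs_For[where I = "\<lambda>i s'. I (length (pairs j) + i) s' \<and> reg s' 13 = j"])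
      show "I (length (pairs j) + 0) (s1\<lparr>reg := (reg s1)(12 := 0)\<rparr>) \<and>
          reg (s1\<lparr>reg := (reg s1)(12 := 0)\<rparr>) 13 = j"
        using j by (simp add: I_def frame_def same_regs_def get_mat_def)
    next
      fix i s2
      let ?k = "length (pairs j) + i"
      assume i: "i < j" "I ?k s2 \<and> reg s2 13 = j" "reg s2 12 = i"
      note r2 = r[OF conjunct1[OF i(2)]]
      have "runs R (fill constraint_adr sdp_dim_exp sdp_dim_exp epipolar_rexp) s2 ?b
        (\<lambda>s'. same_regs {10,11} s2 s' \<and>
          mem s' = set_block (n + 3 + ?k) ?N ?N (\<lambda>r c. F_mat n P i j $$ (r,c)) s2)"
      proof (rule runs_fill)
        fix s' assume "same_regs {10,11} s2 s'"
        then show "aval constraint_adr s' = n + 3 + ?k \<and> aval sdp_dim_exp s' = ?N \<and> aval sdp_dim_exp s' = ?N"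
          using r2 i by (simp add: same_regs_def I_def)
      next
        fix s' r c
        assume rc: "r < ?N" "c < ?N" "same_regs {10,11} s2 s'" "reg s' 10 = r" "reg s' 11 = c"
          and m: "\<And>a. a \<noteq> n + 3 + ?k \<Longrightarrow> mem s' a = mem s2 a"
        have "frame {10,11} {n + 3 + ?k} s2 s'" using rc m by (simp add: frame_def)
        then have "problem_state n P xh s'" by (rule problem_state_frame[OF r2(3)]) auto
        then show "rval epipolar_rexp s' = F_mat n P i j $$ (r,c)"
          by (rule rval_epipolar_rexp) (use rc i j(1) in \<open>auto simp: same_regs_def\<close>)
      qed
      then have "runs R (Seq (fill constraint_adr sdp_dim_exp sdp_dim_exp epipolar_rexp)
          (Assign 3 (Plus (Var 3) (Num 1)))) s2 (1 + ?b + (1 + acost (Plus (Var 3) (Num 1))))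
        (\<lambda>s'. reg s' 12 = i \<and> I (Suc ?k) s' \<and> reg s' 13 = j)"
      proof (rule runs_Seq[OF _ runs_Assign])
        fix s3
        assume s3: "same_regs {10,11} s2 s3 \<and>
          mem s3 = set_block (n + 3 + ?k) ?N ?N (\<lambda>r c. F_mat n P i j $$ (r,c)) s2"
        let ?s4 = "s3\<lparr>reg := (reg s3)(3 := aval (Plus (Var 3) (Num 1)) s3)\<rparr>"
        have F: "F_mat n P i j \<in> carrier_mat ?N ?N"
          using F_mat_sym[of n P i j] by (simp add: sym_mat_def)
        have "get_mat ?s4 (n + 3 + ?k) ?N ?N = F_mat n P i j"
          using s3 F by (intro eq_matI) (auto simp: get_mat_def set_block_def)
        moreover have "get_mat ?s4 (n + 3 + l) ?N ?N = get_mat s2 (n + 3 + l) ?N ?N" if "l < ?k" for l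
          using that s3 by (simp add: get_mat_def set_block_def)
        moreover have "pairs n ! ?k = (i, j)" using nth_pairs i j by simp
        ultimately show "reg ?s4 12 = i \<and> I (Suc ?k) ?s4 \<and> reg ?s4 13 = j"
          using i s3 by (auto simp: I_def frame_def same_regs_def less_Suc_eq set_block_def)
      qed
      then show "runs R (Seq (fill constraint_adr sdp_dim_exp sdp_dim_exp epipolar_rexp)
          (Assign 3 (Plus (Var 3) (Num 1)))) s2 (5 + ?b)
        (\<lambda>s'. reg s' 12 = i \<and>
          I (length (pairs j) + Suc i) (s'\<lparr>reg := (reg s')(12 := Suc i)\<rparr>) \<and>
          reg (s'\<lparr>reg := (reg s')(12 := Suc i)\<rparr>) 13 = j)"
        by (rule runs_mono) (auto simp: I_def frame_def same_regs_def get_mat_def)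
    qed simp
    then show "runs R (For 12 (Var 13) (Seq (fill constraint_adr sdp_dim_exp sdp_dim_exp epipolar_rexp)
        (Assign 3 (Plus (Var 3) (Num 1))))) s1 (for_time n (Var 13) (5 + ?b))
      (\<lambda>s'. reg s' 13 = j \<and> I (length (pairs (Suc j))) (s'\<lparr>reg := (reg s')(13 := Suc j)\<rparr>))"
      by (rule runs_mono)
        (use j in \<open>auto simp: I_def frame_def same_regs_def get_mat_def pairs_Suc for_time_def\<close>)
  qed
  then show ?thesis by (rule runs_mono) (auto simp: I_def)
qed

text \<open>
  The entry of \<open>E\<close> is a product of two entries of the last row of the identity matrix. The
  right-hand sides are placed after the last constraint matrix, and the counter, already
  incremented, gives that address.
\<close>

definition normalization_prog :: com where
  "normalization_prog = Seq (fill constraint_adr sdp_dim_exp sdp_dim_exp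
       (Mul (Cell unit_adr (Var 1) (Var 10)) (Cell unit_adr (Var 1) (Var 11))))
     (Seq (Assign 3 (Plus (Var 3) (Num 1)))
       (Store constraint_adr (Minus (Var 3) (Num 1)) (Num 0) (Const 1)))"

definition normalization_time :: "nat \<Rightarrow> nat" where
  "normalization_time n = 20 + fill_time (2 * n + 1) (2 * n + 1) constraint_adr sdp_dim_exp sdp_dim_exp
       (Mul (Cell unit_adr (Var 1) (Var 10)) (Cell unit_adr (Var 1) (Var 11)))"

text \<open>
  The definition of \<open>q\<close> leaves room for the objective, the \<open>length (pairs n) + 1\<close> constraint matrices
  and the right-hand sides, all below \<open>q\<close>.
\<close>

definition sdp_state :: "nat \<Rightarrow> (nat \<Rightarrow> real mat) \<Rightarrow> real vec \<Rightarrow> nat \<Rightarrow> state \<Rightarrow> bool" where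
  "sdp_state n P xh q s \<longleftrightarrow> problem_state n P xh s \<and> reg s 3 = length (pairs n) + 1 \<and>
     q = n + 5 + length (pairs n) \<and>
     get_sdp s (2 * n + 1) (length (pairs n) + 1) (n + 2) = triangulation_sdp n P xh"

lemma runs_normalization:
  assumes s: "problem_state n P xh s" "reg s 3 = length (pairs n)"
    and blank: "blank_above (n + 2 + length (pairs n)) s"
    and obj: "get_mat s (n + 2) (2 * n + 1) (2 * n + 1) = G_mat n xh"
    and con: "\<And>k. k < length (pairs n) \<Longrightarrow> get_mat s (n + 3 + k) (2 * n + 1) (2 * n + 1) =
        (case pairs n ! k of (i, j) \<Rightarrow> F_mat n P i j)"
  shows "runs R normalization_prog s (normalization_time n)
    (\<lambda>s'. sdp_state n P xh (n + 5 + length (pairs n)) s' \<and> blank_above (n + 4 + length (pairs n)) s')"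
proof -
  let ?N = "2 * n + 1" and ?m = "length (pairs n)"
  let ?e = "Mul (Cell unit_adr (Var 1) (Var 10)) (Cell unit_adr (Var 1) (Var 11))"
  have r: "reg s 0 = n" "reg s 1 = 2 * n" using s by (simp_all add: problem_state_def)
  define Q where "Q s' \<longleftrightarrow> same_regs {10,11} s s' \<and>
    mem s' = set_block (n + 3 + ?m) ?N ?N (\<lambda>r c. E_mat n $$ (r,c)) s" for s'
  have 1: "runs R (fill constraint_adr sdp_dim_exp sdp_dim_exp ?e) s
      (fill_time ?N ?N constraint_adr sdp_dim_exp sdp_dim_exp ?e) Q"
    unfolding Q_def
  proof (rule runs_fill)
    fix s' assume "same_regs {10,11} s s'"
    then show "aval constraint_adr s' = n + 3 + ?m \<and> aval sdp_dim_exp s' = ?N \<and> aval sdp_dim_exp s' = ?N"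
      using r s by (simp add: same_regs_def)
  next
    fix s' i j
    assume "i < ?N" "j < ?N" "same_regs {10,11} s s'" "reg s' 10 = i" "reg s' 11 = j"
      "\<And>a. a \<noteq> n + 3 + ?m \<Longrightarrow> mem s' a = mem s a"
    then show "rval ?e s' = E_mat n $$ (i,j)"
      using r s(1) by (simp add: same_regs_def E_mat_def problem_state_def)
  qed
  define s2 where "s2 s1 = s1\<lparr>reg := (reg s1)(3 := ?m + 1)\<rparr>" for s1 :: state
  define s3 where "s3 s1 = (s2 s1)\<lparr>mem := (mem s1)(n + 4 + ?m := (mem s1 (n + 4 + ?m))(?m :=
    (mem s1 (n + 4 + ?m) ?m)(0 := 1)))\<rparr>" for s1 :: state
  have "runs R normalization_prog s (1 + fill_time ?N ?N constraint_adr sdp_dim_exp sdp_dim_exp ?e +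
      (1 + (1 + acost (Plus (Var 3) (Num 1))) + (1 + acost constraint_adr +
        acost (Minus (Var 3) (Num 1)) + acost (Num 0) + rcost (Const 1))))
      (\<lambda>s'. \<exists>s1. Q s1 \<and> s' = s3 s1)"
    unfolding normalization_prog_def
  proof (rule runs_Seq[OF 1 runs_Seq[OF runs_Assign runs_Store]])
    fix s1 assume "Q s1"
    then show "s1\<lparr>reg := (reg s1)(3 := aval (Plus (Var 3) (Num 1)) s1)\<rparr> = s2 s1"
      using s(2) by (simp add: s2_def Q_def same_regs_def)
  next
    fix s1 s' assume "Q s1" "s' = s2 s1"
    then have *: "aval constraint_adr s' = n + 4 + ?m" "aval (Minus (Var 3) (Num 1)) s' = ?m"
      using r by (simp_all add: s2_def Q_def same_regs_def)
    show "\<exists>s1. Q s1 \<and> s'\<lparr>mem := (mem s')(aval constraint_adr s' := (mem s' (aval constraint_adr s'))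
        (aval (Minus (Var 3) (Num 1)) s' := (mem s' (aval constraint_adr s') (aval (Minus (Var 3) (Num 1)) s'))
          (aval (Num 0) s' := rval (Const 1) s')))\<rparr> = s3 s1"
      unfolding * by (rule exI[of _ s1]) (use \<open>Q s1\<close> \<open>s' = s2 s1\<close> in \<open>simp add: s3_def, simp add: s2_def\<close>)
  qed
  then show ?thesis
  proof (rule runs_mono)
    fix s' assume "\<exists>s1. Q s1 \<and> s' = s3 s1"
    then obtain s1 where s1: "Q s1" "s' = s3 s1" by blast
    have fr: "frame {3,10,11} {n + 3 + ?m, n + 4 + ?m} s s'"
      using s1 by (auto simp: frame_def same_regs_def s3_def s2_def Q_def set_block_def)
    have ps: "problem_state n P xh s'" by (rule problem_state_frame[OF s(1) fr]) auto
    have same: "get_mat s' a ?N ?N = get_mat s a ?N ?N" if "a < n + 3 + ?m" for a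
      using that frame_mem[OF fr] by (simp add: get_mat_def)
    have E: "get_mat s' (n + 3 + ?m) ?N ?N = E_mat n"
      using s1 by (intro eq_matI) (auto simp: get_mat_def s3_def s2_def Q_def set_block_def E_mat_def)
    have b: "mem s' (n + 4 + ?m) k 0 = (if k = ?m then 1 else 0)" for k
      using s1 blank by (simp add: s3_def Q_def set_block_def blank_above_def)
    have "map (\<lambda>k. (get_mat s' (n + 3 + k) ?N ?N, mem s' (n + 4 + ?m) k 0)) [0..<?m + 1] =
        map (\<lambda>(i, j). (F_mat n P i j, 0)) (pairs n) @ [(E_mat n, 1)]" (is "?l = ?r")
    proof (rule nth_equalityI)
      fix k assume "k < length ?l"
      then have "k < ?m \<or> k = ?m" by auto
      then show "?l ! k = ?r ! k"
      proof
        assume k: "k < ?m"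
        then show ?thesis
          using same[of "n + 3 + k"] con[OF k] b[of k]
          by (simp add: nth_append del: upt_Suc split: prod.splits)
      next
        assume k: "k = ?m"
        then show ?thesis
          using E b[of k] by (simp add: nth_append del: upt_Suc)
      qed
    qed simp
    moreover have "n + 2 + 1 + k = n + 3 + k" "n + 2 + (?m + 1) + 1 = n + 4 + ?m" for k by simp_all
    ultimately have "get_sdp s' ?N (?m + 1) (n + 2) = triangulation_sdp n P xh"
      using same[of "n + 2"] obj unfolding get_sdp_def triangulation_sdp_def
      by (simp only:)
    moreover have "reg s' 3 = ?m + 1" using s1 by (simp add: s3_def s2_def)
    moreover have "blank_above (n + 4 + ?m) s'"
      by (rule blank_above_frame[OF blank fr]) auto
    ultimately show "sdp_state n P xh (n + 5 + ?m) s' \<and> blank_above (n + 4 + ?m) s'"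
      using ps by (simp add: sdp_state_def)
  qed (simp add: normalization_time_def)
qed

section \<open>Solving and testing definiteness\<close>

lemma distinct_pairs: "distinct (pairs n)"
  by (induction n) (auto simp: pairs_Suc set_pairs distinct_map inj_on_def, simp add: pairs_def)

text \<open>
  The solver returns a plain vector, whereas \<^const>\<open>triangulation\<close> speaks of multipliers indexed by
  pairs; the pair \<open>(i, j)\<close> occurs at position \<open>length (pairs j) + i\<close>.
\<close>

lemma multipliers_surj:
  assumes "y \<in> carrier_vec (length (pairs n) + 1)"
  shows "\<exists>l \<rho>. y = multipliers n l \<rho>"
proof -
  define l where "l i j = - y $ (length (pairs j) + i)" for i j
  have "y $ k = (- (case pairs n ! k of (i, j) \<Rightarrow> l i j))" if k: "k < length (pairs n)" for k
  proof -
    obtain i j where ij: "pairs n ! k = (i, j)" by fastforce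
    then have lt: "i < j" "j < n" using nth_mem[OF k] by (simp_all add: set_pairs)
    obtain ys where "pairs n = pairs (Suc j) @ ys" using pairs_prefix[of "Suc j" n] lt by auto
    then have "length (pairs j) + i < length (pairs n)" using lt by (simp add: pairs_Suc)
    then have k_eq: "k = length (pairs j) + i"
      using nth_eq_iff_index_eq[OF distinct_pairs k, of "length (pairs j) + i"] nth_pairs[OF lt] ij
      by simp
    show ?thesis unfolding ij by (simp add: l_def k_eq)
  qed
  then have "y = multipliers n l (y $ length (pairs n))"
    using assms by (intro eq_vecI) (auto simp: multipliers_def less_Suc_eq)
  then show ?thesis by blast
qed

lemma sdp_state_frame:
  assumes s: "sdp_state n P xh q s" and fr: "frame V A s s'" and "0 \<notin> V" "1 \<notin> V" "3 \<notin> V"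
    and A: "\<forall>a\<in>A. q \<le> a"
  shows "sdp_state n P xh q s'"
proof -
  have ps: "problem_state n P xh s'"
    by (rule problem_state_frame[OF _ fr assms(3,4)]) (use s A in \<open>auto simp: sdp_state_def\<close>)
  have same: "mem s' a = mem s a" if "a < q" for a
    using A that by (intro frame_mem[OF fr]) auto
  have q: "q = n + 5 + length (pairs n)" using s by (simp add: sdp_state_def)
  have "get_sdp s' (2 * n + 1) (length (pairs n) + 1) (n + 2) =
      get_sdp s (2 * n + 1) (length (pairs n) + 1) (n + 2)"
    unfolding get_sdp_def get_mat_def
    by (intro arg_cong2[where f = SDP] map_cong refl) (auto simp: same q)
  then show ?thesis
    using s ps frame_reg[OF fr assms(5)] by (simp add: sdp_state_def)
qed

lemma sdp_state_mem:
  assumes s: "sdp_state n P xh q s" and ij: "i < 2 * n + 1" "j < 2 * n + 1"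
  shows "mem s (n + 2) i j = G_mat n xh $$ (i,j)"
    and "k < length (pairs n) + 1 \<Longrightarrow>
      mem s (n + 3 + k) i j = fst (constraints (triangulation_sdp n P xh) ! k) $$ (i,j)"
proof -
  have S: "triangulation_sdp n P xh = get_sdp s (2 * n + 1) (length (pairs n) + 1) (n + 2)"
    using s by (simp add: sdp_state_def)
  have "G_mat n xh = objective (triangulation_sdp n P xh)" by (simp add: triangulation_sdp_def)
  then show "mem s (n + 2) i j = G_mat n xh $$ (i,j)"
    using ij unfolding S by (simp add: get_sdp_def get_mat_def)
  show "mem s (n + 3 + k) i j = fst (constraints (triangulation_sdp n P xh) ! k) $$ (i,j)"
    if "k < length (pairs n) + 1"
    using ij that unfolding S
    by (simp add: get_sdp_def get_mat_def eval_nat_numeral del: upt_Suc)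
qed

definition solve_prog :: com where
  "solve_prog = Seq (Assign 2 (Plus (Var 0) (Plus (Num 4) (Var 3))))
     (CallSDP sdp_dim_exp (Var 3) objective_adr (output_adr 0))"

text \<open>
  The argument of the polynomial is the size of the program, and the constant absorbs the cost of
  the addresses.
\<close>

definition solve_time :: "nat poly \<Rightarrow> nat \<Rightarrow> nat" where
  "solve_time p n = 20 + poly p ((2 * n + 1)\<^sup>2 + (length (pairs n) + 1) * ((2 * n + 1)\<^sup>2 + 1))"

lemma runs_solve:
  assumes s: "sdp_state n P xh q s" and cam: "cameras n P" and xh: "xh \<in> carrier_vec (2 * n)"
    and R: "\<And>S. sdp_wf S \<Longrightarrow> \<exists>Y. primal_feasible S Y \<Longrightarrow> \<exists>y. dual_feasible S y \<Longrightarrow>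
      case sdp_solve R S of (Y, y) \<Rightarrow> sdp_solution \<epsilon> S Y y"
    and T: "\<And>S. sdp_wf S \<Longrightarrow> sdp_time R S \<le> poly p (sdp_size S)"
  shows "runs R solve_prog s (solve_time p n)
    (\<lambda>s'. frame {2} {q, q + 1} s s' \<and> reg s' 2 = q \<and>
      (\<exists>Y l \<rho>. sdp_solution \<epsilon> (triangulation_sdp n P xh) Y (multipliers n l \<rho>) \<and>
        (\<forall>i<2 * n + 1. \<forall>j<2 * n + 1. mem s' q i j = Y $$ (i,j)) \<and>
        (\<forall>k<length (pairs n) + 1. mem s' (q + 1) k 0 = multipliers n l \<rho> $ k)))"
proof -
  let ?S = "triangulation_sdp n P xh" and ?M = "length (pairs n) + 1"
  have r: "reg s 0 = n" "reg s 1 = 2 * n" "reg s 3 = ?M" "q = n + 4 + ?M"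
    using s by (simp_all add: sdp_state_def problem_state_def)
  have dim: "sdp_dim ?S = 2 * n + 1" "length (constraints ?S) = ?M"
    by (simp_all add: triangulation_sdp_def sdp_dim_def G_mat_def)
  have wf: "sdp_wf ?S" by (rule triangulation_sdp_wf[OF xh])
  obtain Y y where Yy: "sdp_solve R ?S = (Y, y)" by fastforce
  have sol: "sdp_solution \<epsilon> ?S Y y"
    using R[OF wf triangulation_primal_feasible[OF cam] triangulation_dual_feasible[OF xh]] Yy by simp
  then have Y: "Y \<in> carrier_mat (2 * n + 1) (2 * n + 1)" and y: "y \<in> carrier_vec ?M"
    by (simp_all add: sdp_solution_def sym_mat_def dim)
  obtain l \<rho> where l: "y = multipliers n l \<rho>" using multipliers_surj[OF y] by blast
  define s1 where "s1 = s\<lparr>reg := (reg s)(2 := q)\<rparr>"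
  have get: "get_sdp s1 (aval sdp_dim_exp s1) (aval (Var 3) s1) (aval objective_adr s1) = ?S"
    using s r by (simp add: s1_def get_sdp_def get_mat_def sdp_state_def)
  have call: "exec R (CallSDP sdp_dim_exp (Var 3) objective_adr (output_adr 0)) s1
      (1 + acost sdp_dim_exp + acost (Var 3) + acost objective_adr + acost (output_adr 0) + sdp_time R ?S)
      (put_vec (q + 1) y (put_mat q Y s1))"
    using exec.CallSDP[OF get[symmetric] Yy, of "output_adr 0"] by (simp add: s1_def)
  have "runs R solve_prog s (1 + (1 + acost (Plus (Var 0) (Plus (Num 4) (Var 3)))) +
      (1 + acost sdp_dim_exp + acost (Var 3) + acost objective_adr + acost (output_adr 0) + sdp_time R ?S))
      (\<lambda>s'. s' = put_vec (q + 1) y (put_mat q Y s1))"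
    unfolding solve_prog_def
  proof (rule runs_Seq[OF runs_Assign[where Q = "\<lambda>s'. s' = s1"]])
    have "aval (Plus (Var 0) (Plus (Num 4) (Var 3))) s = q" using r by simp
    then show "s\<lparr>reg := (reg s)(2 := aval (Plus (Var 0) (Plus (Num 4) (Var 3))) s)\<rparr> = s1"
      by (simp only: s1_def)
  qed (use call in \<open>auto simp: runs_def\<close>)
  then show ?thesis
  proof (rule runs_mono)
    show "1 + (1 + acost (Plus (Var 0) (Plus (Num 4) (Var 3)))) +
      (1 + acost sdp_dim_exp + acost (Var 3) + acost objective_adr + acost (output_adr 0) + sdp_time R ?S)
      \<le> solve_time p n"
      using T[OF wf] by (simp add: solve_time_def sdp_size_def dim)
  next
    fix s' assume "s' = put_vec (q + 1) y (put_mat q Y s1)"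
    moreover from this have "(\<forall>i<2 * n + 1. \<forall>j<2 * n + 1. mem s' q i j = Y $$ (i,j))"
      "\<forall>k<?M. mem s' (q + 1) k 0 = multipliers n l \<rho> $ k"
      using Y y by (simp_all add: put_vec_def put_mat_def l[symmetric])
    ultimately show "frame {2} {q, q + 1} s s' \<and> reg s' 2 = q \<and>
      (\<exists>Y l \<rho>. sdp_solution \<epsilon> ?S Y (multipliers n l \<rho>) \<and>
        (\<forall>i<2 * n + 1. \<forall>j<2 * n + 1. mem s' q i j = Y $$ (i,j)) \<and>
        (\<forall>k<?M. mem s' (q + 1) k 0 = multipliers n l \<rho> $ k))"
      using sol l by (auto simp: frame_def same_regs_def put_vec_def put_mat_def s1_def)
  qed
qed

text \<open>
  The Hessian is the top left block of the dual slack, since \<open>E\<close> vanishes there. It can therefore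
  be summed over the constraints as they lie in memory, without a loop over pairs.
\<close>

lemma hessian_mat_eq_dual_slack:
  assumes "r < 2 * n" "c < 2 * n"
  shows "hessian_mat n P l $$ (r,c) = G_mat n xh $$ (r,c) + (\<Sum>k<length (pairs n) + 1.
    - 1 * (multipliers n l \<rho> $ k * fst (constraints (triangulation_sdp n P xh) ! k) $$ (r,c)))"
proof -
  let ?S = "triangulation_sdp n P xh"
  have dim: "sdp_dim ?S = 2 * n + 1" "length (constraints ?S) = length (pairs n) + 1"
    "objective ?S = G_mat n xh"
    by (simp_all add: triangulation_sdp_def sdp_dim_def G_mat_def)
  have "G_mat n xh $$ (r,c) + (\<Sum>k<length (pairs n) + 1.
      - 1 * (multipliers n l \<rho> $ k * fst (constraints ?S ! k) $$ (r,c))) =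
      dual_slack ?S (multipliers n l \<rho>) $$ (r,c)"
    using assms by (simp add: dual_slack_def dim sum_negf del: sum.lessThan_Suc)
  also have "\<dots> = hessian_mat n P l $$ (r,c)"
    using assms by (simp add: triangulation_dual hessian_mat_def H_mat_def G_mat_def E_mat_def)
  finally show ?thesis ..
qed

lemma hessian_mat_sym: "sym_mat (2 * n) (hessian_mat n P l)"
proof -
  have "F_mat n P i j $$ (r,c) = F_mat n P i j $$ (c,r)" if "r < 2 * n" "c < 2 * n" for i j r c
  proof -
    have F: "F_mat n P i j \<in> carrier_mat (2 * n + 1) (2 * n + 1)"
      and sym: "transpose_mat (F_mat n P i j) = F_mat n P i j"
      using F_mat_sym[of n P i j] by (simp_all add: sym_mat_def)
    have "transpose_mat (F_mat n P i j) $$ (c,r) = F_mat n P i j $$ (r,c)"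
      using F that by (intro index_transpose_mat(1)) auto
    then show ?thesis by (simp add: sym)
  qed
  then show ?thesis
    unfolding sym_mat_def hessian_mat_def H_mat_def by (auto intro!: eq_matI)
qed

definition hessian_prog :: com where
  "hessian_prog = Seq
     (fill (output_adr 2) (Var 1) (Var 1) (Cell objective_adr (Var 10) (Var 11)))
     (accumulate (output_adr 2) (Var 1) (Var 1) (Var 3)
       (Mul (Const (- 1)) (Mul (Cell (output_adr 1) (Var 12) (Num 0))
         (Cell (Plus (Plus (Var 0) (Num 3)) (Var 12)) (Var 10) (Var 11)))))"

definition hessian_time :: "nat \<Rightarrow> nat" where
  "hessian_time n = 1 +
     fill_time (2 * n) (2 * n) (output_adr 2) (Var 1) (Var 1) (Cell objective_adr (Var 10) (Var 11)) +
     accumulate_time (2 * n) (2 * n) (length (pairs n) + 1) (output_adr 2) (Var 1) (Var 1) (Var 3)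
       (Mul (Const (- 1)) (Mul (Cell (output_adr 1) (Var 12) (Num 0))
         (Cell (Plus (Plus (Var 0) (Num 3)) (Var 12)) (Var 10) (Var 11))))"

lemma runs_hessian:
  assumes s: "sdp_state n P xh q s" "reg s 2 = q"
    and y: "\<forall>k<length (pairs n) + 1. mem s (q + 1) k 0 = multipliers n l \<rho> $ k"
  shows "runs R hessian_prog s (hessian_time n)
    (\<lambda>s'. frame {10,11,12} {q + 2} s s' \<and>
      get_mat s' (q + 2) (2 * n) (2 * n) = hessian_mat n P l)"
proof -
  let ?M = "length (pairs n) + 1"
  have r: "reg s 0 = n" "reg s 1 = 2 * n" "reg s 3 = ?M" "q = n + 4 + ?M"
    using s by (simp_all add: sdp_state_def problem_state_def)
  let ?e = "Mul (Const (- 1)) (Mul (Cell (output_adr 1) (Var 12) (Num 0))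
         (Cell (Plus (Plus (Var 0) (Num 3)) (Var 12)) (Var 10) (Var 11)))"
  let ?f = "\<lambda>k i j. - 1 * (multipliers n l \<rho> $ k * fst (constraints (triangulation_sdp n P xh) ! k) $$ (i,j))"
  have 1: "runs R (fill (output_adr 2) (Var 1) (Var 1) (Cell objective_adr (Var 10) (Var 11))) s
      (fill_time (2 * n) (2 * n) (output_adr 2) (Var 1) (Var 1) (Cell objective_adr (Var 10) (Var 11)))
      (\<lambda>s'. same_regs {10,11} s s' \<and>
        mem s' = set_block (q + 2) (2 * n) (2 * n) (\<lambda>i j. G_mat n xh $$ (i,j)) s)"
    by (rule runs_fill) (use s r sdp_state_mem(1)[OF s(1)] in \<open>auto simp: same_regs_def\<close>)
  show ?thesis
    unfolding hessian_prog_def hessian_time_def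
  proof (rule runs_Seq[OF 1])
    fix s1
    assume s1: "same_regs {10,11} s s1 \<and>
      mem s1 = set_block (q + 2) (2 * n) (2 * n) (\<lambda>i j. G_mat n xh $$ (i,j)) s"
    have fr: "frame {10,11} {q + 2} s s1" using s1 by (simp add: frame_def set_block_def)
    have st: "sdp_state n P xh q s1" by (rule sdp_state_frame[OF s(1) fr]) auto
    have r1: "reg s1 0 = n" "reg s1 1 = 2 * n" "reg s1 3 = ?M" "reg s1 2 = q"
      using r s(2) s1 by (simp_all add: same_regs_def)
    have "runs R (accumulate (output_adr 2) (Var 1) (Var 1) (Var 3) ?e) s1
        (accumulate_time (2 * n) (2 * n) ?M (output_adr 2) (Var 1) (Var 1) (Var 3) ?e)
        (\<lambda>s'. same_regs {10,11,12} s1 s' \<and> mem s' = set_block (q + 2) (2 * n) (2 * n)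
          (\<lambda>i j. mem s1 (q + 2) i j + (\<Sum>k<?M. ?f k i j)) s1)"
    proof (rule runs_accumulate)
      fix s' assume "same_regs {10,11,12} s1 s'"
      then show "aval (output_adr 2) s' = q + 2 \<and> aval (Var 1) s' = 2 * n \<and> aval (Var 1) s' = 2 * n \<and>
          aval (Var 3) s' = ?M" using r1 by (simp add: same_regs_def)
    next
      fix s' k i j
      assume *: "k < ?M" "i < 2 * n" "j < 2 * n" "same_regs {10,11,12} s1 s'" "reg s' 10 = i"
        "reg s' 11 = j" "reg s' 12 = k" "\<And>a. a \<noteq> q + 2 \<Longrightarrow> mem s' a = mem s1 a"
      have "mem s1 (q + 1) = mem s (q + 1)" using frame_mem[OF fr] by simp
      then show "rval ?e s' = ?f k i j"
        using * y r1 sdp_state_mem(2)[OF st, of i j k] r(4) by (simp add: same_regs_def)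
    qed
    then show "runs R (accumulate (output_adr 2) (Var 1) (Var 1) (Var 3) ?e) s1
        (accumulate_time (2 * n) (2 * n) ?M (output_adr 2) (Var 1) (Var 1) (Var 3) ?e)
        (\<lambda>s'. frame {10,11,12} {q + 2} s s' \<and> get_mat s' (q + 2) (2 * n) (2 * n) = hessian_mat n P l)"
    proof (rule runs_mono)
      fix s' assume s': "same_regs {10,11,12} s1 s' \<and> mem s' = set_block (q + 2) (2 * n) (2 * n)
          (\<lambda>i j. mem s1 (q + 2) i j + (\<Sum>k<?M. ?f k i j)) s1"
      have "frame {10,11,12} {q + 2} s s'"
        using s1 s' by (auto simp: frame_def same_regs_def set_block_def)
      moreover have "get_mat s' (q + 2) (2 * n) (2 * n) = hessian_mat n P l"
      proof (rule eq_matI)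
        fix i j assume "i < dim_row (hessian_mat n P l)" "j < dim_col (hessian_mat n P l)"
        then have ij: "i < 2 * n" "j < 2 * n" by (simp_all add: hessian_mat_def)
        have "get_mat s' (q + 2) (2 * n) (2 * n) $$ (i,j) = G_mat n xh $$ (i,j) + (\<Sum>k<?M. ?f k i j)"
          using s' s1 ij by (simp add: get_mat_def set_block_def del: sum.lessThan_Suc)
        then show "get_mat s' (q + 2) (2 * n) (2 * n) $$ (i,j) = hessian_mat n P l $$ (i,j)"
          using hessian_mat_eq_dual_slack[OF ij, of P l xh \<rho>] by simp
      qed (simp_all add: get_mat_def hessian_mat_def)
      ultimately show "frame {10,11,12} {q + 2} s s' \<and>
        get_mat s' (q + 2) (2 * n) (2 * n) = hessian_mat n P l" ..
    qed simp
  qed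
qed

definition definiteness_prog :: com where
  "definiteness_prog = Seq (CallEig (Var 1) (output_adr 2) (output_adr 3))
     (check_all 5 (Var 1) (RLess (Const 0) (Cell (output_adr 4) (Var 12) (Num 0))))"

definition definiteness_time :: "nat poly \<Rightarrow> nat \<Rightarrow> nat" where
  "definiteness_time p n = 20 + poly p (2 * n * (2 * n)) +
     check_all_time (2 * n) (Var 1) (RLess (Const 0) (Cell (output_adr 4) (Var 12) (Num 0)))"

lemma runs_definiteness:
  assumes r: "reg s 1 = 2 * n" "reg s 2 = q"
    and A: "get_mat s (q + 2) (2 * n) (2 * n) = A" "sym_mat (2 * n) A"
    and R: "\<And>k A. sym_mat k A \<Longrightarrow> case eig R A of (Q, d) \<Rightarrow> eigendecomposition k A Q d"
    and T: "\<And>k A. sym_mat k A \<Longrightarrow> eig_time R A \<le> poly p (k * k)"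
  shows "runs R definiteness_prog s (definiteness_time p n)
    (\<lambda>s'. frame {5,12} {q + 3, q + 4} s s' \<and> reg s' 5 = (if pd_mat (2 * n) A then 1 else 0))"
proof -
  obtain Q d where Qd: "eig R A = (Q, d)" by fastforce
  have eig: "eigendecomposition (2 * n) A Q d" using R[OF A(2)] Qd by simp
  then have d: "d \<in> carrier_vec (2 * n)" by (simp add: eigendecomposition_def)
  define s1 where "s1 = put_vec (q + 4) d (put_mat (q + 3) Q s)"
  have "exec R (CallEig (Var 1) (output_adr 2) (output_adr 3)) s
      (1 + acost (Var 1) + acost (output_adr 2) + acost (output_adr 3) + eig_time R A) s1"
    using exec.CallEig[of A s "output_adr 2" "Var 1" R Q d "output_adr 3"] r A(1) Qd
    by (simp add: s1_def eval_nat_numeral)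
  then have 1: "runs R (CallEig (Var 1) (output_adr 2) (output_adr 3)) s
      (1 + acost (Var 1) + acost (output_adr 2) + acost (output_adr 3) + eig_time R A) ((=) s1)"
    by (rule runsI) simp_all
  let ?b = "RLess (Const 0) (Cell (output_adr 4) (Var 12) (Num 0))"
  have "runs R definiteness_prog s (1 + (1 + acost (Var 1) + acost (output_adr 2) + acost (output_adr 3) +
      eig_time R A) + check_all_time (2 * n) (Var 1) ?b)
      (\<lambda>s'. same_regs {5,12} s1 s' \<and> mem s' = mem s1 \<and> reg s' 5 = (if \<forall>i<2 * n. d $ i > 0 then 1 else 0))"
    unfolding definiteness_prog_def
  proof (rule runs_Seq[OF 1])
    fix s' assume "s1 = s'"
    then show "runs R (check_all 5 (Var 1) ?b) s' (check_all_time (2 * n) (Var 1) ?b)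
      (\<lambda>s'. same_regs {5,12} s1 s' \<and> mem s' = mem s1 \<and> reg s' 5 = (if \<forall>i<2 * n. d $ i > 0 then 1 else 0))"
      using r d by (intro runs_mono[OF runs_check_all[where \<phi> = "\<lambda>i. d $ i > 0"]])
        (auto simp: s1_def put_vec_def put_mat_def same_regs_def)
  qed
  then show ?thesis
  proof (rule runs_mono)
    show "1 + (1 + acost (Var 1) + acost (output_adr 2) + acost (output_adr 3) +
      eig_time R A) + check_all_time (2 * n) (Var 1) ?b \<le> definiteness_time p n"
      using T[OF A(2)] by (simp add: definiteness_time_def)
  next
    fix s' assume "same_regs {5,12} s1 s' \<and> mem s' = mem s1 \<and>
      reg s' 5 = (if \<forall>i<2 * n. d $ i > 0 then 1 else 0)"
    then show "frame {5,12} {q + 3, q + 4} s s' \<and> reg s' 5 = (if pd_mat (2 * n) A then 1 else 0)"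
      using pd_mat_iff_eigenvalues_pos[OF A(2) eig]
      by (auto simp: frame_def same_regs_def s1_def put_vec_def put_mat_def)
  qed
qed

section \<open>Recovering the world point\<close>

text \<open>
  The contribution of camera \<open>i\<close>, in register \<open>12\<close>, to a row of the linear system. The first
  factor is \<open>1\<close> if that row is \<open>2i + a\<close> and \<open>0\<close> otherwise, so that summing over the cameras replaces
  the division of the row number by \<open>2\<close>.
\<close>

definition dlt_rexp :: "nat \<Rightarrow> rexp" where
  "dlt_rexp a = Mul (Cell unit_adr (Plus (Plus (Var 12) (Var 12)) (Num a)) (Var 10))
     (Sub (Mul (Cell (output_adr 0) (Plus (Plus (Var 12) (Var 12)) (Num a)) (Var 1))
         (Cell (Var 12) (Num 2) (Var 11)))
       (Cell (Var 12) (Num a) (Var 11)))"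

definition dlt_prog :: com where
  "dlt_prog = accumulate (output_adr 5) (Var 1) (Num 4) (Var 0) (Add (dlt_rexp 0) (dlt_rexp 1))"

definition dlt_time :: "nat \<Rightarrow> nat" where
  "dlt_time n = accumulate_time (2 * n) 4 n (output_adr 5) (Var 1) (Num 4) (Var 0)
     (Add (dlt_rexp 0) (dlt_rexp 1))"

lemma dlt_mat_index:
  assumes "r < 2 * n" "c < 4"
  shows "dlt_mat n P x $$ (r,c) = (\<Sum>t<n.
    (if 2 * t = r then 1 else 0) * (x $ (2 * t) * P t $$ (2,c) - P t $$ (0,c)) +
    (if 2 * t + 1 = r then 1 else 0) * (x $ (2 * t + 1) * P t $$ (2,c) - P t $$ (1,c)))"
proof -
  have "(\<Sum>t<n. (if 2 * t = r then 1 else 0) * (x $ (2 * t) * P t $$ (2,c) - P t $$ (0,c)) +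
      (if 2 * t + 1 = r then 1 else 0) * (x $ (2 * t + 1) * P t $$ (2,c) - P t $$ (1,c))) =
    (\<Sum>t<n. if t = r div 2 then x $ r * P t $$ (2,c) - P t $$ (r mod 2,c) else 0)"
    by (rule sum.cong) auto
  moreover have "r div 2 < n" using assms by linarith
  ultimately show ?thesis using assms by (simp add: dlt_mat_def)
qed

lemma runs_dlt:
  assumes s: "problem_state n P xh s" "reg s 2 = q" "n + 1 < q" "mem s (q + 5) = (\<lambda>_ _. 0)"
    and x: "\<And>i. i < 2 * n \<Longrightarrow> mem s q i (2 * n) = x $ i"
  shows "runs R dlt_prog s (dlt_time n)
    (\<lambda>s'. frame {10,11,12} {q + 5} s s' \<and> get_mat s' (q + 5) (2 * n) 4 = dlt_mat n P x)"
proof -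
  have r: "reg s 0 = n" "reg s 1 = 2 * n" using s by (simp_all add: problem_state_def)
  let ?f = "\<lambda>t i j.
    (if 2 * t = i then 1 else 0) * (x $ (2 * t) * P t $$ (2,j) - P t $$ (0,j)) +
    (if 2 * t + 1 = i then 1 else 0) * (x $ (2 * t + 1) * P t $$ (2,j) - P t $$ (1,j))"
  have "runs R dlt_prog s (dlt_time n)
    (\<lambda>s'. same_regs {10,11,12} s s' \<and> mem s' = set_block (q + 5) (2 * n) 4
      (\<lambda>i j. mem s (q + 5) i j + (\<Sum>t<n. ?f t i j)) s)"
    unfolding dlt_prog_def dlt_time_def
  proof (rule runs_accumulate)
    fix s' assume "same_regs {10,11,12} s s'"
    then show "aval (output_adr 5) s' = q + 5 \<and> aval (Var 1) s' = 2 * n \<and> aval (Num 4) s' = 4 \<and>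
        aval (Var 0) s' = n" using r s(2) by (simp add: same_regs_def)
  next
    fix s' t i j
    assume *: "t < n" "i < 2 * n" "j < 4" "same_regs {10,11,12} s s'" "reg s' 10 = i"
      "reg s' 11 = j" "reg s' 12 = t" "\<And>a. a \<noteq> q + 5 \<Longrightarrow> mem s' a = mem s a"
    then have [simp]: "mem s' (Suc n) = mem s (Suc n)" "mem s' q = mem s q" "mem s' t = mem s t"
      using s(3) by auto
    have "rval (dlt_rexp a) s' = (if 2 * t + a = i then 1 else 0) *
        (x $ (2 * t + a) * P t $$ (2,j) - P t $$ (a,j))" if "a < 2" for a
      using * that r s(1,2) x[of "2 * t + a"]
      by (simp add: dlt_rexp_def problem_state_def same_regs_def mult_2[symmetric])
    from this[of 0] this[of 1]
    show "rval (Add (dlt_rexp 0) (dlt_rexp 1)) s' = ?f t i j" by simp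
  qed
  then show ?thesis
  proof (rule runs_mono)
    fix s' assume s': "same_regs {10,11,12} s s' \<and> mem s' = set_block (q + 5) (2 * n) 4
      (\<lambda>i j. mem s (q + 5) i j + (\<Sum>t<n. ?f t i j)) s"
    have "get_mat s' (q + 5) (2 * n) 4 = dlt_mat n P x"
    proof (rule eq_matI)
      fix i j assume "i < dim_row (dlt_mat n P x)" "j < dim_col (dlt_mat n P x)"
      then have ij: "i < 2 * n" "j < 4" by (simp_all add: dlt_mat_def)
      have "get_mat s' (q + 5) (2 * n) 4 $$ (i,j) = (\<Sum>t<n. ?f t i j)"
        using s' s(4) ij by (simp add: get_mat_def set_block_def)
      then show "get_mat s' (q + 5) (2 * n) 4 $$ (i,j) = dlt_mat n P x $$ (i,j)"
        by (simp only: dlt_mat_index[OF ij])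
    qed (simp_all add: get_mat_def dlt_mat_def)
    then show "frame {10,11,12} {q + 5} s s' \<and> get_mat s' (q + 5) (2 * n) 4 = dlt_mat n P x"
      using s' by (simp add: frame_def set_block_def)
  qed simp
qed

abbreviation "point_rexp \<equiv> Div (Cell (output_adr 8) (Var 10) (Var 4)) (Cell (output_adr 8) (Num 3) (Var 4))"

definition svd_prog :: com where
  "svd_prog = Seq (CallSVD (Var 1) (Num 4) (output_adr 5) (output_adr 6))
     (Seq (find_min 4 (output_adr 7) (Num 4)) (fill (output_adr 9) (Num 3) (Num 1) point_rexp))"

definition svd_prog_time :: "nat poly \<Rightarrow> nat \<Rightarrow> nat" where
  "svd_prog_time p n = 20 + poly p (2 * n * 4) + find_min_time 4 (output_adr 7) (Num 4) +
     fill_time 3 1 (output_adr 9) (Num 3) (Num 1) point_rexp"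

lemma runs_svd:
  assumes r: "reg s 1 = 2 * n" "reg s 2 = q" "n \<ge> 2"
    and A: "get_mat s (q + 5) (2 * n) 4 = A"
    and R: "\<And>r c A. A \<in> carrier_mat r c \<Longrightarrow>
      case svd R A of (U, \<sigma>, W) \<Rightarrow> singular_value_decomposition r c A U \<sigma> W"
    and T: "\<And>r c A. A \<in> carrier_mat r c \<Longrightarrow> svd_time R A \<le> poly p (r * c)"
  shows "runs R svd_prog s (svd_prog_time p n)
    (\<lambda>s'. frame {4,10,11,12} {q + 6, q + 7, q + 8, q + 9} s s' \<and>
      (\<exists>U \<sigma> V m. singular_value_decomposition (2 * n) 4 A U \<sigma> V \<and> m < 4 \<and>
        (\<forall>k<4. \<sigma> $ m \<le> \<sigma> $ k) \<and> (\<forall>k<3. mem s' (q + 9) k 0 = dehomog (col V m) $ k)))"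
proof -
  have carr: "A \<in> carrier_mat (2 * n) 4" using A by (auto simp: get_mat_def)
  obtain U \<sigma> V where USV: "svd R A = (U, \<sigma>, V)" by (metis prod_cases3)
  have svd: "singular_value_decomposition (2 * n) 4 A U \<sigma> V" using R[OF carr] USV by simp
  then have \<sigma>: "\<sigma> \<in> carrier_vec 4" and V: "V \<in> carrier_mat 4 4"
    using r(3) by (simp_all add: singular_value_decomposition_def orthonormal_mat_def)
  define s1 where "s1 = put_mat (q + 8) V (put_vec (q + 7) \<sigma> (put_mat (q + 6) U s))"
  have "exec R (CallSVD (Var 1) (Num 4) (output_adr 5) (output_adr 6)) s
      (1 + acost (Var 1) + acost (Num 4) + acost (output_adr 5) + acost (output_adr 6) + svd_time R A) s1"
    using exec.CallSVD[of A s "output_adr 5" "Var 1" "Num 4" R U \<sigma> V "output_adr 6"] r A USV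
    by (simp add: s1_def eval_nat_numeral)
  then have 1: "runs R (CallSVD (Var 1) (Num 4) (output_adr 5) (output_adr 6)) s
      (1 + acost (Var 1) + acost (Num 4) + acost (output_adr 5) + acost (output_adr 6) + svd_time R A)
      ((=) s1)" by (rule runsI) simp_all
  have mem1: "mem s1 (q + 7) k 0 = \<sigma> $ k" "mem s1 (q + 8) k c = V $$ (k,c)" if "k < 4" "c < 4" for k c
    using that \<sigma> V by (simp_all add: s1_def put_mat_def put_vec_def)
  have r1: "reg s1 = reg s" by (simp add: s1_def put_mat_def put_vec_def)
  have "runs R svd_prog s (1 + (1 + acost (Var 1) + acost (Num 4) + acost (output_adr 5) +
      acost (output_adr 6) + svd_time R A) + (1 + find_min_time 4 (output_adr 7) (Num 4) +
      fill_time 3 1 (output_adr 9) (Num 3) (Num 1) point_rexp))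
    (\<lambda>s'. \<exists>m. m < 4 \<and> (\<forall>k<4. \<sigma> $ m \<le> \<sigma> $ k) \<and> same_regs {4,10,11,12} s1 s' \<and>
      mem s' = set_block (q + 9) 3 1 (\<lambda>i j. V $$ (i,m) / V $$ (3,m)) s1)"
    unfolding svd_prog_def
  proof (rule runs_Seq[OF 1])
    fix s0 assume "s1 = s0"
    have 2: "runs R (find_min 4 (output_adr 7) (Num 4)) s1 (find_min_time 4 (output_adr 7) (Num 4))
      (\<lambda>s'. same_regs {4,12} s1 s' \<and> mem s' = mem s1 \<and> reg s' 4 < 4 \<and>
        (\<forall>i<4. mem s1 (q + 7) (reg s' 4) 0 \<le> mem s1 (q + 7) i 0))"
      by (rule runs_find_min) (use r r1 in \<open>auto simp: same_regs_def\<close>)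
    show "runs R (Seq (find_min 4 (output_adr 7) (Num 4))
        (fill (output_adr 9) (Num 3) (Num 1) point_rexp)) s0
      (1 + find_min_time 4 (output_adr 7) (Num 4) + fill_time 3 1 (output_adr 9) (Num 3) (Num 1) point_rexp)
      (\<lambda>s'. \<exists>m. m < 4 \<and> (\<forall>k<4. \<sigma> $ m \<le> \<sigma> $ k) \<and> same_regs {4,10,11,12} s1 s' \<and>
        mem s' = set_block (q + 9) 3 1 (\<lambda>i j. V $$ (i,m) / V $$ (3,m)) s1)"
      unfolding \<open>s1 = s0\<close>[symmetric]
    proof (rule runs_Seq[OF 2])
      fix s2 assume s2: "same_regs {4,12} s1 s2 \<and> mem s2 = mem s1 \<and> reg s2 4 < 4 \<and>
        (\<forall>i<4. mem s1 (q + 7) (reg s2 4) 0 \<le> mem s1 (q + 7) i 0)"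
      let ?m = "reg s2 4"
      have "runs R (fill (output_adr 9) (Num 3) (Num 1) point_rexp) s2
        (fill_time 3 1 (output_adr 9) (Num 3) (Num 1) point_rexp)
        (\<lambda>s'. same_regs {10,11} s2 s' \<and>
          mem s' = set_block (q + 9) 3 1 (\<lambda>i j. V $$ (i,?m) / V $$ (3,?m)) s2)"
        by (rule runs_fill) (use s2 r r1 mem1(2) in \<open>auto simp: same_regs_def\<close>)
      then show "runs R (fill (output_adr 9) (Num 3) (Num 1) point_rexp) s2
        (fill_time 3 1 (output_adr 9) (Num 3) (Num 1) point_rexp)
        (\<lambda>s'. \<exists>m. m < 4 \<and> (\<forall>k<4. \<sigma> $ m \<le> \<sigma> $ k) \<and> same_regs {4,10,11,12} s1 s' \<and>
          mem s' = set_block (q + 9) 3 1 (\<lambda>i j. V $$ (i,m) / V $$ (3,m)) s1)"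
      proof (rule runs_mono)
        fix s' assume "same_regs {10,11} s2 s' \<and>
          mem s' = set_block (q + 9) 3 1 (\<lambda>i j. V $$ (i,?m) / V $$ (3,?m)) s2"
        then show "\<exists>m. m < 4 \<and> (\<forall>k<4. \<sigma> $ m \<le> \<sigma> $ k) \<and> same_regs {4,10,11,12} s1 s' \<and>
          mem s' = set_block (q + 9) 3 1 (\<lambda>i j. V $$ (i,m) / V $$ (3,m)) s1"
          using s2 mem1(1)[of _ 0] by (intro exI[of _ ?m]) (auto simp: same_regs_def set_block_def fun_eq_iff)
      qed simp
    qed
  qed
  then show ?thesis
  proof (rule runs_mono)
    show "1 + (1 + acost (Var 1) + acost (Num 4) + acost (output_adr 5) +
      acost (output_adr 6) + svd_time R A) + (1 + find_min_time 4 (output_adr 7) (Num 4) +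
      fill_time 3 1 (output_adr 9) (Num 3) (Num 1) point_rexp) \<le> svd_prog_time p n"
      using T[OF carr] by (simp add: svd_prog_time_def)
  next
    fix s' assume "\<exists>m. m < 4 \<and> (\<forall>k<4. \<sigma> $ m \<le> \<sigma> $ k) \<and> same_regs {4,10,11,12} s1 s' \<and>
      mem s' = set_block (q + 9) 3 1 (\<lambda>i j. V $$ (i,m) / V $$ (3,m)) s1"
    then obtain m where m: "m < 4" "\<forall>k<4. \<sigma> $ m \<le> \<sigma> $ k" "same_regs {4,10,11,12} s1 s'"
      "mem s' = set_block (q + 9) 3 1 (\<lambda>i j. V $$ (i,m) / V $$ (3,m)) s1" by blast
    have "frame {4,10,11,12} {q + 6, q + 7, q + 8, q + 9} s s'"
      using m r1 by (auto simp: frame_def same_regs_def set_block_def s1_def put_mat_def put_vec_def)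
    moreover have "\<forall>k<3. mem s' (q + 9) k 0 = dehomog (col V m) $ k"
      using m V by (simp add: set_block_def dehomog_def)
    ultimately show "frame {4,10,11,12} {q + 6, q + 7, q + 8, q + 9} s s' \<and>
      (\<exists>U \<sigma> V m. singular_value_decomposition (2 * n) 4 A U \<sigma> V \<and> m < 4 \<and>
        (\<forall>k<4. \<sigma> $ m \<le> \<sigma> $ k) \<and> (\<forall>k<3. mem s' (q + 9) k 0 = dehomog (col V m) $ k))"
      using svd m by blast
  qed
qed

section \<open>Reprojection, coplanarity and the verdict\<close>

abbreviation "req a b \<equiv> Conj (Neg (RLess a b)) (Neg (RLess b a))"
abbreviation "bor a b \<equiv> Neg (Conj (Neg a) (Neg b))"

lemma bval_req: "bval (req a b) s \<longleftrightarrow> rval a s = rval b s"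
  by auto

abbreviation "world_rexp k \<equiv> Cell (output_adr 9) (Num k) (Num 0)"

abbreviation "image_rexp k \<equiv> Add (Add (Add
  (Mul (Cell (Var 12) (Num k) (Num 0)) (world_rexp 0))
  (Mul (Cell (Var 12) (Num k) (Num 1)) (world_rexp 1)))
  (Mul (Cell (Var 12) (Num k) (Num 2)) (world_rexp 2)))
  (Cell (Var 12) (Num k) (Num 3))"

definition reproject_bexp :: bexp where
  "reproject_bexp = Conj (Neg (req (image_rexp 2) (Const 0)))
     (Conj (req (Cell (output_adr 0) (Plus (Plus (Var 12) (Var 12)) (Num 0)) (Var 1))
         (Div (image_rexp 0) (image_rexp 2)))
       (req (Cell (output_adr 0) (Plus (Plus (Var 12) (Var 12)) (Num 1)) (Var 1))
         (Div (image_rexp 1) (image_rexp 2))))"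

definition reproject_prog :: com where
  "reproject_prog = check_all 6 (Var 0) reproject_bexp"

definition reproject_time :: "nat \<Rightarrow> nat" where
  "reproject_time n = check_all_time n (Var 0) reproject_bexp"

lemma runs_reproject:
  assumes s: "problem_state n P xh s" "reg s 2 = q"
    and P: "\<And>i. i < n \<Longrightarrow> P i \<in> carrier_mat 3 4"
    and x: "\<And>i. i < 2 * n \<Longrightarrow> mem s q i (2 * n) = x $ i"
    and X: "X \<in> carrier_vec 3" "\<And>k. k < 3 \<Longrightarrow> mem s (q + 9) k 0 = X $ k"
  shows "runs R reproject_prog s (reproject_time n)
    (\<lambda>s'. frame {6,12} {} s s' \<and> reg s' 6 = (if reprojects n P x X then 1 else 0))"
proof -
  have r: "reg s 0 = n" "reg s 1 = 2 * n" using s by (simp_all add: problem_state_def)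
  have PX: "(P i *\<^sub>v homog X) $ k = P i $$ (k,0) * X $ 0 + P i $$ (k,1) * X $ 1 +
      P i $$ (k,2) * X $ 2 + P i $$ (k,3)" if "i < n" "k < 3" for i k
    using P[OF that(1)] X(1) that(2)
    by (simp add: scalar_prod_def homog_def eval_nat_numeral)
  have "runs R reproject_prog s (reproject_time n) (\<lambda>s'. same_regs {6,12} s s' \<and> mem s' = mem s \<and>
      reg s' 6 = (if \<forall>i<n. (P i *\<^sub>v homog X) $ 2 \<noteq> 0 \<and>
        image_point x i = dehomog (P i *\<^sub>v homog X) then 1 else 0))"
    unfolding reproject_prog_def reproject_time_def
  proof (rule runs_check_all)
    show "aval (Var 0) s' = n" if "same_regs {6,12} s s'" for s'
      using that r by (simp add: same_regs_def)
  next
    fix s' i assume *: "i < n" "same_regs {6,12} s s'" "reg s' 12 = i" "mem s' = mem s"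
    have proj: "rval (image_rexp k) s' = (P i *\<^sub>v homog X) $ k" if "k < 3" for k
      using * that s X(2) by (simp add: PX problem_state_def same_regs_def)
    have xi: "rval (Cell (output_adr 0) (Plus (Plus (Var 12) (Var 12)) (Num k)) (Var 1)) s' =
        image_point x i $ k" if "k < 2" for k
      using * that s(2) r x[of "2 * i + k"] by (simp add: same_regs_def image_point_def mult_2[symmetric])
    have lt: "0 < (3::nat)" "1 < (3::nat)" "2 < (3::nat)" "0 < (2::nat)" "1 < (2::nat)" by simp_all
    have b: "bval (Conj (Neg (req a (Const 0))) (Conj (req b (Div c a)) (req d (Div e a)))) s' \<longleftrightarrow>
        rval a s' \<noteq> 0 \<and> rval b s' = rval c s' / rval a s' \<and> rval d s' = rval e s' / rval a s'"
      for a b c d e by auto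
    have "image_point x i = dehomog (P i *\<^sub>v homog X) \<longleftrightarrow>
        (\<forall>k<2. image_point x i $ k = (P i *\<^sub>v homog X) $ k / (P i *\<^sub>v homog X) $ 2)"
      using P[OF *(1)] by (auto simp: vec_eq_iff image_point_def dehomog_def simp del: index_mult_mat_vec)
    also have "\<dots> \<longleftrightarrow> image_point x i $ 0 = (P i *\<^sub>v homog X) $ 0 / (P i *\<^sub>v homog X) $ 2 \<and>
        image_point x i $ 1 = (P i *\<^sub>v homog X) $ 1 / (P i *\<^sub>v homog X) $ 2"
      by (simp only: numeral_2_eq_2 less_Suc_eq_0_disj) auto
    finally show "bval reproject_bexp s' \<longleftrightarrow> (P i *\<^sub>v homog X) $ 2 \<noteq> 0 \<and>
        image_point x i = dehomog (P i *\<^sub>v homog X)"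
      unfolding reproject_bexp_def b
      by (simp only: proj[OF lt(1)] proj[OF lt(2)] proj[OF lt(3)] xi[OF lt(4)] xi[OF lt(5)])
  qed simp
  then show ?thesis
    by (rule runs_mono) (auto simp: reprojects_def frame_def)
qed

text \<open>
  The unit vector in the last row is a row of the identity matrix, which has more than \<open>4\<close> rows
  because \<open>n \<ge> 2\<close>.
\<close>

definition center_rexp :: rexp where
  "center_rexp = det_rexp 4 (\<lambda>r c. if r < 3 then Cell (Var 10) (Num r) (Num c)
     else Cell unit_adr (Var 11) (Num c))"

abbreviation "gram_rexp \<equiv>
  Mul (Cell (output_adr 10) (Var 12) (Var 10)) (Cell (output_adr 10) (Var 12) (Var 11))"

definition centers_prog :: com where
  "centers_prog = Seq (fill (output_adr 10) (Var 0) (Num 4) center_rexp)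
     (accumulate (output_adr 11) (Num 4) (Num 4) (Var 0) gram_rexp)"

definition centers_time :: "nat \<Rightarrow> nat" where
  "centers_time n = 1 + fill_time n 4 (output_adr 10) (Var 0) (Num 4) center_rexp +
     accumulate_time 4 4 n (output_adr 11) (Num 4) (Num 4) (Var 0) gram_rexp"

lemma runs_centers:
  assumes s: "problem_state n P xh s" "reg s 2 = q" "n + 1 < q" "n \<ge> 2"
    and zero: "mem s (q + 11) = (\<lambda>_ _. 0)"
  shows "runs R centers_prog s (centers_time n)
    (\<lambda>s'. frame {10,11,12} {q + 10, q + 11} s s' \<and>
      get_mat s' (q + 11) 4 4 = gram_mat 4 n (\<lambda>i. center_coord (P i)))"
proof -
  have r: "reg s 0 = n" using s by (simp add: problem_state_def)
  have 1: "runs R (fill (output_adr 10) (Var 0) (Num 4) center_rexp) s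
      (fill_time n 4 (output_adr 10) (Var 0) (Num 4) center_rexp)
      (\<lambda>s'. same_regs {10,11} s s' \<and>
        mem s' = set_block (q + 10) n 4 (\<lambda>i j. center_coord (P i) j) s)"
  proof (rule runs_fill)
    fix s' assume "same_regs {10,11} s s'"
    then show "aval (output_adr 10) s' = q + 10 \<and> aval (Var 0) s' = n \<and> aval (Num 4) s' = 4"
      using r s(2) by (simp add: same_regs_def)
  next
    fix s' i j
    assume *: "i < n" "j < 4" "same_regs {10,11} s s'" "reg s' 10 = i" "reg s' 11 = j"
      "\<And>a. a \<noteq> q + 10 \<Longrightarrow> mem s' a = mem s a"
    then have m: "mem s' i = mem s i" "mem s' (Suc n) = mem s (Suc n)" using s(3) by auto
    show "rval center_rexp s' = center_coord (P i) j"
      unfolding center_rexp_def rval_det_rexp center_coord_def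
      by (rule arg_cong[where f = det], rule eq_matI)
        (use * m r s(1,4) in \<open>auto simp: problem_state_def same_regs_def unit_vec_def\<close>)
  qed
  show ?thesis
    unfolding centers_prog_def centers_time_def
  proof (rule runs_Seq[OF 1])
    fix s1 assume s1: "same_regs {10,11} s s1 \<and>
        mem s1 = set_block (q + 10) n 4 (\<lambda>i j. center_coord (P i) j) s"
    have "runs R (accumulate (output_adr 11) (Num 4) (Num 4) (Var 0) gram_rexp) s1
        (accumulate_time 4 4 n (output_adr 11) (Num 4) (Num 4) (Var 0) gram_rexp)
        (\<lambda>s'. same_regs {10,11,12} s1 s' \<and> mem s' = set_block (q + 11) 4 4
          (\<lambda>i j. mem s1 (q + 11) i j + (\<Sum>t<n. center_coord (P t) i * center_coord (P t) j)) s1)"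
      by (rule runs_accumulate) (use s1 r s(2) in \<open>auto simp: same_regs_def set_block_def\<close>)
    then show "runs R (accumulate (output_adr 11) (Num 4) (Num 4) (Var 0) gram_rexp) s1
        (accumulate_time 4 4 n (output_adr 11) (Num 4) (Num 4) (Var 0) gram_rexp)
        (\<lambda>s'. frame {10,11,12} {q + 10, q + 11} s s' \<and>
          get_mat s' (q + 11) 4 4 = gram_mat 4 n (\<lambda>i. center_coord (P i)))"
      by (rule runs_mono)
        (use s1 zero in \<open>auto simp: frame_def same_regs_def set_block_def get_mat_def gram_mat_def\<close>)
  qed
qed

abbreviation "coplanar_bexp \<equiv>
  req (det_rexp 4 (\<lambda>r c. Cell (output_adr 11) (Num r) (Num c))) (Const 0)"

definition verdict_bexp :: bexp where
  "verdict_bexp = Conj (ALess (Num 0) (Var 5))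
     (bor (bor (ALess (Var 0) (Num 3)) (Conj (ALess (Num 3) (Var 0)) (Neg coplanar_bexp)))
       (ALess (Num 0) (Var 6)))"

text \<open>
  Camera \<open>0\<close> and the number \<open>n\<close> are overwritten by the result, which is why every test that reads
  a camera precedes this part, and why \<open>n\<close> is compared within the condition that decides the
  verdict.
\<close>

definition output_prog :: com where
  "output_prog = Seq (fill (Num 0) (Num 3) (Num 1) (Cell (output_adr 9) (Var 10) (Var 11)))
     (Cond verdict_bexp (Assign 0 (Num 1)) (Assign 0 (Num 0)))"

definition output_time :: nat where
  "output_time = 10 + bcost verdict_bexp +
     fill_time 3 1 (Num 0) (Num 3) (Num 1) (Cell (output_adr 9) (Var 10) (Var 11))"

lemma runs_output:
  assumes r: "reg s 0 = n" "reg s 2 = q" "n \<ge> 2" and cam: "cameras n P"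
    and pd: "reg s 5 = (if pd then 1 else 0)" and rep: "reg s 6 = (if rep then 1 else 0)"
    and X: "X \<in> carrier_vec 3" "\<And>k. k < 3 \<Longrightarrow> mem s (q + 9) k 0 = X $ k"
    and gram: "get_mat s (q + 11) 4 4 = gram_mat 4 n (\<lambda>i. center_coord (P i))"
  shows "runs R output_prog s output_time (\<lambda>s'. output_point s' = X \<and>
    output_verdict s' = (if pd \<and> ((n = 2 \<or> n \<ge> 4 \<and> \<not> coplanar_centers n P) \<or> rep)
      then OPTIMAL else SUBOPTIMAL))"
proof -
  have 1: "runs R (fill (Num 0) (Num 3) (Num 1) (Cell (output_adr 9) (Var 10) (Var 11))) s
      (fill_time 3 1 (Num 0) (Num 3) (Num 1) (Cell (output_adr 9) (Var 10) (Var 11)))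
      (\<lambda>s'. same_regs {10,11} s s' \<and> mem s' = set_block 0 3 1 (\<lambda>i j. X $ i) s)"
    by (rule runs_fill) (use r X in \<open>auto simp: same_regs_def\<close>)
  have "runs R output_prog s (1 + fill_time 3 1 (Num 0) (Num 3) (Num 1)
      (Cell (output_adr 9) (Var 10) (Var 11)) + (1 + bcost verdict_bexp + 2)) (\<lambda>s'. output_point s' = X \<and>
    output_verdict s' = (if pd \<and> ((n = 2 \<or> n \<ge> 4 \<and> \<not> coplanar_centers n P) \<or> rep)
      then OPTIMAL else SUBOPTIMAL))"
    unfolding output_prog_def
  proof (rule runs_Seq[OF 1])
    fix s1 assume s1: "same_regs {10,11} s s1 \<and> mem s1 = set_block 0 3 1 (\<lambda>i j. X $ i) s"
    then have r1: "reg s1 0 = n" "reg s1 2 = q" "reg s1 5 = reg s 5" "reg s1 6 = reg s 6"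
      using r by (simp_all add: same_regs_def)
    have X1: "vec 3 (\<lambda>k. mem s1 0 k 0) = X" using s1 X(1) by (intro eq_vecI) (auto simp: set_block_def)
    have "mat 4 4 (\<lambda>(i,j). mem s1 (q + 11) i j) = gram_mat 4 n (\<lambda>i. center_coord (P i))"
      using s1 gram by (simp add: set_block_def get_mat_def)
    then have cop: "bval coplanar_bexp s1 \<longleftrightarrow> coplanar_centers n P"
      unfolding bval_req rval_det_rexp using r1(2) by (simp add: coplanar_centers_iff_det_gram[OF cam])
    have v: "bval verdict_bexp s1 \<longleftrightarrow> pd \<and> ((n = 2 \<or> n \<ge> 4 \<and> \<not> coplanar_centers n P) \<or> rep)"
    proof -
      have b: "bval (Conj a (bor (bor b (Conj c (Neg d))) e)) s1 \<longleftrightarrow>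
          bval a s1 \<and> ((bval b s1 \<or> bval c s1 \<and> \<not> bval d s1) \<or> bval e s1)" for a b c d e
        by auto
      have "bval verdict_bexp s1 \<longleftrightarrow> 0 < reg s 5 \<and>
          ((n < 3 \<or> 3 < n \<and> \<not> bval coplanar_bexp s1) \<or> 0 < reg s 6)"
        unfolding verdict_bexp_def b by (simp only: bval.simps(1) aval.simps r1)
      then show ?thesis unfolding cop using r(3) pd rep by auto
    qed
    show "runs R (Cond verdict_bexp (Assign 0 (Num 1)) (Assign 0 (Num 0))) s1 (1 + bcost verdict_bexp + 2)
      (\<lambda>s'. output_point s' = X \<and>
        output_verdict s' = (if pd \<and> ((n = 2 \<or> n \<ge> 4 \<and> \<not> coplanar_centers n P) \<or> rep)
          then OPTIMAL else SUBOPTIMAL))"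
    proof (rule runs_Cond)
      assume b: "bval verdict_bexp s1"
      have "runs R (Assign 0 (Num 1)) s1 (1 + acost (Num 1)) (\<lambda>s'. s' = s1\<lparr>reg := (reg s1)(0 := 1)\<rparr>)"
        by (rule runs_Assign) simp
      then show "runs R (Assign 0 (Num 1)) s1 2 (\<lambda>s'. output_point s' = X \<and>
        output_verdict s' = (if pd \<and> ((n = 2 \<or> n \<ge> 4 \<and> \<not> coplanar_centers n P) \<or> rep)
          then OPTIMAL else SUBOPTIMAL))"
        using b X1 unfolding v by (elim runs_mono) (auto simp: output_point_def output_verdict_def)
    next
      assume b: "\<not> bval verdict_bexp s1"
      have "runs R (Assign 0 (Num 0)) s1 (1 + acost (Num 0)) (\<lambda>s'. s' = s1\<lparr>reg := (reg s1)(0 := 0)\<rparr>)"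
        by (rule runs_Assign) simp
      then show "runs R (Assign 0 (Num 0)) s1 2 (\<lambda>s'. output_point s' = X \<and>
        output_verdict s' = (if pd \<and> ((n = 2 \<or> n \<ge> 4 \<and> \<not> coplanar_centers n P) \<or> rep)
          then OPTIMAL else SUBOPTIMAL))"
        using b X1 unfolding v by (elim runs_mono) (auto simp: output_point_def output_verdict_def)
    qed
  qed
  then show ?thesis by (rule runs_mono) (simp_all add: output_time_def)
qed

section \<open>The complete program\<close>

definition algorithm :: com where
  "algorithm = Seq setup_prog (Seq objective_prog (Seq constraints_prog (Seq normalization_prog
     (Seq solve_prog (Seq hessian_prog (Seq definiteness_prog (Seq dlt_prog (Seq svd_prog
       (Seq reproject_prog (Seq centers_prog output_prog))))))))))"

definition algorithm_time :: "nat poly \<Rightarrow> nat poly \<Rightarrow> nat poly \<Rightarrow> nat \<Rightarrow> nat" where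
  "algorithm_time p_sdp p_eig p_svd n = 11 + setup_time n + objective_time n + constraints_time n +
     normalization_time n + solve_time p_sdp n + hessian_time n + definiteness_time p_eig n +
     dlt_time n + svd_prog_time p_svd n + reproject_time n + centers_time n + output_time"

lemma length_pairs_le: "length (pairs n) \<le> n * n"
  by (induction n) (simp_all add: pairs_Suc, simp add: pairs_def)

lemma poly_bounded_length_pairs: "poly_bounded (\<lambda>n. length (pairs n))"
  by (rule poly_bounded_le[OF poly_bounded_mult[OF poly_bounded_id poly_bounded_id] length_pairs_le])

lemmas poly_bounded_intros = poly_bounded_const poly_bounded_id poly_bounded_add poly_bounded_mult
  poly_bounded_poly poly_bounded_length_pairs

lemma poly_bounded_algorithm_time: "poly_bounded (algorithm_time p_sdp p_eig p_svd)"
  unfolding algorithm_time_def[abs_def] setup_time_def objective_time_def constraints_time_def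
    normalization_time_def solve_time_def hessian_time_def definiteness_time_def dlt_time_def
    svd_prog_time_def reproject_time_def centers_time_def output_time_def
    accumulate_time_def fill_time_def check_all_time_def find_min_time_def for_time_def
    power2_eq_square
  by (intro poly_bounded_intros)

text \<open>
  What remains is to chain the parts. Each of them changes only a few registers and addresses, so
  that whatever a later part takes from an earlier one is still in place.
\<close>

lemma runs_algorithm:
  assumes n: "n \<ge> 2" and cam: "cameras n P" and xh: "xh \<in> carrier_vec (2 * n)"
    and sdp: "sdp_routine \<epsilon> R" "\<And>S. sdp_wf S \<Longrightarrow> sdp_time R S \<le> poly p_sdp (sdp_size S)"
    and eig: "eig_routine R" "\<And>k A. sym_mat k A \<Longrightarrow> eig_time R A \<le> poly p_eig (k * k)"
    and svd: "svd_routine R" "\<And>r c A. A \<in> carrier_mat r c \<Longrightarrow> svd_time R A \<le> poly p_svd (r * c)"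
  shows "runs R algorithm (input n P xh) (algorithm_time p_sdp p_eig p_svd n)
    (\<lambda>s. triangulation \<epsilon> n P xh (output_verdict s) (output_point s))"
proof -
  let ?N = "2 * n + 1" and ?m = "length (pairs n)"
  define q where "q = n + 5 + ?m"
  have P: "P i \<in> carrier_mat 3 4" if "i < n" for i using cam that by (simp add: cameras_def)
  obtain t1 s1 where 1: "exec R setup_prog (input n P xh) t1 s1" "t1 \<le> setup_time n"
      "problem_state n P xh s1" "blank_above (n + 1) s1" "reg s1 3 = 0"
    using runs_setup[of n P xh R, OF P xh] unfolding runs_def by blast
  obtain t2 s2 where 2: "exec R objective_prog s1 t2 s2" "t2 \<le> objective_time n"
      "frame {10,11,12} {n + 2} s1 s2" "get_mat s2 (n + 2) ?N ?N = G_mat n xh"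
    using runs_objective[OF 1(3,4) xh, of R] unfolding runs_def by blast
  have p2: "problem_state n P xh s2" by (rule problem_state_frame[OF 1(3) 2(3)]) auto
  have b2: "blank_above (n + 2) s2" by (rule blank_above_frame[OF 1(4) 2(3)]) auto
  have "reg s2 3 = 0" using frame_reg[OF 2(3), of 3] 1(5) by simp
  then obtain t3 s3 where 3: "exec R constraints_prog s2 t3 s3" "t3 \<le> constraints_time n"
      "frame {3,10,11,12,13} {n + 3..<n + 3 + ?m} s2 s3" "reg s3 3 = ?m"
      "\<forall>k<?m. get_mat s3 (n + 3 + k) ?N ?N = (case pairs n ! k of (i, j) \<Rightarrow> F_mat n P i j)"
    using runs_constraints[OF p2 b2, of R] unfolding runs_def by blast
  have p3: "problem_state n P xh s3" by (rule problem_state_frame[OF p2 3(3)]) auto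
  have b3: "blank_above (n + 2 + ?m) s3" by (rule blank_above_frame[OF b2 3(3)]) auto
  have o3: "get_mat s3 (n + 2) ?N ?N = G_mat n xh"
    using 2(4) frame_mem[OF 3(3), of "n + 2"] by (simp add: get_mat_def)
  obtain t4 s4 where 4: "exec R normalization_prog s3 t4 s4" "t4 \<le> normalization_time n"
      "sdp_state n P xh q s4" "blank_above (n + 4 + ?m) s4"
    using runs_normalization[OF p3 3(4) b3 o3, of R] 3(5) unfolding runs_def q_def by blast
  have solves: "case sdp_solve R S of (Y, y) \<Rightarrow> sdp_solution \<epsilon> S Y y"
    if "sdp_wf S" "\<exists>Y. primal_feasible S Y" "\<exists>y. dual_feasible S y" for S
    using conjunct1[OF sdp(1)[unfolded sdp_routine_def]] that by simp
  obtain t5 s5 Y l \<rho> where 5: "exec R solve_prog s4 t5 s5" "t5 \<le> solve_time p_sdp n"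
      "frame {2} {q, q + 1} s4 s5" "reg s5 2 = q"
      "sdp_solution \<epsilon> (triangulation_sdp n P xh) Y (multipliers n l \<rho>)"
      "\<forall>i<?N. \<forall>j<?N. mem s5 q i j = Y $$ (i,j)"
      "\<forall>k<?m + 1. mem s5 (q + 1) k 0 = multipliers n l \<rho> $ k"
    using runs_solve[OF 4(3) cam xh solves sdp(2)] unfolding runs_def by blast
  define x where "x = vec (2 * n) (\<lambda>r. Y $$ (r, 2 * n))"
  have st5: "sdp_state n P xh q s5" by (rule sdp_state_frame[OF 4(3) 5(3)]) auto
  obtain t6 s6 where 6: "exec R hessian_prog s5 t6 s6" "t6 \<le> hessian_time n"
      "frame {10,11,12} {q + 2} s5 s6" "get_mat s6 (q + 2) (2 * n) (2 * n) = hessian_mat n P l"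
    using runs_hessian[OF st5 5(4) 5(7), of R] unfolding runs_def by blast
  have st6: "sdp_state n P xh q s6" by (rule sdp_state_frame[OF st5 6(3)]) auto
  have r6: "reg s6 1 = 2 * n" "reg s6 2 = q"
    using st6 frame_reg[OF 6(3), of 2] 5(4) by (simp_all add: sdp_state_def problem_state_def)
  have diagonalizes: "case Defs.eig R A of (Q, d) \<Rightarrow> eigendecomposition k A Q d"
    if "sym_mat k A" for k A
    using conjunct1[OF eig(1)[unfolded eig_routine_def]] that by simp
  obtain t7 s7 where 7: "exec R definiteness_prog s6 t7 s7" "t7 \<le> definiteness_time p_eig n"
      "frame {5,12} {q + 3, q + 4} s6 s7"
      "reg s7 5 = (if pd_mat (2 * n) (hessian_mat n P l) then 1 else 0)"
    using runs_definiteness[OF r6 6(4) hessian_mat_sym diagonalizes eig(2)] unfolding runs_def by blast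
  have fr57: "frame {5,10,11,12} {q + 2, q + 3, q + 4} s5 s7"
    by (rule frame_trans[OF 6(3) 7(3)]) auto
  have st7: "sdp_state n P xh q s7" by (rule sdp_state_frame[OF st5 fr57]) auto
  then have p7: "problem_state n P xh s7" by (simp add: sdp_state_def)
  have r7: "reg s7 2 = q" using frame_reg[OF fr57, of 2] 5(4) by simp
  have q: "n + 1 < q" by (simp add: q_def)
  have x7: "mem s7 q i (2 * n) = x $ i" if "i < 2 * n" for i
    using frame_mem[OF fr57, of q] 5(6) that by (simp add: x_def)
  have fr47: "frame {2,5,10,11,12} {q, q + 1, q + 2, q + 3, q + 4} s4 s7"
    by (rule frame_trans[OF 5(3) fr57]) auto
  have z7: "mem s7 a = (\<lambda>_ _. 0)" if "a > q + 4" for a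
    using frame_mem[OF fr47, of a] 4(4) that by (simp add: blank_above_def q_def)
  obtain t8 s8 where 8: "exec R dlt_prog s7 t8 s8" "t8 \<le> dlt_time n"
      "frame {10,11,12} {q + 5} s7 s8" "get_mat s8 (q + 5) (2 * n) 4 = dlt_mat n P x"
    using runs_dlt[OF p7 r7 q z7 x7, of R] unfolding runs_def by auto
  have r8: "reg s8 1 = 2 * n" "reg s8 2 = q"
    using p7 frame_reg[OF 8(3), of 1] frame_reg[OF 8(3), of 2] r7 by (simp_all add: problem_state_def)
  have decomposes: "case Defs.svd R A of (U, \<sigma>, W) \<Rightarrow> singular_value_decomposition r c A U \<sigma> W"
    if "A \<in> carrier_mat r c" for r c A
    using conjunct1[OF svd(1)[unfolded svd_routine_def]] that by simp
  obtain t9 s9 U \<sigma> V k where 9: "exec R svd_prog s8 t9 s9" "t9 \<le> svd_prog_time p_svd n"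
      "frame {4,10,11,12} {q + 6, q + 7, q + 8, q + 9} s8 s9"
      "singular_value_decomposition (2 * n) 4 (dlt_mat n P x) U \<sigma> V" "k < 4"
      "\<forall>j<4. \<sigma> $ k \<le> \<sigma> $ j" "\<forall>j<3. mem s9 (q + 9) j 0 = dehomog (col V k) $ j"
    using runs_svd[OF r8 n 8(4) decomposes svd(2)] unfolding runs_def by blast
  define X where "X = dehomog (col V k)"
  have "V \<in> carrier_mat 4 4"
    using 9(4) by (simp add: singular_value_decomposition_def orthonormal_mat_def)
  then have X: "X \<in> carrier_vec 3" by (simp add: X_def dehomog_def)
  have fr79: "frame {4,10,11,12} {q + 5, q + 6, q + 7, q + 8, q + 9} s7 s9"
    by (rule frame_trans[OF 8(3) 9(3)]) auto
  have p9: "problem_state n P xh s9" by (rule problem_state_frame[OF p7 fr79]) (use q in auto)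
  have r9: "reg s9 2 = q" using frame_reg[OF fr79, of 2] r7 by simp
  have x9: "mem s9 q i (2 * n) = x $ i" if "i < 2 * n" for i
    using frame_mem[OF fr79, of q] x7[OF that] by simp
  have X9: "mem s9 (q + 9) j 0 = X $ j" if "j < 3" for j using 9(7) that by (simp add: X_def)
  obtain t10 s10 where 10: "exec R reproject_prog s9 t10 s10" "t10 \<le> reproject_time n"
      "frame {6,12} {} s9 s10" "reg s10 6 = (if reprojects n P x X then 1 else 0)"
    using runs_reproject[OF p9 r9 P x9 X X9, of R] unfolding runs_def by blast
  have fr7_10: "frame {4,6,10,11,12} {q + 5, q + 6, q + 7, q + 8, q + 9} s7 s10"
    by (rule frame_trans[OF fr79 10(3)]) auto
  have p10: "problem_state n P xh s10" by (rule problem_state_frame[OF p7 fr7_10]) (use q in auto)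
  have r10: "reg s10 2 = q" "reg s10 5 = (if pd_mat (2 * n) (hessian_mat n P l) then 1 else 0)"
    using frame_reg[OF fr7_10, of 2] frame_reg[OF fr7_10, of 5] r7 7(4) by simp_all
  have z10: "mem s10 (q + 11) = (\<lambda>_ _. 0)" using frame_mem[OF fr7_10, of "q + 11"] z7 by simp
  obtain t11 s11 where 11: "exec R centers_prog s10 t11 s11" "t11 \<le> centers_time n"
      "frame {10,11,12} {q + 10, q + 11} s10 s11"
      "get_mat s11 (q + 11) 4 4 = gram_mat 4 n (\<lambda>i. center_coord (P i))"
    using runs_centers[OF p10 r10(1) q n z10, of R] unfolding runs_def by blast
  have r11: "reg s11 0 = n" "reg s11 2 = q"
    "reg s11 5 = (if pd_mat (2 * n) (hessian_mat n P l) then 1 else 0)"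
    "reg s11 6 = (if reprojects n P x X then 1 else 0)"
    using frame_reg[OF 11(3), of 0] frame_reg[OF 11(3), of 2] frame_reg[OF 11(3), of 5]
      frame_reg[OF 11(3), of 6] p10 r10 10(4) by (simp_all add: problem_state_def)
  have X11: "mem s11 (q + 9) j 0 = X $ j" if "j < 3" for j
    using frame_mem[OF 11(3), of "q + 9"] frame_mem[OF 10(3), of "q + 9"] X9[OF that] by simp
  obtain t12 s12 where 12: "exec R output_prog s11 t12 s12" "t12 \<le> output_time"
      "output_point s12 = X"
      "output_verdict s12 = (if pd_mat (2 * n) (hessian_mat n P l) \<and>
        ((n = 2 \<or> n \<ge> 4 \<and> \<not> coplanar_centers n P) \<or> reprojects n P x X) then OPTIMAL else SUBOPTIMAL)"
    using runs_output[OF r11(1,2) n cam r11(3,4) X X11 11(4), of R] unfolding runs_def by blast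
  have result: "triangulation \<epsilon> n P xh (output_verdict s12) (output_point s12)"
    unfolding triangulation_def using 5(5) x_def 9(4-6) 12(3,4) X_def by blast
  note run = exec.Seq[OF 1(1) exec.Seq[OF 2(1) exec.Seq[OF 3(1) exec.Seq[OF 4(1)
    exec.Seq[OF 5(1) exec.Seq[OF 6(1) exec.Seq[OF 7(1) exec.Seq[OF 8(1) exec.Seq[OF 9(1)
    exec.Seq[OF 10(1) exec.Seq[OF 11(1) 12(1)]]]]]]]]]]]
  show ?thesis
    unfolding algorithm_def algorithm_time_def
  proof (rule runsI[OF run])
    show "triangulation \<epsilon> n P xh (output_verdict s12) (output_point s12)" by (fact result)
  qed (use 1(2) 2(2) 3(2) 4(2) 5(2) 6(2) 7(2) 8(2) 9(2) 10(2) 11(2) 12(2) in linarith)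
qed

theorem theorem1:
  shows "\<exists>algorithm1 :: com. \<forall>(R :: routines) (\<epsilon> :: real).
    \<epsilon> > 0 \<and> sdp_routine \<epsilon> R \<and> eig_routine R \<and> svd_routine R \<longrightarrow>
    (\<exists>p :: nat poly. \<forall>(n :: nat) (P :: nat \<Rightarrow> real mat) (xh :: real vec).
       n \<ge> 2 \<and> cameras n P \<and> xh \<in> carrier_vec (2 * n) \<longrightarrow>
       (\<exists>t s. exec R algorithm1 (input n P xh) t s \<and> t \<le> poly p n \<and>
          triangulation \<epsilon> n P xh (output_verdict s) (output_point s)))"
proof (intro exI[of _ algorithm] allI impI)
  fix R :: routines and \<epsilon> :: real
  assume A: "\<epsilon> > 0 \<and> sdp_routine \<epsilon> R \<and> eig_routine R \<and> svd_routine R"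
  obtain p_sdp p_eig p_svd :: "nat poly" where
    T: "\<And>S. sdp_wf S \<Longrightarrow> sdp_time R S \<le> poly p_sdp (sdp_size S)"
      "\<And>k A. sym_mat k A \<Longrightarrow> eig_time R A \<le> poly p_eig (k * k)"
      "\<And>r c A. A \<in> carrier_mat r c \<Longrightarrow> svd_time R A \<le> poly p_svd (r * c)"
    using A unfolding sdp_routine_def eig_routine_def svd_routine_def by metis
  obtain p :: "nat poly" where p: "\<And>n. algorithm_time p_sdp p_eig p_svd n \<le> poly p n"
    using poly_bounded_algorithm_time unfolding poly_bounded_def by blast
  show "\<exists>p :: nat poly. \<forall>(n :: nat) (P :: nat \<Rightarrow> real mat) (xh :: real vec).
       n \<ge> 2 \<and> cameras n P \<and> xh \<in> carrier_vec (2 * n) \<longrightarrow>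
       (\<exists>t s. exec R algorithm (input n P xh) t s \<and> t \<le> poly p n \<and>
          triangulation \<epsilon> n P xh (output_verdict s) (output_point s))"
  proof (intro exI[of _ p] allI impI)
    fix n :: nat and P :: "nat \<Rightarrow> real mat" and xh :: "real vec"
    assume "n \<ge> 2 \<and> cameras n P \<and> xh \<in> carrier_vec (2 * n)"
    then have "runs R algorithm (input n P xh) (algorithm_time p_sdp p_eig p_svd n)
        (\<lambda>s. triangulation \<epsilon> n P xh (output_verdict s) (output_point s))"
      using A T by (intro runs_algorithm) auto
    then show "\<exists>t s. exec R algorithm (input n P xh) t s \<and> t \<le> poly p n \<and>
        triangulation \<epsilon> n P xh (output_verdict s) (output_point s)"
      using p[of n] by (auto simp: runs_def intro: order_trans)
  qed
qed

end
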